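(* Fix $\alpha,\beta>0$ and $\xi\in(\mathrm{ri}\,\mathcal U)\setminus\{\xi^*\}$. Let $\kappa^\xi_{0,e_1}$ be the Doob-transformed transition probability of the i.i.d. Beta$(\alpha,\beta)$ random walk in random environment, and let $\lambda(\xi)$, $g_\lambda$, $\widetilde g_\lambda$ be as defined in the context. Then the random variable $\kappa^\xi_{0,e_1}$ is not beta distributed, and its density function $f^\xi(x)$ for $0<x<1$ is given by $$f^\xi(x)=\begin{cases}g_{\lambda(\xi)}(x),&\xi_1\in(\xi_1^*,1),\\ \widetilde g_{\lambda(\xi)}(x),&\xi_1\in(0,\xi_1^* ).\end{cases}$$
   Context: Let $e_1=(1,0)$, $e_2=(0,1)$, $|x|_1=|x_1|+|x_2|$. Fix $\alpha,\beta>0$. $\Omega=[0,1]^{\mathbb Z^2}$; under $\mathbb P$, $\omega_{x,x+e_1}$, $x\in\mathbb Z^2$, are i.i.d. Beta$(\alpha,\beta)$, and $\omega_{x,x+e_2}=1-\omega_{x,x+e_1}$. $P^\omega_x$ is the law of the Markov chain $(X_n)_{n\ge0}$ on $\mathbb Z^2$ with $X_0=x$ and $P^\omega_x(X_{n+1}=y+e_i\mid X_n=y)=\omega_{y,y+e_i}$. $\mathrm{ri}\,\mathcal U=\{te_1+(1-t)e_2:0<t<1\}$, $\xi=(\xi_1,\xi_2)$, $\xi^*=(\frac{\alpha}{\alpha+\beta},\frac{\beta}{\alpha+\beta})$. For each $\xi\in\mathrm{ri}\,\mathcal U$, the process $B^\xi$ is defined $\mathbb P$-a.s. by $$B^\xi_{x,y}(\omega)=\lim_{N\to\infty}\big(\log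 P^\omega_x\{X_{|z_N-x|_1}=z_N\}-\log P^\omega_y\{X_{|z_N-y|_1}=z_N\}\big),$$ where $z_N\in\mathbb Z^2$ is any sequence with $|z_N|_1\to\infty$, $z_N/|z_N|_1\to\xi$ (the paper proves that, $\mathbb P$-a.s., the limit exists for all $x,y$ and all such sequences and does not depend on the sequence). Set $\kappa^\xi_{x,x+e_i}(\omega)=\omega_{x,x+e_i}e^{-B^\xi_{x,x+e_i}(\omega)}$, $i\in\{1,2\}$; this is a transition probability. With $\psi_0=\Gamma'/\Gamma$, $\psi_1=\psi_0'$, for $\xi\in(\mathrm{ri}\,\mathcal U)\setminus\{\xi^*\}$ let $\lambda(\xi)\in(0,\infty)$ be the unique solution $\lambda$ of $$\xi_1=\frac{\psi_1(\lambda)-\psi_1(\alpha+\lambda)}{\psi_1(\lambda)-\psi_1(\alpha+\beta+\lambda)}\ \text{ if }\xi_1\in(\xi_1^*,1),\qquad \xi_1=1-\frac{\psi_1(\lambda)-\psi_1(\beta+\lambda)}{\psi_1(\lambda)-\psi_1(\alpha+\beta+\lambda)}\ \text{ if }\xi_1\in(0,\xi_1^* ).$$ $B(a,b)=\Gamma(a)\Gamma(b)/\Gamma(a+b)$ is the beta function, ${}_2F_1(a,b,c;z)=\sum_{k\ge0}\frac{(a)_k(b)_k}{(c)_k}\frac{z^k}{k!}$ is the Gauss hypergeometric function with $(c)_k=c(c+1)\cdots(c+k-1)$, and for $0<\lambda<\infty$, $0<x<1$, $$g_\lambda(x)=\frac{B(\alpha+\lambda,\alpha+\beta)}{B(\alpha+\lambda,\beta)}\cdot\frac{x^{\alpha-1}(1-x)^{\lambda-1}}{B(\lambda,\alpha)}\cdot{}_2F_1(\alpha+\lambda,\alpha+\lambda,2\alpha+\beta+\lambda;x),$$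 $$\widetilde g_\lambda(x)=\frac{B(\beta+\lambda,\alpha+\beta)}{B(\beta+\lambda,\alpha)}\cdot\frac{x^{\lambda-1}(1-x)^{\beta-1}}{B(\lambda,\beta)}\cdot{}_2F_1(\beta+\lambda,\beta+\lambda,\alpha+2\beta+\lambda;1-x).$$ *)

theory Defs
  imports "HOL-Probability.Probability"
begin

section \<open>Beta distributions and the random environment\<close>

definition beta_density :: "real \<Rightarrow> real \<Rightarrow> real \<Rightarrow> real" where
  "beta_density a b x =
     (if 0 < x \<and> x < 1 then x powr (a - 1) * (1 - x) powr (b - 1) / Beta a b else 0)"

definition beta_distribution :: "real \<Rightarrow> real \<Rightarrow> real measure" where
  "beta_distribution a b = density lborel (\<lambda>x. ennreal (beta_density a b x))"

lemma prob_space_beta_distribution: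
  assumes "0 < a" "0 < b"
  shows "prob_space (beta_distribution a b)"
proof
  have pos: "0 < Beta a b"
    using assms by (simp add: Beta_def Gamma_real_pos)
  have "((\<lambda>x. x powr (a - 1) * (1 - x) powr (b - 1) / Beta a b) has_integral 1) {0..1}"
    using has_integral_divide[OF has_integral_Beta_real[OF assms], of "Beta a b"] pos by simp
  then have "((\<lambda>x. beta_density a b x) has_integral 1) {0..1}"
    by (rule has_integral_spike_finite[where S = "{0, 1}", rotated 2]) (auto simp: beta_density_def)
  then have "((\<lambda>x. beta_density a b x) has_integral 1) UNIV"
    by (rule has_integral_on_superset) (auto simp: beta_density_def)
  moreover have "0 \<le> beta_density a b x" for x
    using pos by (simp add: beta_density_def)
  moreover have "(\<lambda>x. beta_density a b x) \<in> borel_measurable borel"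
    unfolding beta_density_def by measurable
  ultimately show "emeasure (beta_distribution a b) (space (beta_distribution a b)) = 1"
    using nn_integral_has_integral_lborel[of "beta_density a b" 1]
    by (simp add: beta_distribution_def emeasure_density)
qed

abbreviation e1 :: "int \<times> int" where "e1 \<equiv> (1, 0)"
abbreviation e2 :: "int \<times> int" where "e2 \<equiv> (0, 1)"

definition norm1 :: "int \<times> int \<Rightarrow> int" where
  "norm1 x = \<bar>fst x\<bar> + \<bar>snd x\<bar>"

text \<open>An environment is stored by its horizontal weights: \<open>\<omega> x\<close> is the weight of the edge
  from \<open>x\<close> to \<open>x + e1\<close>, and \<open>edge_weight\<close> recovers all nearest-neighbour weights.
  Coordinates are real-valued, but almost surely they all lie in the open unit interval.\<close>

type_synonym env = "int \<times> int \<Rightarrow> real"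

definition environment :: "real \<Rightarrow> real \<Rightarrow> env measure" where
  "environment \<alpha> \<beta> = PiM UNIV (\<lambda>_. beta_distribution \<alpha> \<beta>)"

definition edge_weight :: "env \<Rightarrow> int \<times> int \<Rightarrow> int \<times> int \<Rightarrow> real" where
  "edge_weight \<omega> x y = (if y = x + e1 then \<omega> x else if y = x + e2 then 1 - \<omega> x else 0)"


section \<open>The quenched walk\<close>

definition walk_step :: "env \<Rightarrow> int \<times> int \<Rightarrow> (int \<times> int) pmf" where
  "walk_step \<omega> y = map_pmf (\<lambda>b. if b then y + e1 else y + e2) (bernoulli_pmf (\<omega> y))"

text \<open>\<open>bernoulli_pmf\<close> truncates its parameter to the unit interval; on environments with values
  there the step distribution is exactly the one given by the edge weights.\<close>

lemma pmf_walk_step: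
  assumes "0 \<le> \<omega> y" "\<omega> y \<le> 1"
  shows "pmf (walk_step \<omega> y) w = edge_weight \<omega> y w"
proof -
  have "pmf (walk_step \<omega> y) w =
      measure (measure_pmf (bernoulli_pmf (\<omega> y))) ((\<lambda>b. if b then y + e1 else y + e2) -` {w})"
    by (simp add: walk_step_def pmf_map)
  also have "(\<lambda>b. if b then y + e1 else y + e2) -` {w} =
      (if w = y + e1 then {True} else if w = y + e2 then {False} else {})"
    by (auto split: if_splits)
  finally show ?thesis
    using assms by (auto simp: edge_weight_def measure_pmf_single)
qed

text \<open>Law on path space of the Markov chain in the environment \<open>\<omega>\<close> started at \<open>x\<close>, obtained from its
  one-step kernels by the Ionescu Tulcea theorem.\<close>

definition walk_kernel ::
    "env \<Rightarrow> int \<times> int \<Rightarrow> nat \<Rightarrow> (nat \<Rightarrow> int \<times> int) \<Rightarrow> (int \<times> int) measure" where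
  "walk_kernel \<omega> x n X =
     measure_pmf (case n of 0 \<Rightarrow> return_pmf x | Suc m \<Rightarrow> walk_step \<omega> (X m))"

definition walk_law :: "env \<Rightarrow> int \<times> int \<Rightarrow> (nat \<Rightarrow> int \<times> int) measure" where
  "walk_law \<omega> x =
     projective_family.lim UNIV
       (Ionescu_Tulcea.CI (walk_kernel \<omega> x) (\<lambda>_. count_space UNIV)) (\<lambda>_. count_space UNIV)"

lemma Ionescu_Tulcea_walk_kernel:
  "Ionescu_Tulcea (walk_kernel \<omega> x) (\<lambda>_. count_space UNIV)"
proof (rule Ionescu_Tulcea.intro)
  fix i :: nat
  show "walk_kernel \<omega> x i \<in>
      PiM {0..<i} (\<lambda>_. count_space UNIV) \<rightarrow>\<^sub>M subprob_algebra (count_space UNIV)"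
  proof (cases i)
    case 0
    then show ?thesis
      by (auto simp: walk_kernel_def[abs_def] space_subprob_algebra measure_pmf.subprob_space_axioms
          intro!: measurable_const)
  next
    case (Suc m)
    have "(\<lambda>X. X m) \<in> PiM {0..<i} (\<lambda>_. count_space (UNIV :: (int \<times> int) set)) \<rightarrow>\<^sub>M count_space UNIV"
      using Suc by (intro measurable_component_singleton) auto
    moreover have "(\<lambda>y. measure_pmf (walk_step \<omega> y)) \<in>
        count_space UNIV \<rightarrow>\<^sub>M subprob_algebra (count_space UNIV)"
      by (auto simp: space_subprob_algebra measure_pmf.subprob_space_axioms)
    ultimately show ?thesis
      using Suc by (simp add: walk_kernel_def[abs_def] measurable_compose)
  qed
next
  fix i :: nat and X :: "nat \<Rightarrow> int \<times> int"
  assume "X \<in> space (PiM {0..<i} (\<lambda>_. count_space UNIV))"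
  show "prob_space (walk_kernel \<omega> x i X)"
    by (simp add: walk_kernel_def measure_pmf.prob_space_axioms)
qed

lemma measure_walk_law_cylinder:
  "measure (walk_law \<omega> x) {X. \<forall>i\<le>n. X i = p i} =
     (if p 0 = x then \<Prod>i<n. pmf (walk_step \<omega> (p i)) (p (Suc i)) else 0)"
proof -
  define M :: "nat \<Rightarrow> (int \<times> int) measure" where "M = (\<lambda>_. count_space UNIV)"
  interpret IT: Ionescu_Tulcea "walk_kernel \<omega> x" M
    unfolding M_def by (rule Ionescu_Tulcea_walk_kernel)
  define r where "r n = restrict p {0..<n}" for n :: nat
  have sp: "r n \<in> space (PiM {0..<n} M)" for n
    by (auto simp: r_def M_def space_PiM)
  have st: "{r n} \<in> sets (PiM {0..<n} M)" for n
  proof -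
    have "{r n} = PiE {0..<n} (\<lambda>i. {p i})"
      unfolding r_def by (intro set_eqI) (auto simp: PiE_iff extensional_def fun_eq_iff)
    also have "\<dots> \<in> sets (PiM {0..<n} M)"
      by (intro sets_PiM_I_finite) (auto simp: M_def)
    finally show ?thesis .
  qed
  define k where "k n = (case n of 0 \<Rightarrow> return_pmf x | Suc m \<Rightarrow> walk_step \<omega> (p m))" for n
  have step: "emeasure (IT.eP n y) {r (Suc n)} =
      ennreal (pmf (k n) (p n)) * indicator {r n} y" if y: "y \<in> space (PiM {0..<n} M)" for n y
  proof -
    have ext: "y \<in> extensional {0..<n}" using y by (auto simp: space_PiM PiE_def)
    have "y(n := z) = r (Suc n) \<longleftrightarrow> y = r n \<and> z = p n" for z
    proof
      assume e: "y(n := z) = r (Suc n)"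
      have "y i = r n i" for i
        using fun_cong[OF e, of i] ext by (cases "i < n") (auto simp: r_def extensional_def)
      moreover have "z = p n" using fun_cong[OF e, of n] by (simp add: r_def)
      ultimately show "y = r n \<and> z = p n" by auto
    qed (auto simp: r_def fun_eq_iff)
    then have "(\<lambda>z. y(n := z)) -` {r (Suc n)} \<inter> space (M n) = (if y = r n then {p n} else {})"
      by (auto simp: M_def)
    moreover have "walk_kernel \<omega> x n (r n) = measure_pmf (k n)"
      by (cases n) (auto simp: walk_kernel_def k_def r_def)
    ultimately show ?thesis
      using IT.emeasure_eP[OF y st[of "Suc n"]] by (auto simp: emeasure_pmf_single)
  qed
  have C: "emeasure (IT.C 0 n (\<lambda>_. undefined)) {r n} = ennreal (\<Prod>i<n. pmf (k i) (p i))" for n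
  proof (induction n)
    case 0
    then show ?case using st[of 0] by (simp add: emeasure_return r_def restrict_def)
  next
    case (Suc n)
    have u: "(\<lambda>_. undefined) \<in> space (PiM {0..<0::nat} M)" by (simp add: space_PiM)
    have "emeasure (IT.C 0 (Suc n) (\<lambda>_. undefined)) {r (Suc n)} =
        (\<integral>\<^sup>+y. emeasure (IT.eP n y) {r (Suc n)} \<partial>IT.C 0 n (\<lambda>_. undefined))"
      using prob_space.not_empty[OF IT.prob_space_C[OF u, of n]] IT.sets_C[OF u, of n]
      by (simp, subst emeasure_bind[where N = "PiM {0..<Suc n} M"])
         (auto simp: st measurable_cong_sets[OF IT.sets_C[OF u, of n] refl])
    also have "\<dots> = (\<integral>\<^sup>+y. ennreal (pmf (k n) (p n)) * indicator {r n} y \<partial>IT.C 0 n (\<lambda>_. undefined))"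
      using IT.space_C[OF u, of n] by (intro nn_integral_cong step) auto
    also have "\<dots> = ennreal (pmf (k n) (p n)) * emeasure (IT.C 0 n (\<lambda>_. undefined)) {r n}"
      using IT.sets_C[OF u, of n] st[of n] by (intro nn_integral_cmult_indicator) simp
    finally show ?case
      using Suc by (simp add: ennreal_mult' mult.commute prod_nonneg)
  qed
  have "{X. \<forall>i\<le>n. X i = p i} = prod_emb UNIV M {0..<Suc n} {r (Suc n)}"
    by (auto simp: prod_emb_def r_def M_def space_PiM fun_eq_iff less_Suc_eq_le restrict_def) metis
  then have "emeasure (walk_law \<omega> x) {X. \<forall>i\<le>n. X i = p i} =
      emeasure (IT.CI {0..<Suc n}) {r (Suc n)}"
    using IT.lim[OF _ st[of "Suc n"]] by (simp add: walk_law_def M_def)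
  also have "\<dots> = emeasure (IT.C 0 (Suc n) (\<lambda>_. undefined)) {r (Suc n)}"
    using IT.emeasure_CI[OF subset_refl st[of "Suc n"]] sets.sets_into_space[OF st[of "Suc n"]]
    by (simp add: prod_emb_id space_PiM)
  also have "\<dots> = ennreal (\<Prod>i<Suc n. pmf (k i) (p i))"
    by (rule C)
  also have "(\<Prod>i<Suc n. pmf (k i) (p i)) =
      (if p 0 = x then \<Prod>i<n. pmf (walk_step \<omega> (p i)) (p (Suc i)) else 0)"
    unfolding prod.lessThan_Suc_shift by (auto simp: k_def pmf_return)
  finally show ?thesis
    by (simp add: measure_def prod_nonneg)
qed


section \<open>Busemann function and Doob transform\<close>

definition ri_U :: "(real \<times> real) set" where
  "ri_U = {(t, 1 - t) | t. 0 < t \<and> t < 1}"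

definition xi_star :: "real \<Rightarrow> real \<Rightarrow> real \<times> real" where
  "xi_star \<alpha> \<beta> = (\<alpha> / (\<alpha> + \<beta>), \<beta> / (\<alpha> + \<beta>))"

definition hit_prob :: "env \<Rightarrow> int \<times> int \<Rightarrow> int \<times> int \<Rightarrow> real" where
  "hit_prob \<omega> x z = measure (walk_law \<omega> x) {X. X (nat (norm1 (z - x))) = z}"

definition goes_in_direction :: "real \<times> real \<Rightarrow> (nat \<Rightarrow> int \<times> int) \<Rightarrow> bool" where
  "goes_in_direction \<xi> z \<longleftrightarrow>
     filterlim (\<lambda>N. norm1 (z N)) at_top sequentially \<and>
     (\<lambda>N. (real_of_int (fst (z N)) / real_of_int (norm1 (z N)),
           real_of_int (snd (z N)) / real_of_int (norm1 (z N)))) \<longlonglongrightarrow> \<xi>"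

text \<open>The common limit along all sequences of sites in direction \<open>\<xi>\<close>. The value is unspecified for
  environments in which there is no such common limit.\<close>

definition busemann ::
    "real \<times> real \<Rightarrow> int \<times> int \<Rightarrow> int \<times> int \<Rightarrow> env \<Rightarrow> real" where
  "busemann \<xi> x y \<omega> =
     (THE b. \<forall>z. goes_in_direction \<xi> z \<longrightarrow>
        (\<lambda>N. ln (hit_prob \<omega> x (z N)) - ln (hit_prob \<omega> y (z N))) \<longlonglongrightarrow> b)"

definition doob_kappa ::
    "real \<times> real \<Rightarrow> int \<times> int \<Rightarrow> int \<times> int \<Rightarrow> env \<Rightarrow> real" where
  "doob_kappa \<xi> x y \<omega> = edge_weight \<omega> x y * exp (- busemann \<xi> x y \<omega>)"


section \<open>The parameter and the densities\<close>

abbreviation psi1 :: "real \<Rightarrow> real" where "psi1 \<equiv> Polygamma 1"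

text \<open>Meaningful for \<open>\<xi>\<close> in \<open>ri_U - {xi_star \<alpha> \<beta>}\<close>, where the equation has a unique positive
  solution.\<close>

definition lambda_of :: "real \<Rightarrow> real \<Rightarrow> real \<times> real \<Rightarrow> real" where
  "lambda_of \<alpha> \<beta> \<xi> =
     (THE l. 0 < l \<and>
        fst \<xi> =
          (if fst (xi_star \<alpha> \<beta>) < fst \<xi>
           then (psi1 l - psi1 (\<alpha> + l)) / (psi1 l - psi1 (\<alpha> + \<beta> + l))
           else 1 - (psi1 l - psi1 (\<beta> + l)) / (psi1 l - psi1 (\<alpha> + \<beta> + l))))"

definition hyp2F1 :: "real \<Rightarrow> real \<Rightarrow> real \<Rightarrow> real \<Rightarrow> real" where
  "hyp2F1 a b c z =
     (\<Sum>k. pochhammer a k * pochhammer b k / pochhammer c k * (z ^ k / fact k))"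

definition g_density :: "real \<Rightarrow> real \<Rightarrow> real \<Rightarrow> real \<Rightarrow> real" where
  "g_density \<alpha> \<beta> l x =
     Beta (\<alpha> + l) (\<alpha> + \<beta>) / Beta (\<alpha> + l) \<beta>
     * (x powr (\<alpha> - 1) * (1 - x) powr (l - 1) / Beta l \<alpha>)
     * hyp2F1 (\<alpha> + l) (\<alpha> + l) (2 * \<alpha> + \<beta> + l) x"

definition g_tilde_density :: "real \<Rightarrow> real \<Rightarrow> real \<Rightarrow> real \<Rightarrow> real" where
  "g_tilde_density \<alpha> \<beta> l x =
     Beta (\<beta> + l) (\<alpha> + \<beta>) / Beta (\<beta> + l) \<alpha>
     * (x powr (l - 1) * (1 - x) powr (\<beta> - 1) / Beta l \<beta>)
     * hyp2F1 (\<beta> + l) (\<beta> + l) (\<alpha> + 2 * \<beta> + l) (1 - x)"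

end

theory Submission
  imports Defs "HOL-Real_Asymp.Real_Asymp"
begin

text \<open>By planarity, the ratios of neighbouring values of a positive harmonic function are monotone in the
  ratios on the boundary. This sandwiches the transition probability towards a far point \<open>z\<close> between
  the Doob transforms by harmonic functions whose boundary ratios are independent,
  \<open>Beta(\<alpha> + \<lambda>, \<beta>)\<close> horizontally and \<open>Beta(\<lambda>, \<alpha>)\<close> vertically. Such a model is stationary (Burke
  property): \<open>(\<omega>, W) \<mapsto> (I, W / I)\<close> with \<open>I = \<omega> + (1 - \<omega>) W\<close> maps \<open>Beta(\<alpha>, \<beta>) \<times> Beta(\<lambda>, \<alpha> + \<beta>)\<close> to
  \<open>Beta(\<alpha> + \<lambda>, \<beta>) \<times> Beta(\<lambda>, \<alpha>)\<close>, where \<open>W\<close> is the ratio of the harmonic function at the two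
  successors of a site.

  The mean logarithmic growth of the boundary values in direction \<open>(t, 1 - t)\<close> is governed by
  \<open>t (\<psi>\<^sub>0(\<alpha> + \<beta> + \<lambda>) - \<psi>\<^sub>0(\<alpha> + \<lambda>)) - (1 - t) (\<psi>\<^sub>0(\<alpha> + \<lambda>) - \<psi>\<^sub>0(\<lambda>))\<close>, which is strictly monotone on either
  side of the \<open>\<lambda>\<close> attached to \<open>t\<close>. Coupling a parameter with a second one on the same side and applying
  Chernoff bounds shows that one of the two boundaries carries almost all of the mass, so the
  parameters above and below bound the transition probability from the two sides. Letting them tend
  to \<open>\<lambda>\<close> forces the lower and upper limits along \<open>z\<close> to have the same law, hence to agree
  almost surely, and identifies the law as that of \<open>\<omega> / (\<omega> + (1 - \<omega>) W)\<close>. Its density is Euler's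
  integral for the hypergeometric function. It is not a beta density, since \<open>\<^sub>2F\<^sub>1(A, A, C; x)\<close>
  is a power of \<open>1 - x\<close> only if \<open>A = C\<close>. Directions below the characteristic one follow by
  reflection in the diagonal.\<close>

section \<open>Beta distributions\<close>

text \<open>Why the parameter \<lambda> itself is avoided: the error in the sandwich is small only
  if the auxiliary harmonic function has a larger drift than the main one, and \<lambda> is where
  the drift is maximal. Hence a main parameter l \<noteq> \<lambda> with an auxiliary one halfway to
  \<lambda>. The return to \<lambda> rests on a pointwise bound between beta densities whose
  constant tends to 1.

  Uniformity over infinitely many targets: the starting site stays at the far corner of an M by M
  box while the target moves. One random variable, of a law that does not depend on M, then bounds
  the transition probabilities towards all targets at once, and M can grow.

  The Busemann function is a definite description over uncountably many sequences of sites and has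
  some value even where the limit fails. Existence of the limit is therefore proved, along a
  decreasing sequence of cones around the direction. Convergence along these is a countable, hence
  measurable, condition equivalent to a common limit of all sequences.\<close>

lemma sets_beta_distribution [simp, measurable_cong]: "sets (beta_distribution a b) = sets borel"
  by (simp add: beta_distribution_def)

lemma space_beta_distribution [simp]: "space (beta_distribution a b) = UNIV"
  by (simp add: beta_distribution_def)

lemma beta_density_measurable [measurable]: "beta_density a b \<in> borel_measurable borel"
  unfolding beta_density_def by measurable

lemma Beta_real_pos: "0 < a \<Longrightarrow> 0 < b \<Longrightarrow> 0 < (Beta a b :: real)"
  by (simp add: Beta_def Gamma_real_pos)

lemma beta_density_nonneg: "0 < a \<Longrightarrow> 0 < b \<Longrightarrow> 0 \<le> beta_density a b x"
  using Beta_real_pos[of a b] by (simp add: beta_density_def)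

lemma nn_integral_beta_distribution:
  assumes "g \<in> borel_measurable borel"
  shows "(\<integral>\<^sup>+x. g x \<partial>beta_distribution a b) = (\<integral>\<^sup>+x. ennreal (beta_density a b x) * g x \<partial>lborel)"
  unfolding beta_distribution_def using assms by (intro nn_integral_density) auto

lemma AE_beta_distribution: "AE x in beta_distribution a b. 0 < x \<and> x < 1"
  unfolding beta_distribution_def
  by (subst AE_density) (auto simp: beta_density_def intro!: AE_I2 split: if_splits)

lemma powr_eq_exp_ln: "0 < x \<Longrightarrow> x powr (p::real) = exp (p * ln x)"
  by (simp add: powr_def)

section \<open>Dirichlet decomposition of a pair of independent beta variables\<close>

text \<open>The substitution is v = s + (1 - s) t, u = s / v. It is done by two affine substitutions
  in one variable, t to v at fixed s and then s to u at fixed v, with Fubini in between. Since 1 - v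
  = (1 - s) (1 - t), v is symmetric in s and t, so the rule serves twice: u is the ratio W / I if s
  = W, and the Doob weight \<omega> / I if s = \<omega>.\<close>

lemma nn_integral_unit_square_subst:
  fixes g :: "real \<Rightarrow> real \<Rightarrow> ennreal"
  assumes [measurable]: "case_prod g \<in> borel_measurable (borel \<Otimes>\<^sub>M borel)"
    and supp: "\<And>s t. \<not> (0 < s \<and> s < 1 \<and> 0 < t \<and> t < 1) \<Longrightarrow> g s t = 0"
  shows "(\<integral>\<^sup>+s. \<integral>\<^sup>+t. g s t \<partial>lborel \<partial>lborel) =
    (\<integral>\<^sup>+v. \<integral>\<^sup>+u. indicator ({0<..<1} \<times> {0<..<1}) (v, u)
       * (ennreal (v / (1 - v * u)) * g (v * u) ((v - v * u) / (1 - v * u))) \<partial>lborel \<partial>lborel)"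
proof -
  define k where "k s v = ennreal (1 / (1 - s)) * (indicator {0<..<1} s * g s ((v - s) / (1 - s)))" for s v
  have [measurable]: "case_prod k \<in> borel_measurable (borel \<Otimes>\<^sub>M borel)"
    unfolding k_def by measurable
  have 1: "(\<integral>\<^sup>+t. g s t \<partial>lborel) = (\<integral>\<^sup>+v. k s v \<partial>lborel)" for s
  proof (cases "0 < s \<and> s < 1")
    case True
    have "(\<integral>\<^sup>+t. g s t \<partial>lborel) = ennreal \<bar>1 / (1 - s)\<bar> *
        (\<integral>\<^sup>+v. g s (- s / (1 - s) + (1 / (1 - s)) * v) \<partial>lborel)"
      using True by (intro nn_integral_real_affine) auto
    also have "(\<lambda>v. - s / (1 - s) + (1 / (1 - s)) * v) = (\<lambda>v. (v - s) / (1 - s))"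
      by (auto simp: diff_divide_distrib)
    finally show ?thesis
      using True by (simp add: k_def nn_integral_cmult)
  next
    case False
    then show ?thesis by (auto simp: k_def supp)
  qed
  have 2: "(\<integral>\<^sup>+s. k s v \<partial>lborel) = (\<integral>\<^sup>+u. indicator ({0<..<1} \<times> {0<..<1}) (v, u)
       * (ennreal (v / (1 - v * u)) * g (v * u) ((v - v * u) / (1 - v * u))) \<partial>lborel)" for v
  proof (cases "0 < v \<and> v < 1")
    case True
    have "(\<integral>\<^sup>+s. k s v \<partial>lborel) = ennreal \<bar>v\<bar> * (\<integral>\<^sup>+u. k (0 + v * u) v \<partial>lborel)"
      using True by (intro nn_integral_real_affine) auto
    also have "\<dots> = (\<integral>\<^sup>+u. ennreal v * k (v * u) v \<partial>lborel)"
      using True by (simp add: nn_integral_cmult)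
    also have "\<dots> = (\<integral>\<^sup>+u. indicator ({0<..<1} \<times> {0<..<1}) (v, u)
       * (ennreal (v / (1 - v * u)) * g (v * u) ((v - v * u) / (1 - v * u))) \<partial>lborel)"
    proof (intro nn_integral_cong)
      fix u
      show "ennreal v * k (v * u) v = indicator ({0<..<1} \<times> {0<..<1}) (v, u)
       * (ennreal (v / (1 - v * u)) * g (v * u) ((v - v * u) / (1 - v * u)))"
      proof (cases "0 < v * u \<and> v * u < 1 \<and> 0 < (v - v * u) / (1 - v * u)")
        case t: True
        then have "v * u < v" using True by (auto simp: zero_less_divide_iff)
        then have u: "0 < u" "u < 1" using True t by (auto simp: zero_less_mult_iff)
        have "ennreal v * ennreal (1 / (1 - v * u)) = ennreal (v / (1 - v * u))"
          using True t by (subst ennreal_mult[symmetric]) auto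
        then show ?thesis using True t u by (simp add: k_def mult.assoc[symmetric])
      next
        case f: False
        have "\<not> (0 < u \<and> u < 1)"
        proof
          assume u: "0 < u \<and> u < 1"
          then have "v * u < v" "v * u < 1" "0 < v * u" using True
            by (auto simp: mult_less_cancel_left1 intro: less_trans[of "v * u" v 1])
          then show False using f by (auto simp: zero_less_divide_iff)
        qed
        moreover have "indicator {0<..<1} (v * u) * g (v * u) ((v - v * u) / (1 - v * u)) = 0"
          using f by (cases "0 < v * u \<and> v * u < 1") (auto simp: supp)
        ultimately show ?thesis using True by (auto simp: k_def)
      qed
    qed
    finally show ?thesis .
  next
    case False
    have "k s v = 0" for s
    proof (cases "0 < s \<and> s < 1")
      case True
      then have "\<not> (0 < (v - s) / (1 - s) \<and> (v - s) / (1 - s) < 1)"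
        using False by (auto simp: zero_less_divide_iff divide_less_eq)
      then show ?thesis by (simp add: k_def supp)
    qed (simp add: k_def)
    then show ?thesis using False by auto
  qed
  have "(\<integral>\<^sup>+s. \<integral>\<^sup>+t. g s t \<partial>lborel \<partial>lborel) = (\<integral>\<^sup>+s. \<integral>\<^sup>+v. k s v \<partial>lborel \<partial>lborel)"
    by (simp add: 1)
  also have "\<dots> = (\<integral>\<^sup>+v. \<integral>\<^sup>+s. k s v \<partial>lborel \<partial>lborel)"
    by (rule lborel_pair.Fubini') measurable
  finally show ?thesis by (simp add: 2)
qed

text \<open>Stick breaking: for s of law Beta(c, a + b) and t of law Beta(a, b), the vector (s, (1 -
  s) t, (1 - s) (1 - t)) has the Dirichlet(c, a, b) law. Here v is the sum of its first two entries
  and u their relative split. Both products of normalising constants equal Gamma(a) Gamma(b)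
  Gamma(c) / Gamma(a + b + c).\<close>

lemma beta_density_split:
  assumes "0 < a" "0 < b" "0 < c" "0 < u" "u < 1" "0 < v" "v < (1::real)"
  shows "v / (1 - v * u) * (beta_density c (a + b) (v * u) * beta_density a b ((v - v * u) / (1 - v * u)))
    = beta_density (a + c) b v * beta_density c a u"
proof -
  have uv: "0 < v * u" "v * u < v" "v * u < 1"
    using assms by (auto simp: mult_less_cancel_left1 intro: less_trans[of "v * u" v 1])
  have t: "0 < (v - v * u) / (1 - v * u)" "(v - v * u) / (1 - v * u) < 1"
    using uv assms by auto
  have e1: "1 - (v - v * u) / (1 - v * u) = (1 - v) / (1 - v * u)"
    using uv by (simp add: field_simps)
  have e2: "(v - v * u) = v * (1 - u)" by (simp add: algebra_simps)
  have B: "Beta c (a + b) * Beta a b = Beta (a + c) b * Beta c a"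
    using assms less_imp_neq[OF Gamma_real_pos[of "a + b"]] less_imp_neq[OF Gamma_real_pos[of "a + c"]]
    by (simp add: Beta_def add_ac)
  have "v / (1 - v * u) * ((v * u) powr (c - 1) * (1 - v * u) powr (a + b - 1) *
      (((v - v * u) / (1 - v * u)) powr (a - 1) * ((1 - v) / (1 - v * u)) powr (b - 1)))
     = v powr (a + c - 1) * (1 - v) powr (b - 1) * (u powr (c - 1) * (1 - u) powr (a - 1))"
  proof -
    \<comment> \<open>The three differences become free positive variables, so that every factor is
      the exponential of a sum of logarithms.\<close>
    have "v / D * ((v * u) powr (c - 1) * D powr (a + b - 1) * ((v * E / D) powr (a - 1) * (F / D) powr (b - 1)))
      = v powr (a + c - 1) * F powr (b - 1) * (u powr (c - 1) * E powr (a - 1))"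
      if "0 < D" "0 < E" "0 < F" for D E F :: real
    proof -
      have "v = exp (ln v)" "D = exp (ln D)" using assms that by auto
      then have "v / D = exp (ln v - ln D)" by (metis exp_diff)
      then show ?thesis
        using assms that
        by (simp add: powr_eq_exp_ln ln_mult ln_div exp_add[symmetric] algebra_simps)
    qed
    from this[of "1 - v * u" "1 - u" "1 - v"] show ?thesis
      using assms uv unfolding e2 by simp
  qed
  then have "v / (1 - v * u) * ((v * u) powr (c - 1) * (1 - v * u) powr (a + b - 1) *
      (((v - v * u) / (1 - v * u)) powr (a - 1) * ((1 - v) / (1 - v * u)) powr (b - 1)))
       / (Beta c (a + b) * Beta a b)
     = v powr (a + c - 1) * (1 - v) powr (b - 1) * (u powr (c - 1) * (1 - u) powr (a - 1))
       / (Beta (a + c) b * Beta c a)"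
    by (simp add: B)
  then show ?thesis
    using assms uv t unfolding beta_density_def e1 by (simp add: mult_ac)
qed

definition beta_split :: "real \<times> real \<Rightarrow> real \<times> real" where
  "beta_split p = (fst p + (1 - fst p) * snd p, snd p / (fst p + (1 - fst p) * snd p))"

lemma beta_split_measurable [measurable]: "beta_split \<in> borel \<Otimes>\<^sub>M borel \<rightarrow>\<^sub>M borel \<Otimes>\<^sub>M borel"
  unfolding beta_split_def[abs_def] by measurable

lemma sigma_finite_beta: "0 < a \<Longrightarrow> 0 < b \<Longrightarrow> sigma_finite_measure (beta_distribution a b)"
  by (intro prob_space_imp_sigma_finite prob_space_beta_distribution)

lemma nn_integral_beta_pair:
  assumes "0 < a" "0 < b" "0 < c" "0 < d" and F [measurable]: "F \<in> borel_measurable (borel \<Otimes>\<^sub>M borel)"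
  shows "(\<integral>\<^sup>+p. F p \<partial>(beta_distribution a b \<Otimes>\<^sub>M beta_distribution c d)) =
    (\<integral>\<^sup>+x. \<integral>\<^sup>+y. ennreal (beta_density a b x * beta_density c d y) * F (x, y) \<partial>lborel \<partial>lborel)"
proof -
  interpret B: sigma_finite_measure "beta_distribution c d"
    using assms by (intro sigma_finite_beta)
  have "(\<integral>\<^sup>+p. F p \<partial>(beta_distribution a b \<Otimes>\<^sub>M beta_distribution c d)) =
    (\<integral>\<^sup>+x. \<integral>\<^sup>+y. F (x, y) \<partial>beta_distribution c d \<partial>beta_distribution a b)"
    by (intro B.nn_integral_fst[symmetric]) measurable
  also have "\<dots> = (\<integral>\<^sup>+x. ennreal (beta_density a b x) *
      (\<integral>\<^sup>+y. ennreal (beta_density c d y) * F (x, y) \<partial>lborel) \<partial>lborel)"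
    by (simp add: nn_integral_beta_distribution)
  finally show ?thesis
    using assms by (simp add: nn_integral_cmult[symmetric] ennreal_mult beta_density_nonneg mult.assoc)
qed

lemma distr_beta_split:
  assumes "0 < a" "0 < b" "0 < c"
  shows "distr (beta_distribution a b \<Otimes>\<^sub>M beta_distribution c (a + b)) (borel \<Otimes>\<^sub>M borel) beta_split
    = beta_distribution (a + c) b \<Otimes>\<^sub>M beta_distribution c a" (is "?L = ?R")
proof (rule measure_eqI)
  show "sets ?L = sets ?R" by (simp cong: sets_pair_measure_cong)
  fix A assume "A \<in> sets ?L"
  then have A [measurable]: "A \<in> sets (borel \<Otimes>\<^sub>M borel)" by simp
  have "emeasure ?L A = (\<integral>\<^sup>+p. indicator A p \<partial>?L)"
    using A by simp
  also have "\<dots> = (\<integral>\<^sup>+p. indicator A (beta_split p) \<partial>(beta_distribution a b \<Otimes>\<^sub>M beta_distribution c (a + b)))"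
    by (intro nn_integral_distr) measurable
  also have "\<dots> = (\<integral>\<^sup>+x. \<integral>\<^sup>+y. ennreal (beta_density a b x * beta_density c (a + b) y)
      * indicator A (beta_split (x, y)) \<partial>lborel \<partial>lborel)"
    using assms by (intro nn_integral_beta_pair) auto
  also have "\<dots> = (\<integral>\<^sup>+y. \<integral>\<^sup>+x. ennreal (beta_density a b x * beta_density c (a + b) y)
      * indicator A (beta_split (x, y)) \<partial>lborel \<partial>lborel)"
    by (rule lborel_pair.Fubini') measurable
  also have "\<dots> = (\<integral>\<^sup>+v. \<integral>\<^sup>+u. indicator ({0<..<1} \<times> {0<..<1}) (v, u)
       * (ennreal (v / (1 - v * u)) * (ennreal (beta_density a b ((v - v * u) / (1 - v * u)) * beta_density c (a + b) (v * u))
      * indicator A (beta_split ((v - v * u) / (1 - v * u), v * u)))) \<partial>lborel \<partial>lborel)"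
    by (rule nn_integral_unit_square_subst) (measurable, auto simp: beta_density_def)
  also have "\<dots> = (\<integral>\<^sup>+v. \<integral>\<^sup>+u. ennreal (beta_density (a + c) b v * beta_density c a u) * indicator A (v, u) \<partial>lborel \<partial>lborel)"
  proof (intro nn_integral_cong)
    fix v u :: real
    show "indicator ({0<..<1} \<times> {0<..<1}) (v, u)
       * (ennreal (v / (1 - v * u)) * (ennreal (beta_density a b ((v - v * u) / (1 - v * u)) * beta_density c (a + b) (v * u))
      * indicator A (beta_split ((v - v * u) / (1 - v * u), v * u)))) =
      ennreal (beta_density (a + c) b v * beta_density c a u) * indicator A (v, u)"
    proof (cases "0 < v \<and> v < 1 \<and> 0 < u \<and> u < 1")
      case True
      then have uv: "v * u < 1"
        by (auto simp: mult_less_cancel_left1 intro: less_trans[of "v * u" v 1])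
      have v: "(v - v * u) / (1 - v * u) + (1 - (v - v * u) / (1 - v * u)) * (v * u) = v"
      proof -
        define q where "q = (v - v * u) / (1 - v * u)"
        have "q * (1 - v * u) = v - v * u" using uv by (simp add: q_def)
        then show ?thesis unfolding q_def[symmetric] by (simp add: algebra_simps)
      qed
      then have "beta_split ((v - v * u) / (1 - v * u), v * u) = (v, u)"
        unfolding beta_split_def fst_conv snd_conv v using True by simp
      moreover have "ennreal (v / (1 - v * u)) * ennreal (beta_density a b ((v - v * u) / (1 - v * u)) * beta_density c (a + b) (v * u))
         = ennreal (beta_density (a + c) b v * beta_density c a u)"
        using True uv beta_density_split[OF assms, of u v]
        by (subst ennreal_mult[symmetric]) (auto simp: mult_ac intro!: mult_nonneg_nonneg beta_density_nonneg add_pos_pos assms)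
      ultimately show ?thesis using True by (simp add: mult.assoc[symmetric])
    qed (auto simp: beta_density_def)
  qed
  also have "\<dots> = (\<integral>\<^sup>+p. indicator A p \<partial>?R)"
    using assms by (intro nn_integral_beta_pair[symmetric]) auto
  finally show "emeasure ?L A = emeasure ?R A"
    using A by (simp cong: sets_pair_measure_cong)
qed

text \<open>The inverse of \<open>beta_split\<close> on the open unit square: W is recovered as the
  product, and the weight by solving v = \<omega> + (1 - \<omega>) W.\<close>

definition beta_join :: "real \<times> real \<Rightarrow> real \<times> real" where
  "beta_join p = ((fst p - fst p * snd p) / (1 - fst p * snd p), fst p * snd p)"

lemma beta_join_measurable [measurable]: "beta_join \<in> borel \<Otimes>\<^sub>M borel \<rightarrow>\<^sub>M borel \<Otimes>\<^sub>M borel"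
  unfolding beta_join_def[abs_def] by measurable

lemma beta_join_split:
  assumes "0 < fst p" "fst p < 1" "0 < snd p" "snd p < 1"
  shows "beta_join (beta_split p) = p"
proof -
  define v where "v = fst p + (1 - fst p) * snd p"
  have v: "0 < v" using assms by (simp add: v_def add_pos_pos)
  have "v - snd p = fst p * (1 - snd p)" by (simp add: v_def algebra_simps)
  then have "(v - snd p) / (1 - snd p) = fst p" using assms by simp
  moreover have "beta_split p = (v, snd p / v)" by (simp add: beta_split_def v_def)
  ultimately show ?thesis using v by (simp add: beta_join_def prod_eq_iff)
qed

lemma AE_beta_pair:
  assumes "0 < a" "0 < b" "0 < c" "0 < d"
  shows "AE p in beta_distribution a b \<Otimes>\<^sub>M beta_distribution c d.
    0 < fst p \<and> fst p < 1 \<and> 0 < snd p \<and> snd p < 1"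
proof -
  interpret A: prob_space "beta_distribution a b" using assms by (intro prob_space_beta_distribution)
  interpret B: prob_space "beta_distribution c d" using assms by (intro prob_space_beta_distribution)
  interpret P: pair_sigma_finite "beta_distribution a b" "beta_distribution c d" ..
  show ?thesis
  proof (rule P.AE_pair_measure)
    show "AE x in beta_distribution a b. AE y in beta_distribution c d.
      0 < fst (x, y) \<and> fst (x, y) < 1 \<and> 0 < snd (x, y) \<and> snd (x, y) < 1"
      using AE_beta_distribution[of a b]
    proof eventually_elim
      case (elim x)
      then show ?case using AE_beta_distribution[of c d] by simp
    qed
  qed measurable
qed

lemma distr_beta_join:
  assumes "0 < a" "0 < b" "0 < c"
  shows "distr (beta_distribution (a + c) b \<Otimes>\<^sub>M beta_distribution c a) (borel \<Otimes>\<^sub>M borel) beta_join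
    = beta_distribution a b \<Otimes>\<^sub>M beta_distribution c (a + b)"
proof -
  let ?P = "beta_distribution a b \<Otimes>\<^sub>M beta_distribution c (a + b)"
  have s: "sets ?P = sets (borel \<Otimes>\<^sub>M borel)" by (simp cong: sets_pair_measure_cong)
  have "distr (beta_distribution (a + c) b \<Otimes>\<^sub>M beta_distribution c a) (borel \<Otimes>\<^sub>M borel) beta_join
      = distr ?P (borel \<Otimes>\<^sub>M borel) (beta_join \<circ> beta_split)"
    unfolding distr_beta_split[OF assms, symmetric] by (intro distr_distr) measurable
  also have "\<dots> = distr ?P (borel \<Otimes>\<^sub>M borel) (\<lambda>x. x)"
  proof (rule distr_cong_AE)
    show "AE p in ?P. (beta_join \<circ> beta_split) p = p"
      using AE_beta_pair[OF assms(1,2,3) add_pos_pos[OF assms(1,2)]]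
      by eventually_elim (simp add: beta_join_split)
  qed (simp_all, measurable)
  also have "\<dots> = ?P" using s by (intro distr_id2) simp
  finally show ?thesis .
qed

text \<open>\<open>beta_join p\<close> resolves the incoming pair into independent x of law Beta(a,
  b) and W of law Beta(c, a + b). The outgoing pair is formed from W and the weight w, and x takes
  the place of w. Passing the cell thus exchanges two independent Beta(a, b) variables, which is
  Fubini.\<close>

lemma burke_nn_integral:
  assumes "0 < a" "0 < b" "0 < c" and F [measurable]: "F \<in> borel_measurable ((borel \<Otimes>\<^sub>M borel) \<Otimes>\<^sub>M borel)"
  defines "N \<equiv> beta_distribution (a + c) b \<Otimes>\<^sub>M beta_distribution c a"
  shows "(\<integral>\<^sup>+w. \<integral>\<^sup>+p. F (beta_split (w, snd (beta_join p)), fst (beta_join p)) \<partial>N \<partial>beta_distribution a b)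
    = (\<integral>\<^sup>+w. \<integral>\<^sup>+p. F (p, w) \<partial>N \<partial>beta_distribution a b)"
proof -
  let ?A = "beta_distribution a b" and ?C = "beta_distribution c (a + b)"
  interpret A: prob_space ?A using assms by (intro prob_space_beta_distribution)
  interpret C: prob_space ?C using assms by (intro prob_space_beta_distribution) auto
  interpret AA: pair_sigma_finite ?A ?A ..
  have N: "sets N = sets (borel \<Otimes>\<^sub>M borel)" unfolding N_def by (simp cong: sets_pair_measure_cong)
  have "(\<integral>\<^sup>+w. \<integral>\<^sup>+p. F (beta_split (w, snd (beta_join p)), fst (beta_join p)) \<partial>N \<partial>?A)
    = (\<integral>\<^sup>+w. \<integral>\<^sup>+q. F (beta_split (w, snd q), fst q) \<partial>(?A \<Otimes>\<^sub>M ?C) \<partial>?A)"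
    unfolding distr_beta_join[OF assms(1-3), symmetric] N_def
    by (intro nn_integral_cong, subst nn_integral_distr) measurable
  also have "\<dots> = (\<integral>\<^sup>+w. \<integral>\<^sup>+x. \<integral>\<^sup>+y. F (beta_split (w, y), x) \<partial>?C \<partial>?A \<partial>?A)"
    by (intro nn_integral_cong, subst C.nn_integral_fst[symmetric]) measurable
  also have "\<dots> = (\<integral>\<^sup>+x. \<integral>\<^sup>+w. \<integral>\<^sup>+y. F (beta_split (w, y), x) \<partial>?C \<partial>?A \<partial>?A)"
    by (rule AA.Fubini') measurable
  also have "\<dots> = (\<integral>\<^sup>+x. \<integral>\<^sup>+q. F (beta_split q, x) \<partial>(?A \<Otimes>\<^sub>M ?C) \<partial>?A)"
    by (intro nn_integral_cong, subst C.nn_integral_fst[symmetric]) measurable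
  also have "\<dots> = (\<integral>\<^sup>+x. \<integral>\<^sup>+p. F (p, x) \<partial>N \<partial>?A)"
    unfolding N_def distr_beta_split[OF assms(1-3), symmetric]
    by (intro nn_integral_cong, subst nn_integral_distr) measurable
  finally show ?thesis .
qed

lemma distr_snd_prob:
  assumes "prob_space M" "sigma_finite_measure N" and [measurable_cong]: "sets N = sets K"
  shows "distr (M \<Otimes>\<^sub>M N) K snd = N"
proof -
  interpret M: prob_space M by fact
  interpret N: sigma_finite_measure N by fact
  interpret P: pair_sigma_finite M N ..
  show ?thesis
  proof (rule measure_eqI)
    fix A assume "A \<in> sets (distr (M \<Otimes>\<^sub>M N) K snd)"
    then have A: "A \<in> sets K" "A \<in> sets N" using assms(3) by auto
    have e: "snd -` A \<inter> space (M \<Otimes>\<^sub>M N) = space M \<times> A"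
      using sets.sets_into_space[OF A(2)] by (auto simp: space_pair_measure)
    have "emeasure (distr (M \<Otimes>\<^sub>M N) K snd) A = emeasure (M \<Otimes>\<^sub>M N) (space M \<times> A)"
      using A by (subst emeasure_distr) (simp_all add: e)
    then show "emeasure (distr (M \<Otimes>\<^sub>M N) K snd) A = emeasure N A"
      using A by (simp add: N.emeasure_pair_measure_Times M.emeasure_space_1)
  qed (simp add: assms)
qed

text \<open>The product is the second entry of \<open>beta_join\<close>, so its law is read off from
  the joint law.\<close>

lemma distr_beta_mult:
  assumes "0 < a" "0 < b" "0 < c"
  shows "distr (beta_distribution (a + c) b \<Otimes>\<^sub>M beta_distribution c a) borel (\<lambda>p. fst p * snd p)
    = beta_distribution c (a + b)"
proof -
  let ?P = "beta_distribution a b \<Otimes>\<^sub>M beta_distribution c (a + b)"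
  have "distr ?P borel snd = beta_distribution c (a + b)"
    using assms by (intro distr_snd_prob prob_space_beta_distribution sigma_finite_beta) auto
  then show ?thesis
    unfolding distr_beta_join[OF assms, symmetric]
    by (subst (asm) distr_distr) (measurable, simp add: comp_def beta_join_def)
qed

lemma distr_beta_reflect:
  assumes "0 < a" "0 < b"
  shows "distr (beta_distribution a b) borel (\<lambda>x. 1 - x) = beta_distribution b a" (is "?L = ?R")
proof (rule measure_eqI)
  fix A assume "A \<in> sets ?L"
  then have A [measurable]: "A \<in> sets borel" by simp
  have [simp]: "beta_density a b (1 - x) = beta_density b a x" for x
    by (auto simp: beta_density_def Beta_commute[of a b])
  have "emeasure ?L A = (\<integral>\<^sup>+x. indicator A x \<partial>?L)" by simp
  also have "\<dots> = (\<integral>\<^sup>+x. indicator A (1 - x) \<partial>beta_distribution a b)"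
    by (intro nn_integral_distr) measurable
  also have "\<dots> = (\<integral>\<^sup>+x. ennreal (beta_density a b x) * indicator A (1 - x) \<partial>lborel)"
    by (intro nn_integral_beta_distribution) measurable
  also have "\<dots> = (\<integral>\<^sup>+x. ennreal (beta_density a b (1 + (-1) * x)) * indicator A (1 - (1 + (-1) * x)) \<partial>lborel)"
    by (subst nn_integral_real_affine[where c = "-1" and t = 1]) auto
  also have "\<dots> = (\<integral>\<^sup>+x. indicator A x \<partial>?R)"
    by (subst nn_integral_beta_distribution) auto
  finally show "emeasure ?L A = emeasure ?R A" by simp
qed simp

section \<open>Monotone coupling and power moments of beta laws\<close>

text \<open>For y of law Beta(b, p) and an independent x of law Beta(p + b, q - p) the product x y
  has law Beta(b, q). Since x y \<le> y, the complements 1 - x y of law Beta(q, b) and 1 - y of law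
  Beta(p, b) are ordered.\<close>

definition beta_coupling :: "real \<Rightarrow> real \<Rightarrow> real \<Rightarrow> (real \<times> real) measure" where
  "beta_coupling p q b = distr (beta_distribution (p + b) (q - p) \<Otimes>\<^sub>M beta_distribution b p)
     (borel \<Otimes>\<^sub>M borel) (\<lambda>x. (1 - fst x * snd x, 1 - snd x))"

lemma beta_coupling:
  assumes "0 < p" "p < q" "0 < b"
  shows "sets (beta_coupling p q b) = sets (borel \<Otimes>\<^sub>M borel)"
    and "prob_space (beta_coupling p q b)"
    and "distr (beta_coupling p q b) borel fst = beta_distribution q b"
    and "distr (beta_coupling p q b) borel snd = beta_distribution p b"
    and "AE x in beta_coupling p q b. snd x \<le> fst x"
proof -
  let ?A = "beta_distribution (p + b) (q - p)" and ?B = "beta_distribution b p"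
  interpret A: prob_space ?A using assms by (intro prob_space_beta_distribution) auto
  interpret B: prob_space ?B using assms by (intro prob_space_beta_distribution) auto
  interpret P: pair_prob_space ?A ?B ..
  show s: "sets (beta_coupling p q b) = sets (borel \<Otimes>\<^sub>M borel)" by (simp add: beta_coupling_def)
  show "prob_space (beta_coupling p q b)"
    unfolding beta_coupling_def by (intro P.prob_space_distr) measurable
  have "distr (beta_coupling p q b) borel fst = distr (?A \<Otimes>\<^sub>M ?B) borel (\<lambda>x. 1 - fst x * snd x)"
    unfolding beta_coupling_def by (subst distr_distr) (measurable, simp add: comp_def)
  also have "\<dots> = distr (distr (?A \<Otimes>\<^sub>M ?B) borel (\<lambda>x. fst x * snd x)) borel (\<lambda>x. 1 - x)"
    by (subst distr_distr) (measurable, simp add: comp_def)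
  also have "distr (?A \<Otimes>\<^sub>M ?B) borel (\<lambda>x. fst x * snd x) = beta_distribution b q"
    using distr_beta_mult[of p "q - p" b] assms by simp
  also have "distr (beta_distribution b q) borel (\<lambda>x. 1 - x) = beta_distribution q b"
    using assms by (intro distr_beta_reflect) auto
  finally show "distr (beta_coupling p q b) borel fst = beta_distribution q b" .
  have "distr (beta_coupling p q b) borel snd = distr (?A \<Otimes>\<^sub>M ?B) borel (\<lambda>x. 1 - snd x)"
    unfolding beta_coupling_def by (subst distr_distr) (measurable, simp add: comp_def)
  also have "\<dots> = distr (distr (?A \<Otimes>\<^sub>M ?B) borel snd) borel (\<lambda>x. 1 - x)"
    by (subst distr_distr) (measurable, simp add: comp_def)
  also have "distr (?A \<Otimes>\<^sub>M ?B) borel snd = ?B"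
    by (intro distr_snd_prob A.prob_space_axioms B.sigma_finite_measure_axioms) simp
  also have "distr ?B borel (\<lambda>x. 1 - x) = beta_distribution p b"
    using assms by (intro distr_beta_reflect) auto
  finally show "distr (beta_coupling p q b) borel snd = beta_distribution p b" .
  have ae: "AE p in ?A \<Otimes>\<^sub>M ?B. 0 < fst p \<and> fst p < 1 \<and> 0 < snd p \<and> snd p < 1"
    by (rule AE_beta_pair) (use assms in auto)
  have "AE x in ?A \<Otimes>\<^sub>M ?B. snd (1 - fst x * snd x, 1 - snd x) \<le> fst (1 - fst x * snd x, 1 - snd x)"
    using ae by eventually_elim (simp add: mult_left_le_one_le)
  then show "AE x in beta_coupling p q b. snd x \<le> fst x"
    unfolding beta_coupling_def by (subst AE_distr_iff) measurable
qed

text \<open>The factor x powr t shifts the first parameter of the density. Negative t is included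
  because lower-tail estimates use it.\<close>

lemma nn_integral_beta_powr:
  assumes "0 < a" "0 < b" "0 < a + t"
  shows "(\<integral>\<^sup>+x. ennreal (x powr t) \<partial>beta_distribution a b) = ennreal (Beta (a + t) b / Beta a b)"
proof -
  interpret prob_space "beta_distribution (a + t) b" using assms by (intro prob_space_beta_distribution) auto
  have pos: "0 < Beta a b" "0 < Beta (a + t) b" using assms by (auto intro: Beta_real_pos)
  have "(\<integral>\<^sup>+x. ennreal (x powr t) \<partial>beta_distribution a b)
      = (\<integral>\<^sup>+x. ennreal (beta_density a b x) * ennreal (x powr t) \<partial>lborel)"
    by (intro nn_integral_beta_distribution) measurable
  also have "\<dots> = (\<integral>\<^sup>+x. ennreal (Beta (a + t) b / Beta a b) * ennreal (beta_density (a + t) b x) \<partial>lborel)"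
  proof (intro nn_integral_cong)
    fix x :: real
    have "beta_density a b x * x powr t = Beta (a + t) b / Beta a b * beta_density (a + t) b x"
      using pos by (auto simp: beta_density_def powr_add[symmetric] field_simps)
    then show "ennreal (beta_density a b x) * ennreal (x powr t)
        = ennreal (Beta (a + t) b / Beta a b) * ennreal (beta_density (a + t) b x)"
      using pos assms beta_density_nonneg[of a b x] beta_density_nonneg[of "a + t" b x]
      by (simp add: ennreal_mult[symmetric] flip: ennreal_mult)
  qed
  also have "\<dots> = ennreal (Beta (a + t) b / Beta a b) * (\<integral>\<^sup>+x. 1 \<partial>beta_distribution (a + t) b)"
    by (subst nn_integral_beta_distribution) (auto simp: nn_integral_cmult)
  finally show ?thesis using emeasure_space_1 by simp
qed

section \<open>The hypergeometric density\<close>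

lemma not_nonpos_Ints_real: "0 < (x::real) \<Longrightarrow> x \<notin> \<int>\<^sub>\<le>\<^sub>0"
  by (auto elim!: nonpos_Ints_cases)

lemma Beta_ratio_pochhammer:
  assumes "0 < A" "0 < (D::real)"
  shows "Beta (A + real k) D / Beta A D = pochhammer A k / pochhammer (A + D) k"
proof -
  have "Gamma x \<noteq> 0" if "0 < x" for x :: real using Gamma_real_pos[OF that] by simp
  then have "Gamma A \<noteq> 0" "Gamma D \<noteq> 0" "Gamma (A + D) \<noteq> 0" "Gamma (A + real k) \<noteq> 0" "Gamma (A + D + real k) \<noteq> 0"
    using assms by (auto simp: add_pos_nonneg)
  then show ?thesis
    using assms by (simp add: Beta_def pochhammer_Gamma not_nonpos_Ints_real add_ac)
qed

lemma binomial_series_neg: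
  assumes "\<bar>z\<bar> < (1::real)"
  shows "(\<lambda>k. pochhammer s k / fact k * z ^ k) sums (1 - z) powr (- s)"
proof -
  have "((- s) gchoose k) * (- z) ^ k = pochhammer s k / fact k * z ^ k" for k
  proof -
    have "(- 1) ^ k * (- 1) ^ k = (1 :: real)" by (simp flip: power_mult_distrib)
    moreover have "((- s) gchoose k) * (- z) ^ k = ((- 1) ^ k * (- 1) ^ k) * (pochhammer s k / fact k * z ^ k)"
      unfolding gbinomial_pochhammer power_minus[of z k] by simp
    ultimately show ?thesis by simp
  qed
  then show ?thesis using gen_binomial_real[of "- z" "- s"] assms by simp
qed

text \<open>The binomial series of (1 - x v) powr (- A) has nonnegative terms, so it may be
  integrated termwise; the k-th moment of Beta(A, D) supplies the quotient of Pochhammer symbols.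
  Summability comes for free, since the integral is at most (1 - x) powr (- A).\<close>

lemma hyp2F1_euler:
  assumes "0 < A" "0 < D" "0 \<le> x" "x < 1"
  shows "(\<integral>\<^sup>+v. ennreal ((1 - x * v) powr (- A)) \<partial>beta_distribution A D) = ennreal (hyp2F1 A A (A + D) x)"
    and "summable (\<lambda>k. pochhammer A k * pochhammer A k / pochhammer (A + D) k * (x ^ k / fact k))"
proof -
  interpret prob_space "beta_distribution A D" using assms by (intro prob_space_beta_distribution) auto
  define t where "t k = pochhammer A k * pochhammer A k / pochhammer (A + D) k * (x ^ k / fact k)" for k
  have t: "0 \<le> t k" for k
    using assms by (auto simp: t_def intro!: mult_nonneg_nonneg divide_nonneg_nonneg pochhammer_nonneg)
  define q where "q k = pochhammer A k / fact k * x ^ k" for k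
  have q: "0 \<le> q k" for k using assms by (auto simp: q_def intro!: mult_nonneg_nonneg divide_nonneg_nonneg pochhammer_nonneg)
  have xv: "x * v < 1" if "0 < v" "v < 1" for v
  proof -
    have "x * v \<le> 1 * v" using assms that by (intro mult_right_mono) auto
    then show ?thesis using that by linarith
  qed
  have "(\<integral>\<^sup>+v. ennreal ((1 - x * v) powr (- A)) \<partial>beta_distribution A D)
      = (\<integral>\<^sup>+v. (\<Sum>k. ennreal (q k) * ennreal (v powr real k)) \<partial>beta_distribution A D)"
  proof (intro nn_integral_cong_AE)
    show "AE v in beta_distribution A D. ennreal ((1 - x * v) powr - A) = (\<Sum>k. ennreal (q k) * ennreal (v powr real k))"
      using AE_beta_distribution
    proof eventually_elim
      case (elim v)
      then have "(\<lambda>k. q k * v powr real k) sums (1 - x * v) powr (- A)"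
        using binomial_series_neg[of "x * v" A] xv[of v] assms
        by (simp add: q_def powr_realpow power_mult_distrib mult_ac)
      then have "(\<Sum>k. ennreal (q k * v powr real k)) = ennreal ((1 - x * v) powr (- A))"
        using q by (intro suminf_ennreal_eq) auto
      then show ?case using q by (simp add: ennreal_mult)
    qed
  qed
  also have "\<dots> = (\<Sum>k. ennreal (q k) * (\<integral>\<^sup>+v. ennreal (v powr real k) \<partial>beta_distribution A D))"
    by (subst nn_integral_suminf) (auto simp: nn_integral_cmult)
  also have "\<dots> = (\<Sum>k. ennreal (t k))"
  proof (intro suminf_cong)
    fix k
    have "q k * (pochhammer A k / pochhammer (A + D) k) = t k" by (simp add: q_def t_def mult_ac)
    moreover have "0 \<le> pochhammer A k / pochhammer (A + D) k"
      using assms by (auto intro!: divide_nonneg_nonneg pochhammer_nonneg)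
    ultimately show "ennreal (q k) * (\<integral>\<^sup>+v. ennreal (v powr real k) \<partial>beta_distribution A D) = ennreal (t k)"
      using assms q by (subst nn_integral_beta_powr) (auto simp: Beta_ratio_pochhammer ennreal_mult[symmetric])
  qed
  finally have eq: "(\<integral>\<^sup>+v. ennreal ((1 - x * v) powr (- A)) \<partial>beta_distribution A D) = (\<Sum>k. ennreal (t k))" .
  have "(\<integral>\<^sup>+v. ennreal ((1 - x * v) powr (- A)) \<partial>beta_distribution A D)
      \<le> (\<integral>\<^sup>+v. ennreal ((1 - x) powr (- A)) \<partial>beta_distribution A D)"
  proof (intro nn_integral_mono_AE)
    show "AE v in beta_distribution A D. ennreal ((1 - x * v) powr - A) \<le> ennreal ((1 - x) powr - A)"
      using AE_beta_distribution
    proof eventually_elim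
      case (elim v)
      then have "x * v \<le> x" using assms by (intro mult_left_le) auto
      then show ?case using assms by (intro ennreal_leI powr_mono2') auto
    qed
  qed
  also have "\<dots> < top" using emeasure_space_1 by simp
  finally have "(\<Sum>k. ennreal (t k)) \<noteq> top" unfolding eq by simp
  then have sm: "summable t" using t by (intro summable_suminf_not_top) auto
  then show "summable (\<lambda>k. pochhammer A k * pochhammer A k / pochhammer (A + D) k * (x ^ k / fact k))"
    unfolding t_def .
  have "(\<Sum>k. ennreal (t k)) = ennreal (\<Sum>k. t k)"
    using sm t by (intro suminf_ennreal_eq) (auto simp: summable_sums)
  then show "(\<integral>\<^sup>+v. ennreal ((1 - x * v) powr (- A)) \<partial>beta_distribution A D) = ennreal (hyp2F1 A A (A + D) x)"
    unfolding eq hyp2F1_def t_def .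
qed

lemma hyp2F1_summable:
  assumes "0 < A" "0 < D" "\<bar>x\<bar> < (1::real)"
  shows "summable (\<lambda>k. pochhammer A k * pochhammer A k / (pochhammer (A + D) k * fact k) * x ^ k)"
proof -
  obtain y where y: "\<bar>x\<bar> < y" "y < 1" using dense[of "\<bar>x\<bar>" 1] assms(3) by auto
  have "summable (\<lambda>k. pochhammer A k * pochhammer A k / (pochhammer (A + D) k * fact k) * y ^ k)"
    using hyp2F1_euler(2)[of A D y] assms y by simp
  then show ?thesis using y by (rule_tac powser_inside) auto
qed

lemma hyp2F1_altdef:
  "hyp2F1 A A C x = (\<Sum>k. pochhammer A k * pochhammer A k / (pochhammer C k * fact k) * x ^ k)"
  by (simp add: hyp2F1_def)

lemma isCont_hyp2F1:
  assumes "0 < A" "0 < D" "\<bar>x\<bar> < (1::real)"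
  shows "isCont (hyp2F1 A A (A + D)) x"
proof -
  obtain y where y: "\<bar>x\<bar> < y" "y < 1" using dense[of "\<bar>x\<bar>" 1] assms(3) by auto
  have "isCont (\<lambda>x. \<Sum>k. pochhammer A k * pochhammer A k / (pochhammer (A + D) k * fact k) * x ^ k) x"
    using y by (intro isCont_powser[where K = y] hyp2F1_summable assms) auto
  moreover have "hyp2F1 A A (A + D) = (\<lambda>x. \<Sum>k. pochhammer A k * pochhammer A k / (pochhammer (A + D) k * fact k) * x ^ k)"
    by (intro ext hyp2F1_altdef)
  ultimately show ?thesis by (simp only:)
qed

section \<open>Law of the Doob weight for an independent weight and ratio\<close>

definition kappa_density :: "real \<Rightarrow> real \<Rightarrow> real \<Rightarrow> real \<Rightarrow> real" where
  "kappa_density a b c x = (if 0 < x \<and> x < 1 then g_density a b c x else 0)"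

text \<open>The Doob weight of the horizontal step, in terms of the site's weight w and the ratio r
  of the harmonic function at the vertical successor to that at the horizontal one.\<close>

definition kappa_of :: "real \<Rightarrow> real \<Rightarrow> real" where
  "kappa_of w r = w / (w + (1 - w) * r)"

lemma kappa_of_measurable [measurable]:
  assumes [measurable]: "f \<in> borel_measurable M" "g \<in> borel_measurable M"
  shows "(\<lambda>x. kappa_of (f x) (g x)) \<in> borel_measurable M"
  unfolding kappa_of_def by measurable

lemma continuous_on_kappa_density:
  assumes "0 < a" "0 < b" "0 < c"
  shows "continuous_on {0<..<1} (kappa_density a b c)"
proof -
  have "continuous_on {0<..<1} (hyp2F1 (a + c) (a + c) (2 * a + b + c))"
    using isCont_hyp2F1[of "a + c" "a + b"] assms
    by (intro continuous_at_imp_continuous_on) (auto simp: algebra_simps mult_2)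
  then have "continuous_on {0<..<1} (g_density a b c)"
    unfolding g_density_def[abs_def] using assms
    by (intro continuous_intros) (auto simp: Beta_real_pos less_imp_neq[OF Beta_real_pos, symmetric])
  then show ?thesis
    by (rule continuous_on_eq) (auto simp: kappa_density_def)
qed

lemma kappa_density_measurable [measurable]:
  assumes "0 < a" "0 < b" "0 < c"
  shows "kappa_density a b c \<in> borel_measurable borel"
proof -
  have "(\<lambda>x. indicator {0<..<1} x *\<^sub>R kappa_density a b c x) \<in> borel_measurable borel"
    using continuous_on_kappa_density[OF assms]
    by (intro borel_measurable_continuous_on_indicator) auto
  moreover have "(\<lambda>x. indicator {0<..<1} x *\<^sub>R kappa_density a b c x) = kappa_density a b c"
    by (auto simp: kappa_density_def indicator_def)
  ultimately show ?thesis by simp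
qed

lemma kappa_integrand:
  assumes "0 < a" "0 < b" "0 < c" "0 < x" "x < 1" "0 < v" "v < (1::real)"
  shows "v / (1 - v * x) * (beta_density a b (v * x) * beta_density c (a + b) ((v - v * x) / (1 - v * x)))
    = (Beta (a + c) (a + b) / (Beta (a + c) b * Beta c a) * x powr (a - 1) * (1 - x) powr (c - 1))
      * (beta_density (a + c) (a + b) v * (1 - x * v) powr (- (a + c)))"
proof -
  have xv: "0 < v * x" "v * x < v" "v * x < 1"
    using assms by (auto simp: mult_less_cancel_left1 intro: less_trans[of "v * x" v 1])
  have t: "0 < (v - v * x) / (1 - v * x)" "(v - v * x) / (1 - v * x) < 1"
    using xv assms by auto
  have e1: "1 - (v - v * x) / (1 - v * x) = (1 - v) / (1 - v * x)"
    using xv by (simp add: field_simps)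
  have e2: "(v - v * x) = v * (1 - x)" by (simp add: algebra_simps)
  have B: "Beta a b * Beta c (a + b) = Beta (a + c) b * Beta c a"
    using assms less_imp_neq[OF Gamma_real_pos[of "a + b"]] less_imp_neq[OF Gamma_real_pos[of "a + c"]]
    by (simp add: Beta_def add_ac)
  have B': "0 < Beta (a + c) (a + b)" using assms by (intro Beta_real_pos) auto
  have main: "v / (1 - v * x) * ((v * x) powr (a - 1) * (1 - v * x) powr (b - 1) *
      (((v - v * x) / (1 - v * x)) powr (c - 1) * ((1 - v) / (1 - v * x)) powr (a + b - 1)))
     = x powr (a - 1) * (1 - x) powr (c - 1) * (v powr (a + c - 1) * (1 - v) powr (a + b - 1) * (1 - x * v) powr (- (a + c)))"
  proof -
    have "v / G * ((v * x) powr (a - 1) * G powr (b - 1) * ((v * E / G) powr (c - 1) * (F / G) powr (a + b - 1)))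
      = x powr (a - 1) * E powr (c - 1) * (v powr (a + c - 1) * F powr (a + b - 1) * G powr (- (a + c)))"
      if "0 < G" "0 < E" "0 < F" for G E F :: real
    proof -
      have "v = exp (ln v)" "G = exp (ln G)" using assms that by auto
      then have "v / G = exp (ln v - ln G)" by (metis exp_diff)
      then show ?thesis
        using assms that
        by (simp add: powr_eq_exp_ln ln_mult ln_div exp_add[symmetric] algebra_simps)
    qed
    from this[of "1 - v * x" "1 - x" "1 - v"] show ?thesis
      using assms xv unfolding e2 by (simp add: mult.commute[of x v])
  qed
  have "v / (1 - v * x) * (beta_density a b (v * x) * beta_density c (a + b) ((v - v * x) / (1 - v * x)))
     = v / (1 - v * x) * ((v * x) powr (a - 1) * (1 - v * x) powr (b - 1) *
      (((v - v * x) / (1 - v * x)) powr (c - 1) * ((1 - v) / (1 - v * x)) powr (a + b - 1)))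
      / (Beta a b * Beta c (a + b))"
    using assms xv t unfolding beta_density_def e1 by simp
  also have "\<dots> = (Beta (a + c) (a + b) / (Beta (a + c) b * Beta c a) * x powr (a - 1) * (1 - x) powr (c - 1))
      * (beta_density (a + c) (a + b) v * (1 - x * v) powr (- (a + c)))"
    unfolding main B using assms B' by (simp add: beta_density_def)
  finally show ?thesis .
qed

text \<open>With s the weight, the substitution of \<open>nn_integral_unit_square_subst\<close>
  makes u the Doob weight x itself. What depends on v is a Beta(a + c, a + b) density times (1 - x
  v) powr (- (a + c)), and integrating it out is Euler's integral.\<close>

lemma distr_kappa_of:
  assumes "0 < a" "0 < b" "0 < c"
  shows "distr (beta_distribution a b \<Otimes>\<^sub>M beta_distribution c (a + b)) borel (\<lambda>p. kappa_of (fst p) (snd p))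
    = density lborel (\<lambda>x. ennreal (kappa_density a b c x))" (is "?L = ?R")
proof (rule measure_eqI)
  show "sets ?L = sets ?R" by simp
  fix A assume "A \<in> sets ?L"
  then have A [measurable]: "A \<in> sets borel" by simp
  note [measurable] = kappa_density_measurable[OF assms]
  define K where "K x = Beta (a + c) (a + b) / (Beta (a + c) b * Beta c a) * x powr (a - 1) * (1 - x) powr (c - 1)" for x
  have [measurable]: "K \<in> borel_measurable borel" unfolding K_def by measurable
  have K0: "0 \<le> K x" for x
    using assms by (auto simp: K_def intro!: mult_nonneg_nonneg divide_nonneg_nonneg less_imp_le[OF Beta_real_pos])
  have "emeasure ?L A = (\<integral>\<^sup>+x. indicator A x \<partial>?L)"
    using A by simp
  also have "\<dots> = (\<integral>\<^sup>+p. indicator A (kappa_of (fst p) (snd p)) \<partial>(beta_distribution a b \<Otimes>\<^sub>M beta_distribution c (a + b)))"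
    by (intro nn_integral_distr) measurable
  also have "\<dots> = (\<integral>\<^sup>+x. \<integral>\<^sup>+y. ennreal (beta_density a b x * beta_density c (a + b) y)
      * indicator A (kappa_of x y) \<partial>lborel \<partial>lborel)"
    using assms by (subst nn_integral_beta_pair) auto
  also have "\<dots> = (\<integral>\<^sup>+v. \<integral>\<^sup>+x. indicator ({0<..<1} \<times> {0<..<1}) (v, x)
       * (ennreal (v / (1 - v * x)) * (ennreal (beta_density a b (v * x) * beta_density c (a + b) ((v - v * x) / (1 - v * x)))
      * indicator A (kappa_of (v * x) ((v - v * x) / (1 - v * x))))) \<partial>lborel \<partial>lborel)"
    by (rule nn_integral_unit_square_subst) (measurable, auto simp: beta_density_def)
  also have "\<dots> = (\<integral>\<^sup>+v. \<integral>\<^sup>+x. (indicator {0<..<1} x * ennreal (K x) * indicator A x)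
      * (ennreal (beta_density (a + c) (a + b) v) * ennreal ((1 - x * v) powr (- (a + c)))) \<partial>lborel \<partial>lborel)"
  proof (intro nn_integral_cong)
    fix v x :: real
    show "indicator ({0<..<1} \<times> {0<..<1}) (v, x)
       * (ennreal (v / (1 - v * x)) * (ennreal (beta_density a b (v * x) * beta_density c (a + b) ((v - v * x) / (1 - v * x)))
      * indicator A (kappa_of (v * x) ((v - v * x) / (1 - v * x))))) =
      (indicator {0<..<1} x * ennreal (K x) * indicator A x)
      * (ennreal (beta_density (a + c) (a + b) v) * ennreal ((1 - x * v) powr (- (a + c))))"
    proof (cases "0 < v \<and> v < 1 \<and> 0 < x \<and> x < 1")
      case True
      then have vx: "v * x < 1"
        by (auto simp: mult_less_cancel_left1 intro: less_trans[of "v * x" v 1])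
      have "v * x + (1 - v * x) * ((v - v * x) / (1 - v * x)) = v"
        using vx by (simp add: field_simps)
      then have k: "kappa_of (v * x) ((v - v * x) / (1 - v * x)) = x"
        unfolding kappa_of_def using True by simp
      have "ennreal (v / (1 - v * x)) * ennreal (beta_density a b (v * x) * beta_density c (a + b) ((v - v * x) / (1 - v * x)))
         = ennreal (v / (1 - v * x) * (beta_density a b (v * x) * beta_density c (a + b) ((v - v * x) / (1 - v * x))))"
        using True vx
        by (subst ennreal_mult[symmetric]) (auto intro!: mult_nonneg_nonneg beta_density_nonneg add_pos_pos assms)
      also have "\<dots> = ennreal (K x * (beta_density (a + c) (a + b) v * (1 - x * v) powr (- (a + c))))"
        using True assms by (subst kappa_integrand) (auto simp: K_def)
      also have "\<dots> = ennreal (K x) * (ennreal (beta_density (a + c) (a + b) v) * ennreal ((1 - x * v) powr (- (a + c))))"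
        using K0 assms by (simp add: ennreal_mult beta_density_nonneg)
      finally show ?thesis using True k by (simp add: mult_ac)
    qed (auto simp: beta_density_def)
  qed
  also have "\<dots> = (\<integral>\<^sup>+x. \<integral>\<^sup>+v. (indicator {0<..<1} x * ennreal (K x) * indicator A x)
      * (ennreal (beta_density (a + c) (a + b) v) * ennreal ((1 - x * v) powr (- (a + c)))) \<partial>lborel \<partial>lborel)"
    by (rule lborel_pair.Fubini') measurable
  also have "\<dots> = (\<integral>\<^sup>+x. (indicator {0<..<1} x * ennreal (K x) * indicator A x)
      * (\<integral>\<^sup>+v. ennreal ((1 - x * v) powr (- (a + c))) \<partial>beta_distribution (a + c) (a + b)) \<partial>lborel)"
    by (intro nn_integral_cong) (simp add: nn_integral_cmult nn_integral_beta_distribution)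
  also have "\<dots> = (\<integral>\<^sup>+x. ennreal (kappa_density a b c x) * indicator A x \<partial>lborel)"
  proof (intro nn_integral_cong)
    fix x :: real
    show "(indicator {0<..<1} x * ennreal (K x) * indicator A x)
      * (\<integral>\<^sup>+v. ennreal ((1 - x * v) powr (- (a + c))) \<partial>beta_distribution (a + c) (a + b))
      = ennreal (kappa_density a b c x) * indicator A x"
    proof (cases "0 < x \<and> x < 1")
      case True
      have "ennreal (K x) * ennreal (hyp2F1 (a + c) (a + c) (a + c + (a + b)) x) = ennreal (g_density a b c x)"
      proof -
        have e: "a + c + (a + b) = 2 * a + b + c" by simp
        have "K x * hyp2F1 (a + c) (a + c) (2 * a + b + c) x = g_density a b c x"
          by (simp add: K_def g_density_def)
        then show ?thesis unfolding e using K0 by (simp add: ennreal_mult'[symmetric])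
      qed
      note KH = this
      have H: "(\<integral>\<^sup>+v. ennreal ((1 - x * v) powr (- (a + c))) \<partial>beta_distribution (a + c) (a + b))
          = ennreal (hyp2F1 (a + c) (a + c) (a + c + (a + b)) x)"
        using True assms by (intro hyp2F1_euler(1)) auto
      have "indicator {0<..<1} x * ennreal (K x) * indicator A x * ennreal (hyp2F1 (a + c) (a + c) (a + c + (a + b)) x)
        = indicator A x * (ennreal (K x) * ennreal (hyp2F1 (a + c) (a + c) (a + c + (a + b)) x))"
        using True by (simp add: mult_ac)
      then show ?thesis unfolding H KH using True by (simp add: kappa_density_def mult.commute)
    qed (auto simp: kappa_density_def)
  qed
  also have "\<dots> = emeasure ?R A" by (simp add: emeasure_density)
  finally show "emeasure ?L A = emeasure ?R A" .
qed

section \<open>Separation from the beta family\<close>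

text \<open>The limit at 0 from the right is the constant coefficient; after division by x the
  shifted series satisfies the same hypotheses.\<close>

lemma powser_zero_on_unit_interval:
  fixes e :: "nat \<Rightarrow> real"
  assumes "\<And>x. \<bar>x\<bar> < 1 \<Longrightarrow> summable (\<lambda>n. e n * x ^ n)"
    and "\<And>x. 0 < x \<Longrightarrow> x < 1 \<Longrightarrow> (\<Sum>n. e n * x ^ n) = 0"
  shows "e n = 0"
  using assms
proof (induction n arbitrary: e)
  have e0: "e 0 = 0" if sm: "\<And>x. \<bar>x\<bar> < 1 \<Longrightarrow> summable (\<lambda>n. e n * x ^ n)"
    and z: "\<And>x. 0 < x \<Longrightarrow> x < 1 \<Longrightarrow> (\<Sum>n. e n * x ^ n) = 0" for e :: "nat \<Rightarrow> real"
  proof -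
    have "((\<lambda>x. \<Sum>n. e n * x ^ n) \<longlongrightarrow> e 0) (at 0)"
      using sm by (intro powser_limit_0[where s = 1]) (auto intro: summable_sums)
    then have "((\<lambda>x. \<Sum>n. e n * x ^ n) \<longlongrightarrow> e 0) (at_right 0)"
      by (rule filterlim_mono) (auto simp: at_le)
    moreover have "\<forall>\<^sub>F x in at_right 0. (\<Sum>n. e n * x ^ n) = 0"
      using z by (auto simp: eventually_at_right[of 0 1] intro!: exI[of _ 1])
    ultimately have "((\<lambda>x. 0) \<longlongrightarrow> e 0) (at_right (0::real))"
      by (rule Lim_transform_eventually)
    then show ?thesis by (simp add: tendsto_const_iff)
  qed
  {
    case 0
    then show ?case by (rule e0)
  next
    case (Suc n)
    have "e 0 = 0" using Suc.prems by (rule e0)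
    have sm: "summable (\<lambda>n. e (Suc n) * x ^ n)" if "\<bar>x\<bar> < 1" for x
    proof (cases "x = 0")
      case False
      have "summable (\<lambda>n. e (Suc n) * x ^ Suc n)" using Suc.prems(1)[OF that] by (subst summable_Suc_iff)
      then have "summable (\<lambda>n. inverse x * (e (Suc n) * x ^ Suc n))" by (rule summable_mult)
      moreover have "(\<lambda>n. inverse x * (e (Suc n) * x ^ Suc n)) = (\<lambda>n. e (Suc n) * x ^ n)"
        using False by (auto simp: field_simps)
      ultimately show ?thesis by (simp only:)
    qed (auto intro!: summable_finite[of "{0}"])
    have "(\<Sum>n. e (Suc n) * x ^ n) = 0" if "0 < x" "x < 1" for x
    proof -
      have "0 = (\<Sum>n. e n * x ^ n)" using Suc.prems(2)[of x] that by simp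
      also have "\<dots> = (\<Sum>n. e (Suc n) * x ^ Suc n) + e 0 * x ^ 0"
        using Suc.prems(1)[of x] that by (intro suminf_split_head[symmetric, unfolded diff_eq_eq] suminf_split_initial_segment[where k = 1, simplified]) auto
      also have "\<dots> = (\<Sum>n. x * (e (Suc n) * x ^ n))" using \<open>e 0 = 0\<close> by (simp add: mult_ac)
      also have "\<dots> = x * (\<Sum>n. e (Suc n) * x ^ n)" using sm[of x] that by (intro suminf_mult) auto
      finally show ?thesis using that by simp
    qed
    with sm show ?case by (intro Suc.IH[of "\<lambda>n. e (Suc n)"]) auto
  }
qed

text \<open>The coefficients of orders one and two decide. With C = A + D the first forces s = A^2 /
  C, and then the second becomes (A - C)^2 = 0, against D > 0.\<close>

lemma hyp2F1_not_power:
  assumes "0 < A" "0 < D"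
  shows "\<exists>x. 0 < x \<and> x < 1 \<and> hyp2F1 A A (A + D) x \<noteq> (1 - x) powr (- s)"
proof (rule ccontr)
  assume "\<not> ?thesis"
  then have eq: "hyp2F1 A A (A + D) x = (1 - x) powr (- s)" if "0 < x" "x < 1" for x
    using that by blast
  define C where "C = A + D"
  define c where "c k = pochhammer A k * pochhammer A k / (pochhammer C k * fact k)" for k
  define d where "d k = pochhammer s k / fact k" for k
  have c: "summable (\<lambda>k. c k * x ^ k)" if "\<bar>x\<bar> < 1" for x
    using hyp2F1_summable[OF assms that] by (simp add: c_def C_def)
  have d: "(\<lambda>k. d k * x ^ k) sums (1 - x) powr (- s)" if "\<bar>x\<bar> < 1" for x
    using binomial_series_neg[OF that] by (simp add: d_def)
  have z: "c k - d k = 0" for k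
  proof (rule powser_zero_on_unit_interval)
    fix x :: real assume "\<bar>x\<bar> < 1"
    then show "summable (\<lambda>n. (c n - d n) * x ^ n)"
      using summable_diff[OF c[of x] sums_summable[OF d[of x]]] by (simp add: left_diff_distrib)
  next
    fix x :: real assume x: "0 < x" "x < 1"
    then have "(\<lambda>n. c n * x ^ n - d n * x ^ n) sums (hyp2F1 A A C x - (1 - x) powr (- s))"
      using c[of x] d[of x] unfolding hyp2F1_altdef[of A C x] c_def[symmetric]
      by (intro sums_diff summable_sums) auto
    then show "(\<Sum>n. (c n - d n) * x ^ n) = 0"
      using eq[OF x] by (simp add: left_diff_distrib sums_iff C_def)
  qed
  have C: "0 < C" using assms by (simp add: C_def)
  have s: "s = A * A / C"
    using z[of 1] by (simp add: c_def d_def)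
  have "A * (A + 1) * (A * (A + 1)) / (C * (C + 1) * 2) = s * (s + 1) / 2"
    using z[of 2] by (simp add: c_def d_def eval_nat_numeral pochhammer_rec' mult_ac)
  then have 2: "A * (A + 1) * (A * (A + 1)) = s * (s + 1) * (C * (C + 1))"
    using C by (simp add: divide_eq_eq)
  have sC: "s * C = A * A" using s C by simp
  have "A * (A + 1) * (A * (A + 1)) * (C * C) = (s * C) * (s * C + C) * (C * (C + 1))"
    unfolding 2 by (simp add: algebra_simps)
  then have "A * (A + 1) * (A * (A + 1)) * (C * C) = (A * A) * (A * A + C) * (C * (C + 1))"
    unfolding sC .
  then have "(A * A * C) * ((A + 1) * (A + 1) * C - (A * A + C) * (C + 1)) = 0"
    by (simp add: algebra_simps)
  then have "(A + 1) * (A + 1) * C - (A * A + C) * (C + 1) = 0" using assms C by simp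
  then have "(A - C) * (A - C) = 0" by (simp add: algebra_simps)
  then show False using assms by (simp add: C_def)
qed

lemma tendsto_powr_at_right_0:
  assumes "((\<lambda>x. k * x powr e) \<longlongrightarrow> 1) (at_right (0::real))"
  shows "e = 0 \<and> k = 1"
proof -
  have "e = 0"
  proof (rule ccontr)
    assume "e \<noteq> 0"
    then consider "0 < e" | "e < 0" by linarith
    then show False
    proof cases
      case 1
      then have "((\<lambda>x. k * x powr e) \<longlongrightarrow> 0) (at_right (0::real))" by real_asymp
      then show False using tendsto_unique[OF _ assms] by fastforce
    next
      case 2
      have "((\<lambda>x::real. x powr (- e)) \<longlongrightarrow> 0) (at_right 0)" using 2 by real_asymp
      then have "((\<lambda>x. k * x powr e * x powr (- e)) \<longlongrightarrow> 1 * 0) (at_right 0)"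
        by (intro tendsto_mult assms)
      moreover have "\<forall>\<^sub>F x in at_right 0. k * x powr e * x powr (- e) = k"
        by (auto simp: eventually_at_right[of 0 1] powr_minus intro!: exI[of _ 1])
      ultimately have "((\<lambda>x. k) \<longlongrightarrow> 1 * 0) (at_right (0::real))" by (rule Lim_transform_eventually)
      then have "k = 0" using tendsto_unique[OF _ tendsto_const[of k "at_right (0::real)"]] by fastforce
      then show False using assms tendsto_unique[OF _ tendsto_const[of 0 "at_right (0::real)"]] by fastforce
    qed
  qed
  moreover from this have "((\<lambda>x. k) \<longlongrightarrow> 1) (at_right (0::real))"
    using assms by (rule_tac Lim_transform_eventually) (auto simp: eventually_at_right[of 0 1] intro!: exI[of _ 1])
  then have "k = 1" using tendsto_unique[OF _ tendsto_const[of k "at_right (0::real)"]] by fastforce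
  ultimately show ?thesis by simp
qed

text \<open>After cancelling common powers, the hypergeometric factor would be k x^(p - a) (1 -
  x)^(q - c). Its value 1 at 0 forces p = a and k = 1, and what remains is a pure power of 1 -
  x.\<close>

lemma g_density_not_beta:
  assumes "0 < a" "0 < b" "0 < c" "0 < p" "0 < q"
  shows "\<exists>x. 0 < x \<and> x < 1 \<and> g_density a b c x \<noteq> beta_density p q x"
proof (rule ccontr)
  assume "\<not> ?thesis"
  then have eq: "g_density a b c x = beta_density p q x" if "0 < x" "x < 1" for x
    using that by blast
  define h where "h = hyp2F1 (a + c) (a + c) (a + c + (a + b))"
  define K where "K = Beta (a + c) (a + b) / (Beta (a + c) b * Beta c a)"
  have K: "0 < K" using assms by (simp add: K_def Beta_real_pos)
  define k where "k = 1 / (K * Beta p q)"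
  have e: "2 * a + b + c = a + c + (a + b)" by simp
  have h: "h x = k * x powr (p - a) * (1 - x) powr (q - c)" if x: "0 < x" "x < 1" for x
  proof -
    have "K * (x powr (a - 1) * (1 - x) powr (c - 1)) * h x = x powr (p - 1) * (1 - x) powr (q - 1) / Beta p q"
      using eq[OF x] x by (simp add: g_density_def beta_density_def K_def h_def e)
    moreover have "x powr (p - 1) = x powr (a - 1) * x powr (p - a)" "(1 - x) powr (q - 1) = (1 - x) powr (c - 1) * (1 - x) powr (q - c)"
      by (simp_all add: powr_add[symmetric])
    ultimately show ?thesis
      using K x Beta_real_pos[of p q] assms by (simp add: k_def field_simps)
  qed
  have h0: "h 0 = 1" unfolding h_def hyp2F1_altdef powser_zero by simp
  have "isCont h 0" unfolding h_def using assms by (intro isCont_hyp2F1) auto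
  then have "(h \<longlongrightarrow> 1) (at 0)" by (simp add: isCont_def h0)
  then have "(h \<longlongrightarrow> 1) (at_right 0)" by (rule filterlim_mono) (auto simp: at_le)
  moreover have "((\<lambda>x::real. (1 - x) powr (c - q)) \<longlongrightarrow> (1 - 0) powr (c - q)) (at_right 0)"
    by (intro tendsto_intros) auto
  ultimately have "((\<lambda>x. h x * (1 - x) powr (c - q)) \<longlongrightarrow> 1 * (1 - 0) powr (c - q)) (at_right 0)"
    by (rule tendsto_mult)
  moreover have "\<forall>\<^sub>F x in at_right 0. h x * (1 - x) powr (c - q) = k * x powr (p - a)"
  proof -
    have "h x * (1 - x) powr (c - q) = k * x powr (p - a)" if "0 < x" "x < 1" for x
      using h[OF that] that by (simp add: powr_diff field_simps)
    then show ?thesis by (auto simp: eventually_at_right[of 0 1] intro!: exI[of _ 1])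
  qed
  ultimately have "((\<lambda>x. k * x powr (p - a)) \<longlongrightarrow> 1) (at_right 0)"
    by (rule_tac Lim_transform_eventually) auto
  then have "p - a = 0 \<and> k = 1" by (rule tendsto_powr_at_right_0)
  then have "h x = (1 - x) powr (- (c - q))" if "0 < x" "x < 1" for x
    using h[OF that] that by simp
  then show False using hyp2F1_not_power[of "a + c" "a + b" "c - q"] assms by (auto simp: h_def)
qed

text \<open>The densities agree almost everywhere. A difference at one point would persist, by
  continuity, on a nonempty open set, which is not negligible.\<close>

lemma density_eq_imp_eq_on_open:
  fixes f g :: "real \<Rightarrow> real"
  assumes [measurable]: "f \<in> borel_measurable borel" "g \<in> borel_measurable borel"
    and nn: "\<And>x. 0 \<le> f x" "\<And>x. 0 \<le> g x"
    and S: "open S" "continuous_on S f" "continuous_on S g"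
    and fin: "finite_measure (density lborel (\<lambda>x. ennreal (f x)))"
    and eq: "density lborel (\<lambda>x. ennreal (f x)) = density lborel (\<lambda>x. ennreal (g x))"
    and "x \<in> S"
  shows "f x = g x"
proof (rule ccontr)
  assume ne: "f x \<noteq> g x"
  have "(\<integral>\<^sup>+x. ennreal (f x) \<partial>lborel) = emeasure (density lborel (\<lambda>x. ennreal (f x))) UNIV"
    by (simp add: emeasure_density)
  also have "\<dots> \<noteq> \<infinity>" using finite_measure.emeasure_finite[OF fin] by simp
  finally have "AE x in lborel. ennreal (f x) = ennreal (g x)"
    using eq by (intro finite_density_unique[THEN iffD1]) auto
  then have ae: "AE x in lborel. f x = g x" by eventually_elim (use nn in auto)
  define T where "T = S \<inter> (\<lambda>x. f x - g x) -` (- {0})"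
  have "open T" unfolding T_def using S
    by (intro continuous_open_preimage continuous_on_diff) auto
  have "x \<in> T" using \<open>x \<in> S\<close> ne by (simp add: T_def)
  have "{x \<in> space lborel. \<not> f x = g x} \<in> null_sets lborel"
    using ae by (subst (asm) AE_iff_null) auto
  then have "T \<in> null_sets lborel"
    using \<open>open T\<close> by (rule_tac null_sets_subset) (auto simp: T_def)
  then have "negligible T" by (simp add: negligible_iff_null_sets null_sets_completionI)
  with open_not_negligible[OF \<open>open T\<close>] \<open>x \<in> T\<close> show False by auto
qed

section \<open>Polygamma functions and the characteristic direction\<close>

lemma Polygamma_sum:
  assumes "0 < (x::real)" "n > 0"
  shows "(\<lambda>k. inverse ((x + real k) ^ Suc n)) sums (Polygamma n x * (-1) ^ Suc n / fact n)"
proof -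
  have "summable (\<lambda>k. inverse ((x + real k) ^ Suc n))"
    using assms by (intro Polygamma_converges') auto
  then have "(\<lambda>k. inverse ((x + real k) ^ Suc n)) sums (\<Sum>k. inverse ((x + real k) ^ Suc n))"
    by (rule summable_sums)
  also have "(\<Sum>k. inverse ((x + real k) ^ Suc n)) = Polygamma n x * (-1) ^ Suc n / fact n"
    using assms unfolding Polygamma_def by (simp flip: power_mult_distrib del: power_Suc)
  finally show ?thesis .
qed

lemma Polygamma_DERIV:
  assumes "0 < (x::real)" shows "(Polygamma n has_field_derivative Polygamma (Suc n) x) (at x within A)"
  using assms by (intro derivative_intros) (auto elim!: nonpos_Ints_cases)

lemma Polygamma_DERIV_shift:
  assumes "0 < (x::real)" "0 \<le> h"
  shows "((\<lambda>x. Polygamma n (h + x)) has_field_derivative Polygamma (Suc n) (h + x)) (at x within A)"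
proof -
  have "(Polygamma n has_field_derivative Polygamma (Suc n) (h + x)) (at (h + x))"
    using assms by (intro Polygamma_DERIV) auto
  moreover have "((\<lambda>x. h + x) has_field_derivative 1) (at x within A)"
    by (auto intro!: derivative_eq_intros)
  ultimately show ?thesis
    using DERIV_chain2[where f = "Polygamma n" and g = "\<lambda>x. h + x"] by fastforce
qed

text \<open>Up to sign and factorials the three values are the sums of (x + k)^(-n - 1) for n = 2,
  3, 4. The Cauchy-Schwarz inequality for these sums turns into the claim with a factor 36 / 48 from
  the factorials, and this factor gives strictness.\<close>

lemma Polygamma_cauchy_schwarz:
  assumes "0 < (x::real)"
  shows "(Polygamma 3 x)\<^sup>2 < Polygamma 2 x * Polygamma 4 x"
proof -
  define S where "S n = Polygamma n x * (-1) ^ Suc n / fact n" for n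
  have S: "(\<lambda>k. inverse ((x + real k) ^ Suc n)) sums S n" if "n > 0" for n
    unfolding S_def using assms that by (rule Polygamma_sum)
  have S4: "0 < S 4" using Polygamma_real_even_neg[of x 4] assms by (simp add: S_def divide_neg_pos)
  have "0 \<le> S 2 - 2 * t * S 3 + t\<^sup>2 * S 4" for t
  proof -
    have "(\<lambda>k. inverse ((x + real k) ^ Suc 2) - 2 * t * inverse ((x + real k) ^ Suc 3) + t\<^sup>2 * inverse ((x + real k) ^ Suc 4))
      sums (S 2 - 2 * t * S 3 + t\<^sup>2 * S 4)"
      by (intro sums_add sums_diff sums_mult S) auto
    moreover have "inverse ((x + real k) ^ Suc 2) - 2 * t * inverse ((x + real k) ^ Suc 3) + t\<^sup>2 * inverse ((x + real k) ^ Suc 4)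
        = inverse (x + real k) ^ 3 * (1 - t * inverse (x + real k))\<^sup>2" for k
    proof -
      have "i ^ Suc 2 - 2 * t * i ^ Suc 3 + t\<^sup>2 * i ^ Suc 4 = i ^ 3 * (1 - t * i)\<^sup>2" for i :: real
        by (simp add: eval_nat_numeral algebra_simps)
      then show ?thesis unfolding power_inverse[symmetric] .
    qed
    ultimately have sm: "(\<lambda>k. inverse (x + real k) ^ 3 * (1 - t * inverse (x + real k))\<^sup>2) sums (S 2 - 2 * t * S 3 + t\<^sup>2 * S 4)"
      by (simp only:)
    have "0 \<le> inverse (x + real k) ^ 3 * (1 - t * inverse (x + real k))\<^sup>2" for k
      using assms by (intro mult_nonneg_nonneg zero_le_power2) auto
    then show ?thesis by (intro sums_le[OF _ sums_zero sm])
  qed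
  \<comment> \<open>The minimiser of the quadratic in t.\<close>
  from this[of "S 3 / S 4"] have "0 \<le> (S 2 - 2 * (S 3 / S 4) * S 3 + (S 3 / S 4)\<^sup>2 * S 4) * S 4"
    using S4 by (intro mult_nonneg_nonneg) auto
  also have "\<dots> = S 2 * S 4 - (S 3)\<^sup>2"
    using S4 by (simp add: field_simps power2_eq_square)
  finally have "(Polygamma 3 x / 6)\<^sup>2 \<le> Polygamma 2 x / 2 * (Polygamma 4 x / 24)"
    by (simp add: S_def fact_numeral)
  then have "4 * (Polygamma 3 x)\<^sup>2 \<le> 3 * (Polygamma 2 x * Polygamma 4 x)"
    by (simp add: power_divide)
  moreover have "0 < Polygamma 3 x" using assms by (intro Polygamma_real_odd_pos) (auto elim!: nonpos_Ints_cases)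
  then have "0 < (Polygamma 3 x)\<^sup>2" by simp
  ultimately show ?thesis by linarith
qed

lemma Polygamma_ratio_strict_mono:
  assumes "0 < x" "x < (y::real)"
  shows "Polygamma 3 x / Polygamma 2 x < Polygamma 3 y / Polygamma 2 y"
proof (rule DERIV_pos_imp_increasing[OF assms(2)])
  fix z assume "x \<le> z" "z \<le> y"
  then have z: "0 < z" using assms by simp
  then have neg: "Polygamma 2 z < 0" by (intro Polygamma_real_even_neg) auto
  have "((\<lambda>z. Polygamma 3 z / Polygamma 2 z) has_field_derivative
      (Polygamma 4 z * Polygamma 2 z - Polygamma 3 z * Polygamma 3 z) / (Polygamma 2 z * Polygamma 2 z)) (at z)"
    using DERIV_divide[OF Polygamma_DERIV[OF z, of 3] Polygamma_DERIV[OF z, of 2]] neg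
    by (simp add: eval_nat_numeral)
  moreover have "0 < (Polygamma 4 z * Polygamma 2 z - Polygamma 3 z * Polygamma 3 z) / (Polygamma 2 z * Polygamma 2 z)"
    using Polygamma_cauchy_schwarz[OF z] neg
    by (intro divide_pos_pos) (auto simp: power2_eq_square mult_ac mult_neg_neg)
  ultimately show "\<exists>d. ((\<lambda>z. Polygamma 3 z / Polygamma 2 z) has_real_derivative d) (at z) \<and> 0 < d" by blast
qed

section \<open>The characteristic direction as a function of the parameter\<close>

definition psi_ratio :: "real \<Rightarrow> real \<Rightarrow> real \<Rightarrow> real" where
  "psi_ratio a b l = (psi1 l - psi1 (a + l)) / (psi1 l - psi1 (a + b + l))"

lemma psi1_pos: "0 < x \<Longrightarrow> 0 < psi1 x"
  by (intro Polygamma_real_odd_pos) (auto elim!: nonpos_Ints_cases)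

lemma psi1_antimono: "0 < x \<Longrightarrow> x < y \<Longrightarrow> psi1 y < psi1 x"
  by (rule Polygamma_real_strict_antimono) auto

text \<open>The value is 1 / (1 + N / D), so N / D has to increase. By Cauchy's mean value theorem
  N' / N and D' / D are values of the increasing function Polygamma 3 / Polygamma 2, at a point of
  (a + z, a + b + z) and at one of (z, a + z); the former point is the larger.\<close>

lemma psi_ratio_strict_antimono:
  assumes "0 < a" "0 < b" "0 < x" "x < y"
  shows "psi_ratio a b y < psi_ratio a b x"
proof -
  define N where "N l = psi1 (a + l) - psi1 (a + b + l)" for l
  define D where "D l = psi1 l - psi1 (a + l)" for l
  have ND: "0 < N l" "0 < D l" if "0 < l" for l
    using assms that psi1_antimono[of "a + l" "a + b + l"] psi1_antimono[of l "a + l"] by (auto simp: N_def D_def)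
  have "N x / D x < N y / D y"
  proof (rule DERIV_pos_imp_increasing[OF assms(4)])
    fix z assume "x \<le> z" "z \<le> y"
    then have z: "0 < z" using assms by simp
    define N' where "N' = Polygamma 2 (a + z) - Polygamma 2 (a + b + z)"
    define D' where "D' = Polygamma 2 z - Polygamma 2 (a + z)"
    have sh: "((\<lambda>x. psi1 (h + x)) has_field_derivative Polygamma 2 (h + z)) (at z)" if "0 \<le> h" for h
      using Polygamma_DERIV_shift[OF z that, of 1 UNIV] by (simp add: numeral_2_eq_2)
    have dN: "(N has_field_derivative N') (at z)"
      unfolding N_def N'_def using assms by (intro DERIV_diff sh) auto
    have dD: "(D has_field_derivative D') (at z)"
      unfolding D_def D'_def using assms sh[of 0] by (intro DERIV_diff sh) auto
    have cm: "\<exists>c. u < c \<and> c < v \<and> (psi1 v - psi1 u) * Polygamma 3 c = (Polygamma 2 v - Polygamma 2 u) * Polygamma 2 c"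
      if "0 < u" "u < v" for u v :: real
      using that Polygamma_DERIV[of _ 2 UNIV] Polygamma_DERIV[of _ 1 UNIV]
      by (intro GMVT') (auto simp: eval_nat_numeral intro!: DERIV_isCont Polygamma_DERIV)
    obtain c where c: "a + z < c" "(psi1 (a + b + z) - psi1 (a + z)) * Polygamma 3 c = (Polygamma 2 (a + b + z) - Polygamma 2 (a + z)) * Polygamma 2 c"
      using cm[of "a + z" "a + b + z"] assms z by auto
    obtain d where d: "z < d" "d < a + z" "(psi1 (a + z) - psi1 z) * Polygamma 3 d = (Polygamma 2 (a + z) - Polygamma 2 z) * Polygamma 2 d"
      using cm[of z "a + z"] assms z by auto
    have neg: "Polygamma 2 c < 0" "Polygamma 2 d < 0" using c d z assms by (auto intro!: Polygamma_real_even_neg)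
    have N': "N' = N z * (Polygamma 3 c / Polygamma 2 c)"
      using c(2) neg by (simp add: N_def N'_def field_simps)
    have D': "D' = D z * (Polygamma 3 d / Polygamma 2 d)"
      using d(3) neg by (simp add: D_def D'_def field_simps)
    have "Polygamma 3 d / Polygamma 2 d < Polygamma 3 c / Polygamma 2 c"
      using c d z by (intro Polygamma_ratio_strict_mono) auto
    then have "0 < N z * D z * (Polygamma 3 c / Polygamma 2 c - Polygamma 3 d / Polygamma 2 d)"
      using ND[OF z] by simp
    also have "\<dots> = N' * D z - N z * D'" unfolding N' D' by (simp add: algebra_simps)
    finally have pos: "0 < (N' * D z - N z * D') / (D z * D z)" using ND[OF z] by simp
    have "((\<lambda>z. N z / D z) has_field_derivative (N' * D z - N z * D') / (D z * D z)) (at z)"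
      using ND[OF z] by (intro DERIV_divide dN dD) auto
    with pos show "\<exists>d. ((\<lambda>z. N z / D z) has_real_derivative d) (at z) \<and> 0 < d" by blast
  qed
  moreover have "psi_ratio a b l = 1 / (1 + N l / D l)" if "0 < l" for l
    using ND[OF that] by (simp add: psi_ratio_def N_def D_def field_simps)
  moreover have "0 < N x / D x" using ND[OF assms(3)] by simp
  ultimately show ?thesis using assms by (simp add: frac_less2)
qed

text \<open>As l tends to 0, psi1 l \<ge> 1 / l^2 dominates psi1 (a + l), which stays below psi1 a;
  so the quotient comes arbitrarily close to 1.\<close>

lemma psi_ratio_ge:
  assumes "0 < a" "0 < b" "r < 1"
  shows "\<exists>l>0. r < psi_ratio a b l"
proof -
  define r' where "r' = max r 0"
  have r': "0 \<le> r'" "r' < 1" "r \<le> r'" using assms by (auto simp: r'_def)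
  \<comment> \<open>The second entry of the minimum gives psi1 a \<le> (1 - r') / (2 l), and l \<le>
    1 makes this less than (1 - r') / l^2.\<close>
  define l where "l = min 1 ((1 - r') / (2 * psi1 a))"
  have pa: "0 < psi1 a" using assms by (intro psi1_pos)
  have l: "0 < l" "l \<le> 1" using r' pa by (auto simp: l_def)
  have "(\<lambda>k. inverse ((l + real k)\<^sup>2)) sums psi1 l"
    using Polygamma_sum[of l 1] l by (simp add: numeral_2_eq_2)
  then have "sum (\<lambda>k. inverse ((l + real k)\<^sup>2)) {0} \<le> psi1 l"
    using sum_le_suminf[of "\<lambda>k. inverse ((l + real k)\<^sup>2)" "{0}"] by (auto simp: sums_iff)
  then have p1: "inverse (l * l) \<le> psi1 l" by (simp add: power2_eq_square)
  have "psi1 a \<le> (1 - r') / (2 * l)"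
    using pa l by (simp add: l_def field_simps min_def split: if_splits)
  also have "\<dots> < (1 - r') * inverse (l * l)"
  proof -
    have "l * l \<le> l * 1" using l by (intro mult_left_mono) auto
    then have "l * l < 2 * l" using l by simp
    then have "(1 - r') / (2 * l) < (1 - r') / (l * l)"
      using r' l by (intro divide_strict_left_mono) auto
    then show ?thesis by (simp only: divide_inverse)
  qed
  also have "\<dots> \<le> (1 - r') * psi1 l" using r' p1 by (intro mult_left_mono) auto
  finally have "psi1 a < (1 - r') * psi1 l" .
  moreover have "psi1 (a + l) < psi1 a" using assms l by (intro psi1_antimono) auto
  moreover have "0 \<le> r' * psi1 (a + b + l)"
    using r' psi1_pos[of "a + b + l"] assms l by (intro mult_nonneg_nonneg) auto
  ultimately have "r' * (psi1 l - psi1 (a + b + l)) < psi1 l - psi1 (a + l)" by (simp add: algebra_simps)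
  moreover have "0 < psi1 l - psi1 (a + b + l)" using psi1_antimono[of l "a + b + l"] assms l by simp
  ultimately have "r' < psi_ratio a b l" by (simp add: psi_ratio_def pos_less_divide_eq)
  then show ?thesis using r' l by (intro exI[of _ l]) auto
qed


text \<open>The values are negative, so this limits the decay of the modulus under a shift. The
  series satisfy the bound term by term.\<close>

lemma Polygamma2_shift:
  assumes "0 < x" "0 \<le> (h::real)"
  shows "Polygamma 2 (x + h) \<le> (x / (x + h)) ^ 3 * Polygamma 2 x"
proof -
  have s: "(\<lambda>k. inverse ((y + real k) ^ 3)) sums (- Polygamma 2 y / 2)" if "0 < y" for y
    using Polygamma_sum[OF that, of 2] by (simp add: fact_numeral eval_nat_numeral)
  have "(\<lambda>k. (x / (x + h)) ^ 3 * inverse ((x + real k) ^ 3)) sums ((x / (x + h)) ^ 3 * (- Polygamma 2 x / 2))"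
    using s assms by (intro sums_mult) auto
  moreover have "(\<lambda>k. inverse ((x + h + real k) ^ 3)) sums (- Polygamma 2 (x + h) / 2)"
    using assms by (intro s) auto
  moreover have "(x / (x + h)) ^ 3 * inverse ((x + real k) ^ 3) \<le> inverse ((x + h + real k) ^ 3)" for k
  proof -
    have "x * (x + h + real k) \<le> (x + h) * (x + real k)" using assms by (simp add: algebra_simps)
    then have "x / (x + h) * inverse (x + real k) \<le> inverse (x + h + real k)"
    proof -
      have "x / p * inverse q \<le> inverse s" if "x * s \<le> p * q" "0 < p" "0 < q" "0 < s" for p q s
        using that by (simp add: field_simps)
      then show ?thesis using assms \<open>x * (x + h + real k) \<le> (x + h) * (x + real k)\<close> by auto
    qed
    then have "(x / (x + h) * inverse (x + real k)) ^ 3 \<le> inverse (x + h + real k) ^ 3"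
      using assms by (intro power_mono) auto
    then show ?thesis by (simp only: power_mult_distrib power_inverse)
  qed
  ultimately have "(x / (x + h)) ^ 3 * (- Polygamma 2 x / 2) \<le> - Polygamma 2 (x + h) / 2"
    by (rule sums_le[rotated])
  then show ?thesis by (simp add: field_simps)
qed

text \<open>By the mean value theorem the two differences of psi1 are a and b times values of -
  Polygamma 2 within distance a + b of l. \<open>Polygamma2_shift\<close> compares these up to a
  cubic factor q that tends to 1 for large l, and the resulting bound a / (a + b q) approaches a /
  (a + b).\<close>

lemma psi_ratio_le:
  assumes "0 < a" "0 < b" "a / (a + b) < r"
  shows "\<exists>l>0. psi_ratio a b l < r"
proof -
  have "((\<lambda>l. a / (a + b * (l / (l + (a + b))) ^ 3)) \<longlongrightarrow> a / (a + b * 1 ^ 3)) at_top"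
  proof (intro tendsto_intros)
    show "((\<lambda>l. l / (l + (a + b))) \<longlongrightarrow> 1) at_top" by real_asymp
  qed (use assms in auto)
  then have "\<forall>\<^sub>F l in at_top. a / (a + b * (l / (l + (a + b))) ^ 3) < r"
    using assms by (intro order_tendstoD) auto
  moreover have "\<forall>\<^sub>F l in at_top. 0 < (l::real)" by (rule eventually_gt_at_top)
  ultimately have "\<forall>\<^sub>F l in at_top. 0 < l \<and> a / (a + b * (l / (l + (a + b))) ^ 3) < r"
    by eventually_elim auto
  then obtain l where l: "0 < l" "a / (a + b * (l / (l + (a + b))) ^ 3) < r"
    using eventually_happens'[OF trivial_limit_at_top_linorder] by blast
  define q where "q = (l / (l + (a + b))) ^ 3"
  have q: "0 < q" using l assms by (simp add: q_def)
  have mvt: "\<exists>c. u < c \<and> c < v \<and> psi1 v - psi1 u = (v - u) * Polygamma 2 c" if "0 < u" "u < v" for u v :: real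
    using that Polygamma_DERIV[of _ 1 UNIV] by (intro MVT2) (auto simp: numeral_2_eq_2)
  obtain c where c: "a + l < c" "c < a + b + l" "psi1 (a + b + l) - psi1 (a + l) = b * Polygamma 2 c"
    using mvt[of "a + l" "a + b + l"] assms l by auto
  obtain d where d: "l < d" "d < a + l" "psi1 (a + l) - psi1 l = a * Polygamma 2 d"
    using mvt[of l "a + l"] assms l by auto
  have neg: "Polygamma 2 c < 0" "Polygamma 2 d < 0" using c d l assms by (auto intro!: Polygamma_real_even_neg)
  have "Polygamma 2 c \<le> Polygamma 2 (l + (a + b))"
    using c l assms by (intro Polygamma_real_mono) auto
  also have "\<dots> \<le> q * Polygamma 2 l"
    unfolding q_def using l assms by (intro Polygamma2_shift) auto
  also have "\<dots> \<le> q * Polygamma 2 d"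
    using q d l by (intro mult_left_mono Polygamma_real_mono) auto
  finally have "b * Polygamma 2 c \<le> b * (q * Polygamma 2 d)" using assms by (intro mult_left_mono) auto
  then have "psi_ratio a b l \<le> a / (a + b * q)"
  proof -
    have e: "psi_ratio a b l = (- a * Polygamma 2 d) / (- a * Polygamma 2 d + - b * Polygamma 2 c)"
    proof -
      have "psi1 l - psi1 (a + l) = - a * Polygamma 2 d" using d(3) by simp
      moreover have "psi1 l - psi1 (a + b + l) = - a * Polygamma 2 d + - b * Polygamma 2 c"
        using c(3) d(3) by simp
      ultimately show ?thesis by (simp only: psi_ratio_def)
    qed
    have "0 < - a * Polygamma 2 d" "0 < - b * Polygamma 2 c" using neg assms by (auto simp: mult_pos_neg)
    then have p: "0 < - a * Polygamma 2 d + - b * Polygamma 2 c" by simp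
    have "0 < a + b * q" using assms q by (simp add: add_pos_pos)
    have "(- a * Polygamma 2 d) * (b * q) \<le> a * (- b * Polygamma 2 c)"
      using \<open>b * Polygamma 2 c \<le> b * (q * Polygamma 2 d)\<close> assms by (simp add: mult_ac)
    show ?thesis
    proof -
      have "X / (X + Y) \<le> a / (a + w)" if "X * w \<le> a * Y" "0 < X + Y" "0 < a + w" for X Y w
        using that by (simp add: divide_simps algebra_simps)
      then show ?thesis unfolding e using p \<open>0 < a + b * q\<close> \<open>(- a * Polygamma 2 d) * (b * q) \<le> a * (- b * Polygamma 2 c)\<close>
        by blast
    qed
  qed
  then show ?thesis using l by (auto simp: q_def)
qed

lemma psi_ratio_unique_solution:
  assumes "0 < a" "0 < b" "a / (a + b) < r" "r < 1"
  shows "\<exists>!l. 0 < l \<and> r = psi_ratio a b l"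
proof -
  obtain x where x: "0 < x" "r < psi_ratio a b x" using psi_ratio_ge assms by blast
  obtain y where y: "0 < y" "psi_ratio a b y < r" using psi_ratio_le assms by blast
  have xy: "x < y"
  proof (rule ccontr)
    assume "\<not> x < y"
    then have "y = x \<or> y < x" by auto
    then show False using psi_ratio_strict_antimono[of a b y x] assms x y by auto
  qed
  have nz: "psi1 l - psi1 (a + b + l) \<noteq> 0" if "0 < l" for l
    using psi1_antimono[of l "a + b + l"] that assms by auto
  have ct: "continuous_on {x..y} (\<lambda>l. psi1 (h + l))" if "0 \<le> h" for h
    using DERIV_isCont[OF Polygamma_DERIV_shift[OF _ that]] x
    by (intro continuous_at_imp_continuous_on ballI) auto
  have "continuous_on {x..y} (\<lambda>l. psi_ratio a b l)"
    unfolding psi_ratio_def using x assms nz ct[of 0]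
    by (intro continuous_on_divide continuous_on_diff ct) auto
  then obtain l where l: "x \<le> l" "l \<le> y" "psi_ratio a b l = r"
    using IVT2'[of "psi_ratio a b" y r x] xy x y by auto
  show ?thesis
  proof (rule ex1I[of _ l])
    show "0 < l \<and> r = psi_ratio a b l" using l x by auto
    fix k assume "0 < k \<and> r = psi_ratio a b k"
    then show "k = l"
      using psi_ratio_strict_antimono[of a b k l] psi_ratio_strict_antimono[of a b l k] assms l x
      by (cases k l rule: linorder_cases) auto
  qed
qed

section \<open>Mean logarithmic growth in a direction\<close>

text \<open>Minus the mean of ln X for X of law Beta(a + l, b), the law of a horizontal ratio;
  \<open>phi2\<close> is the same for inverted vertical ratios, of law Beta(l, a).\<close>

definition phi1 :: "real \<Rightarrow> real \<Rightarrow> real \<Rightarrow> real" where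
  "phi1 a b l = Digamma (a + b + l) - Digamma (a + l)"

definition phi2 :: "real \<Rightarrow> real \<Rightarrow> real \<Rightarrow> real" where
  "phi2 a b l = Digamma (a + l) - Digamma l"

text \<open>The first factor is positive since psi1 decreases, so the sign is that of
  \<open>psi_ratio a b l - t\<close>. The drift therefore has its maximum at the parameter whose
  characteristic direction is t.\<close>

lemma drift_deriv:
  assumes "0 < a" "0 < b" "0 < l"
  shows "((\<lambda>l. t * phi1 a b l - (1 - t) * phi2 a b l) has_field_derivative
    (psi1 l - psi1 (a + b + l)) * (psi_ratio a b l - t)) (at l)"
proof -
  have sh: "((\<lambda>x. Digamma (h + x)) has_field_derivative psi1 (h + l)) (at l)" if "0 \<le> h" for h
    using Polygamma_DERIV_shift[OF assms(3) that, of 0 UNIV] by simp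
  have nz: "psi1 l - psi1 (a + b + l) \<noteq> 0"
    using psi1_antimono[of l "a + b + l"] assms by auto
  have "((\<lambda>l. t * phi1 a b l - (1 - t) * phi2 a b l) has_field_derivative
      t * (psi1 (a + b + l) - psi1 (a + l)) - (1 - t) * (psi1 (a + l) - psi1 (0 + l))) (at l)"
    unfolding phi1_def phi2_def using assms sh[of 0] by (intro DERIV_diff DERIV_cmult sh) auto
  also have "t * (psi1 (a + b + l) - psi1 (a + l)) - (1 - t) * (psi1 (a + l) - psi1 (0 + l)) =
      (psi1 l - psi1 (a + b + l)) * (psi_ratio a b l - t)"
  proof -
    have "(psi1 l - psi1 (a + b + l)) * psi_ratio a b l = psi1 l - psi1 (a + l)"
      using nz by (simp add: psi_ratio_def)
    then show ?thesis by (simp add: algebra_simps)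
  qed
  finally show ?thesis .
qed

lemma drift_strict_mono:
  assumes "0 < a" "0 < b" "0 < l" "t = psi_ratio a b l" "0 < x" "x < y" "y \<le> l"
  shows "t * phi1 a b x - (1 - t) * phi2 a b x < t * phi1 a b y - (1 - t) * phi2 a b y"
proof (rule DERIV_pos_imp_increasing_open[OF assms(6)])
  fix z assume z: "x < z" "z < y"
  then have "t < psi_ratio a b z" using psi_ratio_strict_antimono[of a b z l] assms by auto
  moreover have "psi1 (a + b + z) < psi1 z" using z assms by (intro psi1_antimono) auto
  ultimately show "\<exists>d. ((\<lambda>l. t * phi1 a b l - (1 - t) * phi2 a b l) has_real_derivative d) (at z) \<and> 0 < d"
    using drift_deriv[of a b z t] z assms by (intro exI[of _ "(psi1 z - psi1 (a + b + z)) * (psi_ratio a b z - t)"]) auto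
next
  show "continuous_on {x..y} (\<lambda>l. t * phi1 a b l - (1 - t) * phi2 a b l)"
    using DERIV_isCont[OF drift_deriv[of a b _ t]] assms
    by (intro continuous_at_imp_continuous_on ballI) auto
qed

lemma drift_strict_antimono:
  assumes "0 < a" "0 < b" "0 < l" "t = psi_ratio a b l" "l \<le> x" "x < y"
  shows "t * phi1 a b y - (1 - t) * phi2 a b y < t * phi1 a b x - (1 - t) * phi2 a b x"
proof (rule DERIV_neg_imp_decreasing_open[OF assms(6)])
  fix z assume z: "x < z" "z < y"
  then have "psi_ratio a b z < t" using psi_ratio_strict_antimono[of a b l z] assms by auto
  moreover have "psi1 (a + b + z) < psi1 z" using z assms by (intro psi1_antimono) auto
  ultimately show "\<exists>d. ((\<lambda>l. t * phi1 a b l - (1 - t) * phi2 a b l) has_real_derivative d) (at z) \<and> d < 0"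
    using drift_deriv[of a b z t] z assms by (intro exI[of _ "(psi1 z - psi1 (a + b + z)) * (psi_ratio a b z - t)"]) (auto simp: mult_pos_neg)
next
  show "continuous_on {x..y} (\<lambda>l. t * phi1 a b l - (1 - t) * phi2 a b l)"
    using DERIV_isCont[OF drift_deriv[of a b _ t]] assms
    by (intro continuous_at_imp_continuous_on ballI) auto
qed

section \<open>Harmonic functions on the quadrant\<close>

text \<open>Indices count steps back from the north-east corner: from (Suc i, Suc j) the step e1
  leads to (i, Suc j) and e2 to (Suc i, j), while the weight of that site is stored as w i j. Row 0
  and column 0 carry boundary values.\<close>

definition harmonic :: "(nat \<Rightarrow> nat \<Rightarrow> real) \<Rightarrow> (nat \<Rightarrow> nat \<Rightarrow> real) \<Rightarrow> bool" where
  "harmonic w h \<longleftrightarrow> (\<forall>i j. h (Suc i) (Suc j) = w i j * h i (Suc j) + (1 - w i j) * h (Suc i) j)"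

lemma harmonicD: "harmonic w h \<Longrightarrow> h (Suc i) (Suc j) = w i j * h i (Suc j) + (1 - w i j) * h (Suc i) j"
  by (simp add: harmonic_def)

definition transp :: "(nat \<Rightarrow> nat \<Rightarrow> real) \<Rightarrow> nat \<Rightarrow> nat \<Rightarrow> real" where
  "transp h i j = h j i"

definition transp_weight :: "(nat \<Rightarrow> nat \<Rightarrow> real) \<Rightarrow> nat \<Rightarrow> nat \<Rightarrow> real" where
  "transp_weight w i j = 1 - w j i"

lemma harmonic_transp: "harmonic w h \<Longrightarrow> harmonic (transp_weight w) (transp h)"
  by (simp add: harmonic_def transp_def transp_weight_def)

text \<open>The product of the two comparisons at (i, j), after cancelling h i j * k i j, compares
  the values at (Suc i, j) and (i, Suc j), the successors of (Suc i, Suc j). Harmonicity adds the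
  same term to both sides of that inequality, and this carries both comparisons across the
  cell.\<close>

lemma harmonic_ratio_mono:
  assumes h: "harmonic w h" and k: "harmonic w k"
    and pos: "\<And>i j. 0 < h i j" "\<And>i j. 0 < k i j" and w: "\<And>i j. 0 < w i j \<and> w i j < 1"
    and north: "\<And>i. k (Suc i) 0 * h i 0 \<le> h (Suc i) 0 * k i 0"
    and east: "\<And>j. k 0 j * h 0 (Suc j) \<le> h 0 j * k 0 (Suc j)"
  shows "k (Suc i) j * h i j \<le> h (Suc i) j * k i j"
    and "k i j * h i (Suc j) \<le> h i j * k i (Suc j)"
proof -
  have mid: "k (Suc i) j * h i (Suc j) \<le> h (Suc i) j * k i (Suc j)"
    if A: "k (Suc i) j * h i j \<le> h (Suc i) j * k i j" and B: "k i j * h i (Suc j) \<le> h i j * k i (Suc j)" for i j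
  proof -
    have "(k (Suc i) j * h i j) * (k i j * h i (Suc j)) \<le> (h (Suc i) j * k i j) * (h i j * k i (Suc j))"
      using pos by (intro mult_mono A B) (auto intro!: mult_nonneg_nonneg less_imp_le[OF pos(1)] less_imp_le[OF pos(2)])
    then have "(h i j * k i j) * (k (Suc i) j * h i (Suc j)) \<le> (h i j * k i j) * (h (Suc i) j * k i (Suc j))"
      by (simp add: mult_ac)
    then show ?thesis using pos(1)[of i j] pos(2)[of i j] by (simp add: mult_le_cancel_left)
  qed
  have col: "k i j * h i (Suc j) \<le> h i j * k i (Suc j)"
    if A: "\<And>i. k (Suc i) j * h i j \<le> h (Suc i) j * k i j" for i j
  proof (induction i)
    case 0
    show ?case by (rule east)
  next
    case (Suc i)
    have "w i j * (k (Suc i) j * h i (Suc j)) \<le> w i j * (h (Suc i) j * k i (Suc j))"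
      using w[of i j] by (intro mult_left_mono mid A Suc.IH) auto
    then show ?case by (simp add: harmonicD[OF h] harmonicD[OF k] algebra_simps)
  qed
  have row: "k (Suc i) j * h i j \<le> h (Suc i) j * k i j" for i j
  proof (induction j arbitrary: i)
    case 0
    show ?case by (rule north)
  next
    case (Suc j)
    have "(1 - w i j) * (k (Suc i) j * h i (Suc j)) \<le> (1 - w i j) * (h (Suc i) j * k i (Suc j))"
      using w[of i j] by (intro mult_left_mono mid Suc.IH col) auto
    then show ?case by (simp add: harmonicD[OF h] harmonicD[OF k] algebra_simps)
  qed
  show "k (Suc i) j * h i j \<le> h (Suc i) j * k i j" by (rule row)
  show "k i j * h i (Suc j) \<le> h i j * k i (Suc j)" by (intro col row)
qed

section \<open>Hitting probabilities of a corner against harmonic functions\<close>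

text \<open>The part of a harmonic function that is carried by paths leaving through the north row:
  values a there and zero on the east column. Index (i, j) is the site (Suc i, Suc j) of
  \<open>harmonic\<close>, and a i belongs to the boundary site (Suc i, 0).\<close>

fun exit_north :: "(nat \<Rightarrow> nat \<Rightarrow> real) \<Rightarrow> (nat \<Rightarrow> real) \<Rightarrow> nat \<Rightarrow> nat \<Rightarrow> real" where
  "exit_north w a 0 0 = (1 - w 0 0) * a 0"
| "exit_north w a (Suc i) 0 = w (Suc i) 0 * exit_north w a i 0 + (1 - w (Suc i) 0) * a (Suc i)"
| "exit_north w a 0 (Suc j) = (1 - w 0 (Suc j)) * exit_north w a 0 j"
| "exit_north w a (Suc i) (Suc j) =
     w (Suc i) (Suc j) * exit_north w a i (Suc j) + (1 - w (Suc i) (Suc j)) * exit_north w a (Suc i) j"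

text \<open>For weights in the unit interval, the probability of reaching (0, 0) from (i, j). Here w
  i j belongs to (i, j) itself, so the indexing is shifted by one against \<open>harmonic\<close>,
  as for \<open>exit_north\<close>.\<close>

fun point_hit :: "(nat \<Rightarrow> nat \<Rightarrow> real) \<Rightarrow> nat \<Rightarrow> nat \<Rightarrow> real" where
  "point_hit w 0 0 = 1"
| "point_hit w (Suc i) 0 = w (Suc i) 0 * point_hit w i 0"
| "point_hit w 0 (Suc j) = (1 - w 0 (Suc j)) * point_hit w 0 j"
| "point_hit w (Suc i) (Suc j) =
     w (Suc i) (Suc j) * point_hit w i (Suc j) + (1 - w (Suc i) (Suc j)) * point_hit w (Suc i) j"

lemma point_hit_transp: "point_hit (transp_weight w) i j = point_hit w j i"
  by (induction w j i rule: point_hit.induct) (auto simp: transp_weight_def)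

lemma point_hit_pos:
  assumes "\<And>i j. 0 < w i j \<and> w i j < 1"
  shows "0 < point_hit w i j"
  using assms by (induction w i j rule: point_hit.induct) (auto intro!: add_pos_pos mult_pos_pos)

lemma exit_north_pos:
  assumes "\<And>i j. 0 < w i j \<and> w i j < 1" "\<And>i. 0 < a i"
  shows "0 < exit_north w a i j"
  using assms by (induction w a i j rule: exit_north.induct) (auto intro!: add_pos_pos mult_pos_pos)

text \<open>Let N be the part of h that exits north and G the hitting probability. Along the bottom
  row of cells N gains boundary mass at each step back and G does not, so ratio monotonicity gives G
  i j / G (Suc i) j \<ge> N i j / N (Suc i) j. Moreover N \<le> h, and N \<ge> h - C k because k
  grows at least as fast as h along the east column. The last factor of the bound is thus a lower
  bound for the share of h that exits north.\<close>

lemma kappa_lower_bound: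
  assumes h: "harmonic w h" and k: "harmonic w k"
    and pos: "\<And>i j. 0 < h i j" "\<And>i j. 0 < k i j" and w: "\<And>i j. 0 < w i j \<and> w i j < 1"
    and east: "\<And>j. k 0 (Suc j) * h 0 (Suc (Suc j)) \<le> h 0 (Suc j) * k 0 (Suc (Suc j))"
  shows "w (Suc i) j * h (Suc i) (Suc j) / h (Suc (Suc i)) (Suc j)
      * (1 - h 0 1 / k 0 1 * k (Suc i) (Suc j) / h (Suc i) (Suc j))
    \<le> w (Suc i) j * point_hit w i j / point_hit w (Suc i) j"
proof -
  define a where "a i = h (Suc i) 0" for i
  \<comment> \<open>C k equals h at the first east site (0, 1), from where the growth hypothesis
    takes over. The corner (0, 0) is a successor of no site.\<close>
  define C where "C = h 0 1 / k 0 1"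
  have C: "0 < C" using pos by (simp add: C_def)
  have a: "0 < a i" for i using pos by (simp add: a_def)
  let ?N = "exit_north w a" and ?G = "point_hit w"
  have e: "h 0 (Suc j) \<le> C * k 0 (Suc j)" for j
  proof (induction j)
    case 0
    show ?case using pos[of 0 1] by (simp add: C_def)
  next
    case (Suc j)
    have "k 0 (Suc j) * h 0 (Suc (Suc j)) \<le> (C * k 0 (Suc j)) * k 0 (Suc (Suc j))"
      using east[of j] mult_right_mono[OF Suc.IH less_imp_le[OF pos(2)[of 0 "Suc (Suc j)"]]] by linarith
    then have "k 0 (Suc j) * h 0 (Suc (Suc j)) \<le> k 0 (Suc j) * (C * k 0 (Suc (Suc j)))" by (simp add: mult_ac)
    then show ?case using pos(2)[of 0 "Suc j"] by simp
  qed
  have n: "a i = h (Suc i) 0" "0 \<le> C * k (Suc i) 0" for i using C pos by (auto simp: a_def intro!: mult_nonneg_nonneg less_imp_le)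
  \<comment> \<open>On the north row N and h have the same values; on the east column N is replaced
    by 0, which lies between h - C k and h. Averaging preserves both inequalities.\<close>
  have bounds: "?N i j \<le> h (Suc i) (Suc j) \<and> h (Suc i) (Suc j) - C * k (Suc i) (Suc j) \<le> ?N i j" for i j
  proof -
    have step: "w i j * x + (1 - w i j) * y \<le> h (Suc i) (Suc j) \<and>
        h (Suc i) (Suc j) - C * k (Suc i) (Suc j) \<le> w i j * x + (1 - w i j) * y"
      if "x \<le> h i (Suc j)" "h i (Suc j) - C * k i (Suc j) \<le> x"
        "y \<le> h (Suc i) j" "h (Suc i) j - C * k (Suc i) j \<le> y" for i j x y
    proof
      show "w i j * x + (1 - w i j) * y \<le> h (Suc i) (Suc j)"
        unfolding harmonicD[OF h] using w[of i j] that by (intro add_mono mult_left_mono) auto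
      have "w i j * (h i (Suc j) - C * k i (Suc j)) + (1 - w i j) * (h (Suc i) j - C * k (Suc i) j)
          \<le> w i j * x + (1 - w i j) * y"
        using w[of i j] that by (intro add_mono mult_left_mono) auto
      then show "h (Suc i) (Suc j) - C * k (Suc i) (Suc j) \<le> w i j * x + (1 - w i j) * y"
        unfolding harmonicD[OF h] harmonicD[OF k] by (simp add: algebra_simps)
    qed
    show ?thesis
    proof (induction i arbitrary: j)
      case 0
      show ?case
      proof (induction j)
        case 0
        show ?case using step[of 0 0 0 "a 0"] e[of 0] n[of 0] less_imp_le[OF pos(1)[of 0 1]] by simp
      next
        case (Suc j)
        then show ?case using step[of 0 0 "Suc j" "?N 0 j"] e[of "Suc j"] less_imp_le[OF pos(1)[of 0 "Suc (Suc j)"]] by simp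
      qed
    next
      case (Suc i)
      note IHi = this
      show ?case
      proof (induction j)
        case 0
        show ?case using step[of "?N i 0" "Suc i" 0 "a (Suc i)"] n[of "Suc i"] IHi[of 0] by simp
      next
        case (Suc j)
        then show ?case using step[of "?N i (Suc j)" "Suc i" "Suc j" "?N (Suc i) j"] IHi[of "Suc j"] by simp
      qed
    qed
  qed
  define w' where "w' i j = w (Suc i) (Suc j)" for i j
  have Npos: "0 < ?N i j" for i j using w a by (rule exit_north_pos)
  have Gpos: "0 < ?G i j" for i j using w by (rule point_hit_pos)
  have "?G (Suc i) j * ?N i j \<le> ?N (Suc i) j * ?G i j"
  proof (rule harmonic_ratio_mono(1)[where w = w'])
    show "harmonic w' ?N" "harmonic w' ?G" by (simp_all add: harmonic_def w'_def)
    show "0 < w' i j \<and> w' i j < 1" for i j using w by (simp add: w'_def)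
    show "?G (Suc i) 0 * ?N i 0 \<le> ?N (Suc i) 0 * ?G i 0" for i
    proof -
      have "0 \<le> (1 - w (Suc i) 0) * a (Suc i) * ?G i 0"
        using w[of "Suc i" 0] less_imp_le[OF a[of "Suc i"]] less_imp_le[OF Gpos[of i 0]]
        by (intro mult_nonneg_nonneg) auto
      then show ?thesis by (simp add: algebra_simps)
    qed
    \<comment> \<open>In the first column both functions are multiplied by the same factor at each
      step, so equality holds.\<close>
    show "?G 0 j * ?N 0 (Suc j) \<le> ?N 0 j * ?G 0 (Suc j)" for j by simp
  qed (rule Npos Gpos)+
  then have G: "?N i j / ?N (Suc i) j \<le> ?G i j / ?G (Suc i) j"
    using Npos[of "Suc i" j] Gpos[of "Suc i" j] by (simp add: field_simps)
  have "(h (Suc i) (Suc j) - C * k (Suc i) (Suc j)) / h (Suc (Suc i)) (Suc j) \<le> ?N i j / h (Suc (Suc i)) (Suc j)"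
    using bounds[of i j] pos(1)[of "Suc (Suc i)" "Suc j"] by (intro divide_right_mono) auto
  also have "\<dots> \<le> ?N i j / ?N (Suc i) j"
    using bounds[of "Suc i" j] Npos[of i j] Npos[of "Suc i" j] by (intro divide_left_mono) auto
  also note G
  finally have "w (Suc i) j * ((h (Suc i) (Suc j) - C * k (Suc i) (Suc j)) / h (Suc (Suc i)) (Suc j))
      \<le> w (Suc i) j * (?G i j / ?G (Suc i) j)"
    using w[of "Suc i" j] by (intro mult_left_mono) auto
  moreover have "w (Suc i) j * h (Suc i) (Suc j) / h (Suc (Suc i)) (Suc j)
      * (1 - h 0 1 / k 0 1 * k (Suc i) (Suc j) / h (Suc i) (Suc j)) =
     w (Suc i) j * ((h (Suc i) (Suc j) - C * k (Suc i) (Suc j)) / h (Suc (Suc i)) (Suc j))"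
  proof -
    have "h (Suc i) (Suc j) \<noteq> 0" using pos(1)[of "Suc i" "Suc j"] by simp
    then have "1 - C * k (Suc i) (Suc j) / h (Suc i) (Suc j) = (h (Suc i) (Suc j) - C * k (Suc i) (Suc j)) / h (Suc i) (Suc j)"
      by (simp add: diff_divide_distrib)
    then show ?thesis unfolding C_def[symmetric] using \<open>h (Suc i) (Suc j) \<noteq> 0\<close> by simp
  qed
  ultimately show ?thesis by (simp only: times_divide_eq_right)
qed


text \<open>Transposition exchanges the two steps: a lower bound for the vertical transition
  probability is an upper bound for the horizontal one.\<close>

lemma kappa_upper_bound:
  assumes h: "harmonic w h" and k: "harmonic w k"
    and pos: "\<And>i j. 0 < h i j" "\<And>i j. 0 < k i j" and w: "\<And>i j. 0 < w i j \<and> w i j < 1"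
    and north: "\<And>i. k (Suc i) 0 * h (Suc (Suc i)) 0 \<le> h (Suc i) 0 * k (Suc (Suc i)) 0"
  shows "(1 - w i (Suc j)) * h (Suc i) (Suc j) / h (Suc i) (Suc (Suc j))
      * (1 - h 1 0 / k 1 0 * k (Suc i) (Suc j) / h (Suc i) (Suc j))
    \<le> (1 - w i (Suc j)) * point_hit w i j / point_hit w i (Suc j)"
  using kappa_lower_bound[OF harmonic_transp[OF h] harmonic_transp[OF k], of j i] pos w north
  by (simp add: transp_def point_hit_transp) (simp add: transp_weight_def)

section \<open>Stationary boundary data\<close>

lemma nn_integral_PiM_insert:
  assumes D: "\<And>i. prob_space (D i)" and F [measurable]: "F \<in> borel_measurable (PiM (insert i I) D)"
  shows "(\<integral>\<^sup>+f. F f \<partial>PiM (insert i I) D) = (\<integral>\<^sup>+x. \<integral>\<^sup>+X. F (X(i := x)) \<partial>PiM I D \<partial>D i)"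
proof -
  interpret P: prob_space "PiM I D" using D by (intro prob_space_PiM) auto
  have [measurable]: "(\<lambda>(x, X). X(i := x)) \<in> D i \<Otimes>\<^sub>M PiM I D \<rightarrow>\<^sub>M PiM (insert i I) D"
    by measurable
  have "(\<integral>\<^sup>+f. F f \<partial>PiM (insert i I) D)
      = (\<integral>\<^sup>+f. F f \<partial>distr (D i \<Otimes>\<^sub>M PiM I D) (PiM (insert i I) D) (\<lambda>(x, X). X(i := x)))"
    using D by (subst distr_pair_PiM_eq_PiM) auto
  also have "\<dots> = (\<integral>\<^sup>+p. F ((\<lambda>(x, X). X(i := x)) p) \<partial>(D i \<Otimes>\<^sub>M PiM I D))"
    by (intro nn_integral_distr) measurable
  also have "\<dots> = (\<integral>\<^sup>+x. \<integral>\<^sup>+X. F (X(i := x)) \<partial>PiM I D \<partial>D i)"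
    by (subst P.nn_integral_fst[symmetric]) auto
  finally show ?thesis .
qed

text \<open>Exposes the three coordinates that a single cell involves, with all others integrated as
  one block.\<close>

lemma nn_integral_PiM_three:
  assumes D: "\<And>i. prob_space (D i)" and F [measurable]: "F \<in> borel_measurable (PiM UNIV D)"
    and ne: "a \<noteq> b" "a \<noteq> c" "b \<noteq> c"
  shows "(\<integral>\<^sup>+f. F f \<partial>PiM UNIV D) = (\<integral>\<^sup>+z. \<integral>\<^sup>+x. \<integral>\<^sup>+y. \<integral>\<^sup>+X. F (X(b := y, a := x, c := z)) \<partial>PiM (- {a, b, c}) D \<partial>D b \<partial>D a \<partial>D c)"
proof -
  define I0 where "I0 = - {a, b, c}"
  define I1 where "I1 = insert b I0"
  define I2 where "I2 = insert a I1"
  have U: "UNIV = insert c I2" by (auto simp: I0_def I1_def I2_def)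
  have F2 [measurable]: "F \<in> borel_measurable (PiM (insert c I2) D)" using F U by simp
  have "(\<integral>\<^sup>+f. F f \<partial>PiM UNIV D) = (\<integral>\<^sup>+z. \<integral>\<^sup>+X. F (X(c := z)) \<partial>PiM I2 D \<partial>D c)"
    unfolding U by (rule nn_integral_PiM_insert[OF D F2])
  also have "\<dots> = (\<integral>\<^sup>+z. \<integral>\<^sup>+x. \<integral>\<^sup>+X. F (X(a := x, c := z)) \<partial>PiM I1 D \<partial>D a \<partial>D c)"
  proof (intro nn_integral_cong)
    fix z assume "z \<in> space (D c)"
    then have [measurable]: "(\<lambda>X. X(c := z)) \<in> PiM I2 D \<rightarrow>\<^sub>M PiM (insert c I2) D"
      by (intro measurable_fun_upd[where J = I2]) auto
    show "(\<integral>\<^sup>+X. F (X(c := z)) \<partial>PiM I2 D) = (\<integral>\<^sup>+x. \<integral>\<^sup>+X. F (X(a := x, c := z)) \<partial>PiM I1 D \<partial>D a)"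
      unfolding I2_def by (rule nn_integral_PiM_insert[OF D]) (simp add: I2_def[symmetric])
  qed
  also have "\<dots> = (\<integral>\<^sup>+z. \<integral>\<^sup>+x. \<integral>\<^sup>+y. \<integral>\<^sup>+X. F (X(b := y, a := x, c := z)) \<partial>PiM I0 D \<partial>D b \<partial>D a \<partial>D c)"
  proof (intro nn_integral_cong)
    fix z x assume zx: "z \<in> space (D c)" "x \<in> space (D a)"
    have [measurable]: "(\<lambda>X. X(a := x)) \<in> PiM I1 D \<rightarrow>\<^sub>M PiM I2 D"
      unfolding I2_def using zx by (intro measurable_fun_upd[where J = I1]) auto
    have [measurable]: "(\<lambda>X. X(c := z)) \<in> PiM I2 D \<rightarrow>\<^sub>M PiM (insert c I2) D"
      using zx by (intro measurable_fun_upd[where J = I2]) auto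
    show "(\<integral>\<^sup>+X. F (X(a := x, c := z)) \<partial>PiM I1 D) = (\<integral>\<^sup>+y. \<integral>\<^sup>+X. F (X(b := y, a := x, c := z)) \<partial>PiM I0 D \<partial>D b)"
      unfolding I1_def by (rule nn_integral_PiM_insert[OF D]) (simp add: I1_def[symmetric])
  qed
  finally show ?thesis by (simp add: I0_def)
qed

lemma measurable_PiM_UNIV:
  assumes "\<And>i. (\<lambda>x. g x i) \<in> M \<rightarrow>\<^sub>M D i"
  shows "g \<in> M \<rightarrow>\<^sub>M PiM UNIV D"
  by (rule measurable_PiM_single') (use assms in \<open>auto intro: measurable_space[OF assms]\<close>)

lemma measurable_upd3:
  assumes "sets (D a) = sets borel" "sets (D b) = sets borel" "sets (D c) = sets borel"
    and "x \<in> borel_measurable M" "y \<in> borel_measurable M" "z \<in> borel_measurable M"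
    and g: "g \<in> M \<rightarrow>\<^sub>M PiM (- {a, b, c}) D"
  shows "(\<lambda>p. (g p)(b := y p, a := x p, c := z p)) \<in> M \<rightarrow>\<^sub>M PiM UNIV D"
proof (rule measurable_PiM_UNIV)
  fix i
  have m: "(\<lambda>p. g p i) \<in> M \<rightarrow>\<^sub>M D i" if "i \<in> - {a, b, c}"
    by (intro measurable_compose[OF g measurable_component_singleton] that)
  show "(\<lambda>p. ((g p)(b := y p, a := x p, c := z p)) i) \<in> M \<rightarrow>\<^sub>M D i"
    using m measurable_cong_sets[OF refl assms(1), of M] measurable_cong_sets[OF refl assms(2), of M] measurable_cong_sets[OF refl assms(3), of M] assms(4-6)
    by (cases "i = c"; cases "i = a"; cases "i = b") auto
qed

text \<open>Coordinates count backwards from the north-east corner, so harmonic functions are determined by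
  recursion from the boundary. The slots \<open>(Suc i, 0)\<close> and \<open>(0, Suc j)\<close> of the driving noise hold
  horizontal and inverted vertical boundary ratios, and \<open>(Suc i, Suc j)\<close> holds an environment weight.\<close>

fun stat_h :: "(nat \<times> nat \<Rightarrow> real) \<Rightarrow> nat \<Rightarrow> nat \<Rightarrow> real" where
  "stat_h f 0 0 = 1"
| "stat_h f (Suc i) 0 = f (Suc i, 0) * stat_h f i 0"
| "stat_h f 0 (Suc j) = stat_h f 0 j / f (0, Suc j)"
| "stat_h f (Suc i) (Suc j) = f (Suc i, Suc j) * stat_h f i (Suc j) + (1 - f (Suc i, Suc j)) * stat_h f (Suc i) j"

definition stat_w :: "(nat \<times> nat \<Rightarrow> real) \<Rightarrow> nat \<Rightarrow> nat \<Rightarrow> real" where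
  "stat_w f i j = f (Suc i, Suc j)"

definition unit_valued :: "('i \<Rightarrow> real) \<Rightarrow> bool" where
  "unit_valued f \<longleftrightarrow> (\<forall>p. 0 < f p \<and> f p < 1)"

lemma harmonic_stat_h: "harmonic (stat_w f) (stat_h f)"
  by (simp add: harmonic_def stat_w_def)

lemma stat_h_pos: "unit_valued f \<Longrightarrow> 0 < stat_h f i j"
  by (induction f i j rule: stat_h.induct) (auto simp: unit_valued_def intro!: add_pos_pos mult_pos_pos)

lemma stat_h_measurable [measurable]:
  assumes [measurable]: "\<And>p. (\<lambda>x. g x p) \<in> borel_measurable M"
  shows "(\<lambda>x. stat_h (g x) i j) \<in> borel_measurable M"
proof (induction i arbitrary: j)
  case 0
  show ?case by (induction j) auto
next
  case (Suc i)
  note [measurable] = Suc.IH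
  show ?case by (induction j) auto
qed

definition h_ratio :: "(nat \<times> nat \<Rightarrow> real) \<Rightarrow> nat \<Rightarrow> nat \<Rightarrow> real" where
  "h_ratio f i j = stat_h f (Suc i) j / stat_h f i j"

definition v_ratio :: "(nat \<times> nat \<Rightarrow> real) \<Rightarrow> nat \<Rightarrow> nat \<Rightarrow> real" where
  "v_ratio f i j = stat_h f i j / stat_h f i (Suc j)"

definition stat_law :: "real \<Rightarrow> real \<Rightarrow> real \<Rightarrow> nat \<times> nat \<Rightarrow> real measure" where
  "stat_law a b l p = (if snd p = 0 then beta_distribution (a + l) b
     else if fst p = 0 then beta_distribution l a else beta_distribution a b)"

lemma sets_stat_law [simp, measurable_cong]: "sets (stat_law a b l p) = sets borel"
  by (simp add: stat_law_def)

lemma space_stat_law [simp]: "space (stat_law a b l p) = UNIV"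
  by (simp add: stat_law_def)

lemma prob_space_stat_law: "0 < a \<Longrightarrow> 0 < b \<Longrightarrow> 0 < l \<Longrightarrow> prob_space (stat_law a b l p)"
  by (auto simp: stat_law_def intro!: prob_space_beta_distribution)

lemma AE_stat_law: "AE x in stat_law a b l p. 0 < x \<and> x < 1"
proof -
  have "stat_law a b l p = beta_distribution (a + l) b \<or> stat_law a b l p = beta_distribution l a
      \<or> stat_law a b l p = beta_distribution a b"
    by (simp add: stat_law_def)
  then show ?thesis by (elim disjE ssubst) (rule AE_beta_distribution)+
qed

abbreviation stat_measure :: "real \<Rightarrow> real \<Rightarrow> real \<Rightarrow> (nat \<times> nat \<Rightarrow> real) measure" where
  "stat_measure a b l \<equiv> PiM UNIV (stat_law a b l)"

lemma AE_stat_measure: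
  assumes "0 < a" "0 < b" "0 < l"
  shows "AE f in stat_measure a b l. unit_valued f"
  unfolding unit_valued_def AE_all_countable
  using assms by (intro allI AE_PiM_component prob_space_stat_law AE_stat_law) auto

text \<open>The Burke property for one cell: the boundary ratios are pushed through the cell \<open>(i, j)\<close>, and the
  environment weight, now used up, is replaced by the complementary beta variable so that the law of
  the whole noise is preserved.\<close>

definition cell_map :: "nat \<Rightarrow> nat \<Rightarrow> (nat \<times> nat \<Rightarrow> real) \<Rightarrow> nat \<times> nat \<Rightarrow> real" where
  "cell_map i j f =
     (let p = (f (Suc i, 0), f (0, Suc j)); q = beta_split (f (Suc i, Suc j), snd (beta_join p))
      in f((0, Suc j) := snd q, (Suc i, 0) := fst q, (Suc i, Suc j) := fst (beta_join p)))"

lemma stat_measurable_component [measurable]: "(\<lambda>f. f p) \<in> borel_measurable (stat_measure a b l)"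
proof -
  have "(\<lambda>f. f p) \<in> stat_measure a b l \<rightarrow>\<^sub>M stat_law a b l p" by measurable
  then show ?thesis by (simp cong: measurable_cong_sets)
qed

lemma measurable_into_stat_measure:
  assumes "\<And>p. (\<lambda>x. g x p) \<in> borel_measurable M"
  shows "g \<in> M \<rightarrow>\<^sub>M stat_measure a b l"
  by (rule measurable_PiM_UNIV) (use assms in \<open>simp cong: measurable_cong_sets\<close>)

lemma cell_map_measurable [measurable]: "cell_map i j \<in> stat_measure a b l \<rightarrow>\<^sub>M stat_measure a b l"
proof (rule measurable_into_stat_measure)
  fix p
  show "(\<lambda>x. cell_map i j x p) \<in> borel_measurable (stat_measure a b l)"
    unfolding cell_map_def Let_def fun_upd_def beta_split_def beta_join_def
    by (cases "p = (Suc i, Suc j)"; cases "p = (Suc i, 0)"; cases "p = (0, Suc j)") auto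
qed

text \<open>With the other coordinates frozen, the map acts on the three coordinates of the cell
  exactly as in \<open>burke_nn_integral\<close>.\<close>

lemma distr_cell_map:
  assumes l: "0 < a" "0 < b" "0 < l"
  shows "distr (stat_measure a b l) (stat_measure a b l) (cell_map i j) = stat_measure a b l"
proof (rule measure_eqI)
  let ?Q = "stat_measure a b l"
  let ?a = "(Suc i, 0::nat)" and ?b = "(0::nat, Suc j)" and ?c = "(Suc i, Suc j)"
  let ?R = "PiM (- {?a, ?b, ?c}) (stat_law a b l)"
  let ?A = "beta_distribution (a + l) b" and ?B = "beta_distribution l a" and ?C = "beta_distribution a b"
  have D: "prob_space (stat_law a b l p)" for p using l by (rule prob_space_stat_law)
  have [simp]: "stat_law a b l ?a = ?A" "stat_law a b l ?b = ?B" "stat_law a b l ?c = ?C"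
    by (simp_all add: stat_law_def)
  interpret R: prob_space ?R using D by (intro prob_space_PiM)
  interpret B: sigma_finite_measure ?B using l by (intro sigma_finite_beta)
  fix S assume "S \<in> sets (distr ?Q ?Q (cell_map i j))"
  then have S [measurable]: "S \<in> sets ?Q" by simp
  define u where "u X p = X(?b := snd (fst p), ?a := fst (fst p), ?c := snd p)" for X :: "nat \<times> nat \<Rightarrow> real" and p :: "(real \<times> real) \<times> real"
  have u [measurable]: "(\<lambda>x. u (g x) (q x)) \<in> M \<rightarrow>\<^sub>M ?Q"
    if [measurable]: "g \<in> M \<rightarrow>\<^sub>M ?R" "q \<in> M \<rightarrow>\<^sub>M ((borel \<Otimes>\<^sub>M borel) \<Otimes>\<^sub>M borel)" for g q M
    unfolding u_def by (rule measurable_upd3) auto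
  define G where "G p = (\<integral>\<^sup>+X. indicator S (u X p) \<partial>?R)" for p
  have [measurable]: "G \<in> borel_measurable ((borel \<Otimes>\<^sub>M borel) \<Otimes>\<^sub>M borel)"
    unfolding G_def by measurable
  have int: "(\<integral>\<^sup>+f. F f \<partial>?Q) = (\<integral>\<^sup>+z. \<integral>\<^sup>+p. \<integral>\<^sup>+X. F (u X (p, z)) \<partial>?R \<partial>(?A \<Otimes>\<^sub>M ?B) \<partial>?C)"
    if F [measurable]: "F \<in> borel_measurable ?Q" for F
  proof -
    have "(\<integral>\<^sup>+f. F f \<partial>?Q) = (\<integral>\<^sup>+z. \<integral>\<^sup>+x. \<integral>\<^sup>+y. \<integral>\<^sup>+X. F (u X ((x, y), z)) \<partial>?R \<partial>?B \<partial>?A \<partial>?C)"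
      by (subst nn_integral_PiM_three[where a = ?a and b = ?b and c = ?c]) (simp_all add: D u_def)
    also have "\<dots> = (\<integral>\<^sup>+z. \<integral>\<^sup>+p. \<integral>\<^sup>+X. F (u X (p, z)) \<partial>?R \<partial>(?A \<Otimes>\<^sub>M ?B) \<partial>?C)"
      by (intro nn_integral_cong, subst B.nn_integral_fst[symmetric]) auto
    finally show ?thesis .
  qed
  have cell: "cell_map i j (u X (p, z)) = u X (beta_split (z, snd (beta_join p)), fst (beta_join p))" for X p z
    by (auto simp: cell_map_def u_def Let_def fun_eq_iff)
  have "emeasure (distr ?Q ?Q (cell_map i j)) S = (\<integral>\<^sup>+f. indicator S f \<partial>distr ?Q ?Q (cell_map i j))"
    by simp
  also have "\<dots> = (\<integral>\<^sup>+f. indicator S (cell_map i j f) \<partial>?Q)"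
    by (intro nn_integral_distr) measurable
  also have "\<dots> = (\<integral>\<^sup>+z. \<integral>\<^sup>+p. G (beta_split (z, snd (beta_join p)), fst (beta_join p)) \<partial>(?A \<Otimes>\<^sub>M ?B) \<partial>?C)"
    by (subst int) (auto simp: cell G_def)
  also have "\<dots> = (\<integral>\<^sup>+z. \<integral>\<^sup>+p. G (p, z) \<partial>(?A \<Otimes>\<^sub>M ?B) \<partial>?C)"
    using l by (intro burke_nn_integral) auto
  also have "\<dots> = (\<integral>\<^sup>+f. indicator S f \<partial>?Q)"
    by (subst int) (auto simp: G_def)
  finally show "emeasure (distr ?Q ?Q (cell_map i j)) S = emeasure ?Q S" by simp
qed simp

section \<open>Stationarity along staircases\<close>

definition dual_weight :: "(nat \<times> nat \<Rightarrow> real) \<Rightarrow> nat \<Rightarrow> nat \<Rightarrow> real" where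
  "dual_weight f i j = fst (beta_join (h_ratio f i j, v_ratio f i j))"

text \<open>The noise after the cells of the first \<open>m\<close> columns (up to height \<open>n\<close>) and of the first \<open>j\<close> rows of
  column \<open>m\<close> have been processed by \<open>cell_map\<close>.\<close>

definition stair :: "nat \<Rightarrow> nat \<Rightarrow> nat \<Rightarrow> (nat \<times> nat \<Rightarrow> real) \<Rightarrow> nat \<times> nat \<Rightarrow> real" where
  "stair n m j f p =
    (case p of (0, 0) \<Rightarrow> f p
     | (Suc i, 0) \<Rightarrow> h_ratio f i (if i < m then n else if i = m then j else 0)
     | (0, Suc k) \<Rightarrow> v_ratio f (if k < j then Suc m else if k < n then m else 0) k
     | (Suc i, Suc k) \<Rightarrow> if (i < m \<and> k < n) \<or> (i = m \<and> k < j) then dual_weight f i k else f p)"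

lemma stair_initial: "unit_valued f \<Longrightarrow> stair n 0 0 f = f"
proof
  fix p assume f: "unit_valued f"
  have nz: "stat_h f i k \<noteq> 0" for i k using stat_h_pos[OF f, of i k] by simp
  have nf: "f q \<noteq> 0" for q using f by (metis unit_valued_def less_irrefl)
  show "stair n 0 0 f p = f p"
    using nz nf by (auto simp: stair_def h_ratio_def v_ratio_def split: prod.split nat.split)
qed

lemma stair_column: "stair n m n = stair n (Suc m) 0"
  by (auto simp: stair_def fun_eq_iff split: prod.split nat.split)

text \<open>Divided by the value at the horizontal successor (m, Suc j), the harmonic equation at
  (Suc m, Suc j) becomes \<open>beta_split\<close>, with r the quotient of the values at the two
  successors. This r is the product of the two incoming ratios.\<close>

lemma stair_step:
  assumes f: "unit_valued f" and "j < n"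
  shows "cell_map m j (stair n m j f) = stair n m (Suc j) f"
proof -
  have pos: "0 < stat_h f i k" for i k by (rule stat_h_pos[OF f])
  have nz: "stat_h f i k \<noteq> 0" for i k using pos[of i k] by simp
  define r where "r = h_ratio f m j * v_ratio f m j"
  have r: "r = stat_h f (Suc m) j / stat_h f m (Suc j)"
    using nz by (simp add: r_def h_ratio_def v_ratio_def)
  have s: "beta_split (f (Suc m, Suc j), r) = (h_ratio f m (Suc j), v_ratio f (Suc m) j)"
  proof -
    have "f (Suc m, Suc j) + (1 - f (Suc m, Suc j)) * r = h_ratio f m (Suc j)"
      using nz[of m "Suc j"] by (simp add: r h_ratio_def field_simps)
    moreover have "r / h_ratio f m (Suc j) = v_ratio f (Suc m) j"
      using nz[of m "Suc j"] unfolding r h_ratio_def v_ratio_def by (simp del: stat_h.simps)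
    ultimately show ?thesis by (simp add: beta_split_def)
  qed
  have st: "stair n m j f (Suc m, 0) = h_ratio f m j" "stair n m j f (0, Suc j) = v_ratio f m j"
    "stair n m j f (Suc m, Suc j) = f (Suc m, Suc j)"
    using \<open>j < n\<close> by (auto simp: stair_def)
  have "cell_map m j (stair n m j f) = (stair n m j f)((0, Suc j) := v_ratio f (Suc m) j,
      (Suc m, 0) := h_ratio f m (Suc j), (Suc m, Suc j) := dual_weight f m j)"
    unfolding cell_map_def Let_def st
    using s by (simp add: beta_join_def r_def[symmetric] dual_weight_def)
  also have "\<dots> = stair n m (Suc j) f"
    using \<open>j < n\<close> by (auto simp: stair_def fun_eq_iff less_Suc_eq split: prod.split nat.split)
  finally show ?thesis .
qed

lemma stair_measurable [measurable]: "stair n m j \<in> stat_measure a b l \<rightarrow>\<^sub>M stat_measure a b l"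
proof (rule measurable_into_stat_measure)
  fix p
  show "(\<lambda>x. stair n m j x p) \<in> borel_measurable (stat_measure a b l)"
    unfolding stair_def h_ratio_def v_ratio_def dual_weight_def beta_join_def
    by (cases p; cases "fst p"; cases "snd p") auto
qed

text \<open>Cells are processed one at a time and each preserves the law. So the ratios read off
  along the staircase are again independent with the boundary laws, and independent of the weights
  not yet processed.\<close>

lemma distr_stair:
  assumes l: "0 < a" "0 < b" "0 < l" and "j \<le> n"
  shows "distr (stat_measure a b l) (stat_measure a b l) (stair n m j) = stat_measure a b l"
proof -
  let ?Q = "stat_measure a b l"
  have step: "distr ?Q ?Q (stair n m (Suc j)) = ?Q" if "distr ?Q ?Q (stair n m j) = ?Q" "j < n" for m j
  proof -
    have "distr ?Q ?Q (stair n m (Suc j)) = distr ?Q ?Q (cell_map m j \<circ> stair n m j)"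
    proof (rule distr_cong_AE)
      show "AE f in ?Q. stair n m (Suc j) f = (cell_map m j \<circ> stair n m j) f"
        using AE_stat_measure[OF l] by eventually_elim (simp add: stair_step that)
    qed auto
    also have "\<dots> = distr (distr ?Q ?Q (stair n m j)) ?Q (cell_map m j)"
      by (intro distr_distr[symmetric]) measurable
    finally show ?thesis using that by (simp add: distr_cell_map[OF l])
  qed
  have col: "distr ?Q ?Q (stair n m j) = ?Q" if "distr ?Q ?Q (stair n m 0) = ?Q" "j \<le> n" for m j
    using that(2) by (induction j) (auto simp: that(1) step)
  have "distr ?Q ?Q (stair n m 0) = ?Q"
  proof (induction m)
    case 0
    have "distr ?Q ?Q (stair n 0 0) = distr ?Q ?Q (\<lambda>f. f)"
    proof (rule distr_cong_AE)
      show "AE f in ?Q. stair n 0 0 f = f"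
        using AE_stat_measure[OF l] by eventually_elim (simp add: stair_initial)
    qed auto
    then show ?case by simp
  next
    case (Suc m)
    then show ?case using col[of m n] by (simp add: stair_column)
  qed
  with col \<open>j \<le> n\<close> show ?thesis by blast
qed

section \<open>Images of product measures and moments of products of ratios\<close>

text \<open>One tool for restricting to a set of coordinates, for the marginals of a coupling and
  for relabelling sites. Injectivity of s keeps the selected coordinates independent.\<close>

lemma distr_PiM_map:
  fixes D :: "'i \<Rightarrow> 'a measure" and D' :: "'j \<Rightarrow> 'b measure"
  assumes D: "\<And>i. prob_space (D i)" and D': "\<And>j. prob_space (D' j)" and inj: "inj_on s J"
    and phi: "\<And>j. j \<in> J \<Longrightarrow> phi \<in> D (s j) \<rightarrow>\<^sub>M D' j"
    and eq: "\<And>j. j \<in> J \<Longrightarrow> distr (D (s j)) (D' j) phi = D' j"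
  shows "distr (PiM UNIV D) (PiM J D') (\<lambda>f. \<lambda>j\<in>J. phi (f (s j))) = PiM J D'"
proof -
  interpret P: product_prob_space D' J
    by (intro product_prob_spaceI D')
  have comp: "(\<lambda>f. phi (f (s j))) \<in> PiM UNIV D \<rightarrow>\<^sub>M D' j" if "j \<in> J" for j
    using phi[OF that] by (intro measurable_compose[OF measurable_component_singleton]) auto
  have m: "(\<lambda>f. \<lambda>j\<in>J. phi (f (s j))) \<in> PiM UNIV D \<rightarrow>\<^sub>M PiM J D'"
    by (intro measurable_restrict comp)
  show ?thesis
  proof (rule P.PiM_eq)
    fix I F assume I: "finite I" "I \<subseteq> J" and F: "\<And>j. j \<in> I \<Longrightarrow> F j \<in> sets (D' j)"
    define A where "A i = phi -` F (inv_into I s i) \<inter> space (D i)" for i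
    have injI: "inj_on s I" using inj I by (rule_tac inj_on_subset)
    have A: "A (s j) = phi -` F j \<inter> space (D (s j))" if "j \<in> I" for j
      using inv_into_f_f[OF injI that] by (simp add: A_def)
    have A_sets: "A i \<in> sets (D i)" if "i \<in> s ` I" for i
    proof -
      from that obtain j where j: "j \<in> I" "i = s j" by auto
      show ?thesis unfolding j(2) A[OF j(1)]
        using phi[of j] F[OF j(1)] j I by (intro measurable_sets) auto
    qed
    have E: "prod_emb J D' I (\<Pi>\<^sub>E j\<in>I. F j) \<in> sets (PiM J D')"
      using I F by (intro sets_PiM_I) auto
    have "(\<lambda>f. \<lambda>j\<in>J. phi (f (s j))) -` prod_emb J D' I (\<Pi>\<^sub>E j\<in>I. F j) \<inter> space (PiM UNIV D)
        = prod_emb UNIV D (s ` I) (\<Pi>\<^sub>E i\<in>s ` I. A i)"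
    proof (intro set_eqI)
      fix f
      have sp: "f \<in> space (PiM UNIV D) \<Longrightarrow> (\<lambda>j\<in>J. phi (f (s j))) \<in> space (PiM J D')"
        using measurable_space[OF m] .
      show "f \<in> (\<lambda>f. \<lambda>j\<in>J. phi (f (s j))) -` prod_emb J D' I (\<Pi>\<^sub>E j\<in>I. F j) \<inter> space (PiM UNIV D)
          \<longleftrightarrow> f \<in> prod_emb UNIV D (s ` I) (\<Pi>\<^sub>E i\<in>s ` I. A i)"
      proof (cases "f \<in> space (PiM UNIV D)")
        case True
        have fs: "f i \<in> space (D i)" for i using True by (auto simp: space_PiM)
        have "f \<in> (\<lambda>f. \<lambda>j\<in>J. phi (f (s j))) -` prod_emb J D' I (\<Pi>\<^sub>E j\<in>I. F j) \<inter> space (PiM UNIV D)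
            \<longleftrightarrow> (\<forall>j\<in>I. phi (f (s j)) \<in> F j)"
          using True sp[OF True] I by (auto simp: prod_emb_iff PiE_iff subset_eq space_PiM)
        also have "\<dots> \<longleftrightarrow> (\<forall>j\<in>I. f (s j) \<in> A (s j))" using A fs by simp
        also have "\<dots> \<longleftrightarrow> f \<in> prod_emb UNIV D (s ` I) (\<Pi>\<^sub>E i\<in>s ` I. A i)"
          using fs by (simp add: prod_emb_iff Pi_iff)
        finally show ?thesis .
      next
        case False
        then show ?thesis by (auto simp: prod_emb_iff space_PiM)
      qed
    qed
    then have "emeasure (distr (PiM UNIV D) (PiM J D') (\<lambda>f. \<lambda>j\<in>J. phi (f (s j)))) (prod_emb J D' I (\<Pi>\<^sub>E j\<in>I. F j))
        = emeasure (PiM UNIV D) (prod_emb UNIV D (s ` I) (\<Pi>\<^sub>E i\<in>s ` I. A i))"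
      using E by (simp add: emeasure_distr[OF m])
    also have "\<dots> = (\<Prod>i\<in>s ` I. emeasure (D i) (A i))"
      using I A_sets D by (intro emeasure_PiM_emb) auto
    also have "\<dots> = (\<Prod>j\<in>I. emeasure (D (s j)) (A (s j)))"
      using injI by (simp add: prod.reindex)
    also have "\<dots> = (\<Prod>j\<in>I. emeasure (D' j) (F j))"
    proof (intro prod.cong refl)
      fix j assume j: "j \<in> I"
      then have "emeasure (distr (D (s j)) (D' j) phi) (F j) = emeasure (D (s j)) (A (s j))"
        using I F[OF j] phi[of j] by (subst emeasure_distr) (auto simp: A)
      then show "emeasure (D (s j)) (A (s j)) = emeasure (D' j) (F j)"
        using eq[of j] j I by auto
    qed
    finally show "emeasure (distr (PiM UNIV D) (PiM J D') (\<lambda>f. \<lambda>j\<in>J. phi (f (s j)))) (prod_emb J D' I (\<Pi>\<^sub>E j\<in>I. F j))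
        = (\<Prod>j\<in>I. emeasure (D' j) (F j))" .
  qed simp
qed

lemma nn_integral_PiM_prod:
  assumes D: "\<And>i. prob_space (D i)" and "finite J" and psi: "\<And>j. j \<in> J \<Longrightarrow> psi j \<in> borel_measurable (D j)"
  shows "(\<integral>\<^sup>+f. (\<Prod>j\<in>J. psi j (f j)) \<partial>PiM UNIV D) = (\<Prod>j\<in>J. \<integral>\<^sup>+x. psi j x \<partial>D j)"
proof -
  interpret S: product_prob_space D UNIV by (intro product_prob_spaceI D)
  have r: "distr (PiM UNIV D) (PiM J D) (\<lambda>f. \<lambda>j\<in>J. f j) = PiM J D"
    by (rule distr_PiM_map[of D D "\<lambda>j. j" J "\<lambda>x. x"]) (auto simp: D distr_id2)
  have m1: "(\<lambda>f. \<lambda>j\<in>J. f j) \<in> PiM UNIV D \<rightarrow>\<^sub>M PiM J D"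
    by (intro measurable_restrict measurable_component_singleton) auto
  have m2: "(\<lambda>f. \<Prod>j\<in>J. psi j (f j)) \<in> borel_measurable (PiM J D)"
  proof (rule borel_measurable_prod_ennreal)
    fix j assume j: "j \<in> J"
    show "(\<lambda>f. psi j (f j)) \<in> borel_measurable (PiM J D)"
      using measurable_compose[OF measurable_component_singleton[OF j, of D] psi[OF j]] .
  qed
  have "(\<Prod>j\<in>J. \<integral>\<^sup>+x. psi j x \<partial>D j) = (\<integral>\<^sup>+f. (\<Prod>j\<in>J. psi j (f j)) \<partial>PiM J D)"
    using assms by (intro S.product_nn_integral_prod[symmetric]) auto
  also have "\<dots> = (\<integral>\<^sup>+f. (\<Prod>j\<in>J. psi j (f j)) \<partial>distr (PiM UNIV D) (PiM J D) (\<lambda>f. \<lambda>j\<in>J. f j))"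
    by (simp only: r)
  also have "\<dots> = (\<integral>\<^sup>+f. (\<Prod>j\<in>J. psi j ((\<lambda>j\<in>J. f j) j)) \<partial>PiM UNIV D)"
    by (subst nn_integral_distr) (simp_all add: m1 m2)
  also have "\<dots> = (\<integral>\<^sup>+f. (\<Prod>j\<in>J. psi j (f j)) \<partial>PiM UNIV D)"
    by (intro nn_integral_cong prod.cong) auto
  finally show ?thesis ..
qed

lemma h_ratio_pos: "unit_valued f \<Longrightarrow> 0 < h_ratio f i j"
  by (simp add: h_ratio_def stat_h_pos)

lemma v_ratio_pos: "unit_valued f \<Longrightarrow> 0 < v_ratio f i j"
  by (simp add: v_ratio_def stat_h_pos)

lemma prod_powr:
  fixes x :: "'a \<Rightarrow> real"
  assumes "\<And>i. i \<in> A \<Longrightarrow> 0 < x i"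
  shows "(\<Prod>i\<in>A. x i) powr t = (\<Prod>i\<in>A. x i powr t)"
  using assms by (induction A rule: infinite_finite_induct) (auto simp: powr_mult prod_nonneg less_imp_le)

lemma prod_h_ratio:
  assumes f: "unit_valued f" and "p \<le> m"
  shows "(\<Prod>i\<in>{p..<m}. h_ratio f i n) = stat_h f m n / stat_h f p n"
  using assms(2)
proof (induction m rule: dec_induct)
  case (step m)
  have "stat_h f m n \<noteq> 0" using stat_h_pos[OF f, of m n] by simp
  then show ?case using step by (simp add: h_ratio_def)
qed (use stat_h_pos[OF f, of p n] in simp)

lemma prod_v_ratio:
  assumes f: "unit_valued f" and "q \<le> n"
  shows "(\<Prod>j\<in>{q..<n}. v_ratio f m j) = stat_h f m q / stat_h f m n"
  using assms(2)
proof (induction n rule: dec_induct)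
  case (step n)
  have "stat_h f m n \<noteq> 0" using stat_h_pos[OF f, of m n] by simp
  then show ?case using step by (simp add: v_ratio_def)
qed (use stat_h_pos[OF f, of m q] in simp)

text \<open>By \<open>distr_stair\<close> the staircase coordinates may be exchanged for the noise
  itself, whose coordinates are independent, so the moment factorises.\<close>

lemma stair_moment:
  assumes l: "0 < a" "0 < b" "0 < l" and J: "finite J" and c: "0 < c" "0 < d" "0 < c + t"
    and law: "\<And>p. p \<in> J \<Longrightarrow> stat_law a b l p = beta_distribution c d"
    and Y: "\<And>f. unit_valued f \<Longrightarrow> (\<forall>p\<in>J. 0 < stair n m 0 f p) \<and> Y f = (\<Prod>p\<in>J. stair n m 0 f p)"
  shows "(\<integral>\<^sup>+f. ennreal (Y f powr t) \<partial>stat_measure a b l) = ennreal ((Beta (c + t) d / Beta c d) ^ card J)"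
proof -
  let ?Q = "stat_measure a b l"
  have "(\<integral>\<^sup>+f. ennreal (Y f powr t) \<partial>?Q) = (\<integral>\<^sup>+f. (\<Prod>p\<in>J. ennreal (stair n m 0 f p powr t)) \<partial>?Q)"
  proof (intro nn_integral_cong_AE)
    show "AE f in ?Q. ennreal (Y f powr t) = (\<Prod>p\<in>J. ennreal (stair n m 0 f p powr t))"
      using AE_stat_measure[OF l]
    proof eventually_elim
      case (elim f)
      then have "Y f powr t = (\<Prod>p\<in>J. stair n m 0 f p powr t)"
        using Y[OF elim] prod_powr[of J "stair n m 0 f" t] by auto
      then show ?case by (simp add: prod_ennreal)
    qed
  qed
  also have "\<dots> = (\<integral>\<^sup>+f. (\<Prod>p\<in>J. ennreal (f p powr t)) \<partial>distr ?Q ?Q (stair n m 0))"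
    by (subst nn_integral_distr) (auto intro!: borel_measurable_prod_ennreal)
  also have "\<dots> = (\<Prod>p\<in>J. \<integral>\<^sup>+x. ennreal (x powr t) \<partial>stat_law a b l p)"
    unfolding distr_stair[OF l le0]
    by (intro nn_integral_PiM_prod prob_space_stat_law l J) (auto cong: measurable_cong_sets)
  also have "\<dots> = (\<Prod>p\<in>J. ennreal (Beta (c + t) d / Beta c d))"
    using c by (intro prod.cong) (simp_all add: law nn_integral_beta_powr)
  also have "\<dots> = ennreal ((Beta (c + t) d / Beta c d) ^ card J)"
    using less_imp_le[OF Beta_real_pos[OF c(3,2)]] less_imp_le[OF Beta_real_pos[OF c(1,2)]]
    by (simp add: ennreal_power)
  finally show ?thesis .
qed

text \<open>The quotient telescopes into the horizontal ratios of row n, which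
  \<open>stair n m 0\<close> holds in the slots (Suc i, 0) with i < m.\<close>

lemma row_moment:
  assumes l: "0 < a" "0 < b" "0 < l" and "p \<le> m" and t: "0 < a + l + t"
  shows "(\<integral>\<^sup>+f. ennreal ((stat_h f m n / stat_h f p n) powr t) \<partial>stat_measure a b l)
    = ennreal ((Beta (a + l + t) b / Beta (a + l) b) ^ (m - p))"
proof -
  have "(\<integral>\<^sup>+f. ennreal ((stat_h f m n / stat_h f p n) powr t) \<partial>stat_measure a b l)
    = ennreal ((Beta (a + l + t) b / Beta (a + l) b) ^ card ((\<lambda>i. (Suc i, 0::nat)) ` {p..<m}))"
  proof (rule stair_moment[OF l, where n = n and m = m])
    fix f :: "nat \<times> nat \<Rightarrow> real" assume f: "unit_valued f"
    show "(\<forall>q\<in>(\<lambda>i. (Suc i, 0::nat)) ` {p..<m}. 0 < stair n m 0 f q) \<and>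
      stat_h f m n / stat_h f p n = (\<Prod>q\<in>(\<lambda>i. (Suc i, 0::nat)) ` {p..<m}. stair n m 0 f q)"
      unfolding prod_h_ratio[OF f \<open>p \<le> m\<close>, symmetric]
      by (subst prod.reindex) (auto simp: inj_on_def stair_def h_ratio_pos[OF f] intro!: prod.cong)
  qed (use l t in \<open>auto simp: stat_law_def\<close>)
  then show ?thesis by (simp add: card_image inj_on_def)
qed

lemma col_moment:
  assumes l: "0 < a" "0 < b" "0 < l" and "q \<le> n" and t: "0 < l + t"
  shows "(\<integral>\<^sup>+f. ennreal ((stat_h f m q / stat_h f m n) powr t) \<partial>stat_measure a b l)
    = ennreal ((Beta (l + t) a / Beta l a) ^ (n - q))"
proof -
  have "(\<integral>\<^sup>+f. ennreal ((stat_h f m q / stat_h f m n) powr t) \<partial>stat_measure a b l)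
    = ennreal ((Beta (l + t) a / Beta l a) ^ card ((\<lambda>j. (0::nat, Suc j)) ` {q..<n}))"
  proof (rule stair_moment[OF l, where n = n and m = m])
    fix f :: "nat \<times> nat \<Rightarrow> real" assume f: "unit_valued f"
    show "(\<forall>p\<in>(\<lambda>j. (0::nat, Suc j)) ` {q..<n}. 0 < stair n m 0 f p) \<and>
      stat_h f m q / stat_h f m n = (\<Prod>p\<in>(\<lambda>j. (0::nat, Suc j)) ` {q..<n}. stair n m 0 f p)"
      unfolding prod_v_ratio[OF f \<open>q \<le> n\<close>, symmetric]
      by (subst prod.reindex) (auto simp: inj_on_def stair_def v_ratio_pos[OF f] intro!: prod.cong)
  qed (use l t in \<open>auto simp: stat_law_def\<close>)
  then show ?thesis by (simp add: card_image inj_on_def)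
qed

section \<open>Law of the stationary Doob weight\<close>

definition stat_kappa :: "nat \<Rightarrow> nat \<Rightarrow> (nat \<times> nat \<Rightarrow> real) \<Rightarrow> real" where
  "stat_kappa i j f = f (Suc i, Suc j) * stat_h f i (Suc j) / stat_h f (Suc i) (Suc j)"

lemma stat_kappa_eq:
  assumes f: "unit_valued f"
  shows "stat_kappa i j f = kappa_of (f (Suc i, Suc j)) (h_ratio f i j * v_ratio f i j)"
proof -
  have pos: "0 < stat_h f i k" for i k by (rule stat_h_pos[OF f])
  have nz: "stat_h f i k \<noteq> 0" for i k using pos[of i k] by simp
  have "h_ratio f i j * v_ratio f i j = stat_h f (Suc i) j / stat_h f i (Suc j)"
    using nz by (simp add: h_ratio_def v_ratio_def)
  moreover have "w + (1 - w) * (x / y) = (w * y + (1 - w) * x) / y" if "y \<noteq> 0" for w x y :: real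
    using that by (simp add: field_simps)
  ultimately show ?thesis using nz[of i "Suc j"] by (simp add: stat_kappa_def kappa_of_def)
qed

lemma stat_kappa_measurable [measurable]:
  assumes [measurable]: "\<And>p. (\<lambda>x. g x p) \<in> borel_measurable M"
  shows "(\<lambda>x. stat_kappa i j (g x)) \<in> borel_measurable M"
  unfolding stat_kappa_def by measurable

text \<open>The staircase that stops just before the cell (i, j) has the two incoming ratios among
  its coordinates and leaves the weight untouched. The three are independent, and by
  \<open>distr_beta_mult\<close> the product of the ratios has law Beta(l, a + b).\<close>

lemma distr_stat_kappa:
  assumes l: "0 < a" "0 < b" "0 < l"
  shows "distr (stat_measure a b l) borel (stat_kappa i j) = density lborel (\<lambda>x. ennreal (kappa_density a b l x))"
proof -
  let ?Q = "stat_measure a b l"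
  let ?a = "(Suc i, 0::nat)" and ?b = "(0::nat, Suc j)" and ?c = "(Suc i, Suc j)"
  let ?A = "beta_distribution (a + l) b" and ?B = "beta_distribution l a" and ?C = "beta_distribution a b"
  have D: "prob_space (stat_law a b l p)" for p using l by (rule prob_space_stat_law)
  have [simp]: "stat_law a b l ?a = ?A" "stat_law a b l ?b = ?B" "stat_law a b l ?c = ?C"
    by (simp_all add: stat_law_def)
  interpret R: prob_space "PiM (- {?a, ?b, ?c}) (stat_law a b l)" using D by (intro prob_space_PiM)
  interpret B: sigma_finite_measure ?B using l by (intro sigma_finite_beta)
  interpret W: sigma_finite_measure "beta_distribution l (a + b)" using l by (intro sigma_finite_beta) auto
  define k where "k f = kappa_of (f ?c) (f ?a * f ?b)" for f :: "nat \<times> nat \<Rightarrow> real"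
  have [measurable]: "k \<in> borel_measurable ?Q" unfolding k_def by measurable
  \<comment> \<open>Height Suc j makes the slot (0, Suc j) hold the ratio at column i, while
    stopping after j rows leaves the cell (i, j) unprocessed.\<close>
  have "distr ?Q borel (stat_kappa i j) = distr ?Q borel (k \<circ> stair (Suc j) i j)"
  proof (rule distr_cong_AE)
    show "AE f in ?Q. stat_kappa i j f = (k \<circ> stair (Suc j) i j) f"
      using AE_stat_measure[OF l] by eventually_elim (simp add: stat_kappa_eq k_def stair_def)
  qed auto
  also have "\<dots> = distr (distr ?Q ?Q (stair (Suc j) i j)) borel k"
    by (intro distr_distr[symmetric]) measurable
  also have "\<dots> = distr ?Q borel k"
    using l by (subst distr_stair) auto
  also have "\<dots> = distr (?C \<Otimes>\<^sub>M beta_distribution l (a + b)) borel (\<lambda>p. kappa_of (fst p) (snd p))" (is "_ = ?R")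
  proof (rule measure_eqI)
    fix S assume "S \<in> sets (distr ?Q borel k)"
    then have S [measurable]: "S \<in> sets borel" by simp
    have "emeasure (distr ?Q borel k) S = (\<integral>\<^sup>+f. indicator S f \<partial>distr ?Q borel k)" by simp
    also have "\<dots> = (\<integral>\<^sup>+f. indicator S (k f) \<partial>?Q)" by (subst nn_integral_distr) simp_all
    also have "\<dots> = (\<integral>\<^sup>+z. \<integral>\<^sup>+x. \<integral>\<^sup>+y. indicator S (kappa_of z (x * y)) \<partial>?B \<partial>?A \<partial>?C)"
      by (subst nn_integral_PiM_three[where a = ?a and b = ?b and c = ?c]) (simp_all add: D k_def R.emeasure_space_1)
    also have "\<dots> = (\<integral>\<^sup>+z. \<integral>\<^sup>+p. indicator S (kappa_of z (fst p * snd p)) \<partial>(?A \<Otimes>\<^sub>M ?B) \<partial>?C)"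
      by (intro nn_integral_cong, subst B.nn_integral_fst[symmetric]) auto
    also have "\<dots> = (\<integral>\<^sup>+z. \<integral>\<^sup>+r. indicator S (kappa_of z r) \<partial>beta_distribution l (a + b) \<partial>?C)"
      using l by (subst distr_beta_mult[symmetric]) (auto simp: nn_integral_distr)
    also have "\<dots> = (\<integral>\<^sup>+p. indicator S (kappa_of (fst p) (snd p)) \<partial>(?C \<Otimes>\<^sub>M beta_distribution l (a + b)))"
      by (subst W.nn_integral_fst[symmetric]) auto
    also have "\<dots> = (\<integral>\<^sup>+x. indicator S x \<partial>?R)" by (subst nn_integral_distr) auto
    finally show "emeasure (distr ?Q borel k) S = emeasure ?R S" by simp
  qed simp
  also have "\<dots> = density lborel (\<lambda>x. ennreal (kappa_density a b l x))"
    by (rule distr_kappa_of[OF l])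
  finally show ?thesis .
qed

section \<open>Deviations and coupling\<close>

text \<open>For X of law Beta(a, b), m is the mean of ln X and F e s the mean of exp (s (ln X - m -
  e)). The derivative at s = 0 is - e, so a small s of the right sign brings F below its value 1 at
  0.\<close>

lemma beta_chernoff:
  assumes "0 < a" "0 < b" "0 < (d::real)"
  defines "m \<equiv> Digamma a - Digamma (a + b)"
  shows "\<exists>t>0. Beta (a + t) b / Beta a b * exp (- t * (m + d)) < 1"
    and "\<exists>t>0. t < a \<and> Beta (a - t) b / Beta a b * exp (t * (m - d)) < 1"
proof -
  define F where "F e s = Beta (a + s) b / Beta a b * exp (- s * (m + e))" for e s
  have B: "Beta a b > 0" using assms by (intro Beta_real_pos)
  have F0: "F e 0 = 1" for e using B by (simp add: F_def)
  have D: "(F e has_field_derivative - e) (at 0)" for e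
  proof -
    have "((\<lambda>x. Beta x b) has_field_derivative Beta a b * m) (at (a + 0))"
      using has_field_derivative_Beta1[of a b UNIV] assms(1,2) by (simp add: m_def not_nonpos_Ints_real)
    then have "((\<lambda>s. Beta (a + s) b) has_field_derivative Beta a b * m * 1) (at 0)"
      by (intro DERIV_chain2[where f = "\<lambda>x. Beta x b" and g = "\<lambda>s. a + s"]) (auto intro!: derivative_eq_intros)
    then have "(F e has_field_derivative (Beta a b * m * 1) / Beta a b * exp (- 0 * (m + e)) + (- (m + e) * exp (- 0 * (m + e))) * (Beta (a + 0) b / Beta a b)) (at 0)"
      unfolding F_def by (intro DERIV_mult DERIV_cdivide) (auto intro!: derivative_eq_intros)
    then show ?thesis using B by simp
  qed
  obtain r where r: "0 < r" "\<And>h. 0 < h \<Longrightarrow> h < r \<Longrightarrow> F d (0 + h) < F d 0"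
    using DERIV_neg_dec_right[OF D[of d]] assms(3) by auto
  show "\<exists>t>0. Beta (a + t) b / Beta a b * exp (- t * (m + d)) < 1"
    using r(1) r(2)[of "r / 2"] F0 by (intro exI[of _ "r / 2"]) (auto simp: F_def)
  obtain r where r: "0 < r" "\<And>h. 0 < h \<Longrightarrow> h < r \<Longrightarrow> F (- d) (0 - h) < F (- d) 0"
    using DERIV_pos_inc_left[OF D[of "- d"]] assms(3) by auto
  \<comment> \<open>Staying below a keeps the moment of order - h finite.\<close>
  define h where "h = min (r / 2) (a / 2)"
  have "0 < h" "h < r" "h < a" using r assms by (auto simp: h_def)
  then show "\<exists>t>0. t < a \<and> Beta (a - t) b / Beta a b * exp (t * (m - d)) < 1"
    using r(2)[of h] F0 by (intro exI[of _ h]) (auto simp: F_def)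
qed

lemma markov_power:
  assumes "prob_space Q" and [measurable]: "Y \<in> borel_measurable Q" "A \<in> sets Q"
    and B: "0 \<le> B" "(\<integral>\<^sup>+x. ennreal (Y x powr t) \<partial>Q) = ennreal (B ^ N)"
    and A: "AE x in Q. x \<in> A \<longrightarrow> exp (real N * s) \<le> Y x powr t"
  shows "measure Q A \<le> (B * exp (- s)) ^ N"
proof -
  interpret prob_space Q by fact
  have "emeasure Q A = (\<integral>\<^sup>+x. indicator A x \<partial>Q)" by simp
  also have "\<dots> \<le> (\<integral>\<^sup>+x. ennreal (exp (- (real N * s))) * ennreal (Y x powr t) \<partial>Q)"
  proof (rule nn_integral_mono_AE)
    show "AE x in Q. indicator A x \<le> ennreal (exp (- (real N * s))) * ennreal (Y x powr t)"
      using A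
    proof eventually_elim
      case (elim x)
      have "1 \<le> exp (- (real N * s)) * (Y x powr t)" if "x \<in> A"
      proof -
        have "exp (- (real N * s)) * exp (real N * s) \<le> exp (- (real N * s)) * (Y x powr t)"
          using elim that by (intro mult_left_mono) auto
        then show ?thesis by (simp add: exp_minus)
      qed
      then show ?case by (auto simp: indicator_def ennreal_mult[symmetric])
    qed
  qed
  also have "\<dots> = ennreal (exp (- (real N * s))) * ennreal (B ^ N)"
    by (simp add: nn_integral_cmult B)
  also have "\<dots> = ennreal ((B * exp (- s)) ^ N)"
    using B by (simp add: ennreal_mult[symmetric] power_mult_distrib exp_of_nat_mult[symmetric] mult.commute)
  finally show ?thesis
    using B by (simp add: emeasure_eq_measure)
qed

text \<open>The rate r is chosen before the space, the variable and N, so that one rate serves all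
  sites of a cone. The condition on Y prescribes the moments of a product of N independent Beta(a,
  b) variables.\<close>

lemma product_deviation:
  assumes "0 < a" "0 < b" "0 < (d::real)"
  defines "m \<equiv> Digamma a - Digamma (a + b)"
  shows "\<exists>r. 0 < r \<and> r < 1 \<and> (\<forall>(Q :: 'x measure) Y N. prob_space Q \<longrightarrow> Y \<in> borel_measurable Q \<longrightarrow>
      (AE x in Q. 0 < Y x) \<longrightarrow>
      (\<forall>t. 0 < a + t \<longrightarrow> (\<integral>\<^sup>+x. ennreal (Y x powr t) \<partial>Q) = ennreal ((Beta (a + t) b / Beta a b) ^ N)) \<longrightarrow>
      measure Q {x \<in> space Q. real N * d < \<bar>ln (Y x) - real N * m\<bar>} \<le> 2 * r ^ N)"
proof -
  obtain t1 where t1: "0 < t1" "Beta (a + t1) b / Beta a b * exp (- t1 * (m + d)) < 1"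
    using beta_chernoff(1)[OF assms(1-3)] unfolding m_def by blast
  obtain t2 where t2: "0 < t2" "t2 < a" "Beta (a - t2) b / Beta a b * exp (t2 * (m - d)) < 1"
    using beta_chernoff(2)[OF assms(1-3)] unfolding m_def by blast
  define r1 where "r1 = Beta (a + t1) b / Beta a b * exp (- (t1 * (m + d)))"
  define r2 where "r2 = Beta (a + - t2) b / Beta a b * exp (- (- t2 * (m - d)))"
  have pos: "0 < r1" "0 < r2" using assms t1 t2 by (auto simp: r1_def r2_def intro!: mult_pos_pos divide_pos_pos Beta_real_pos)
  have lt: "r1 < 1" "r2 < 1" using t1 t2 by (auto simp: r1_def r2_def)
  define r where "r = max r1 r2"
  show ?thesis
  proof (intro exI[of _ r] conjI allI impI)
    show "0 < r" "r < 1" using pos lt by (auto simp: r_def)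
    fix Q :: "'x measure" and Y :: "'x \<Rightarrow> real" and N :: nat
    assume Q: "prob_space Q" and [measurable]: "Y \<in> borel_measurable Q" and Ypos: "AE x in Q. 0 < Y x"
      and mom: "\<forall>t. 0 < a + t \<longrightarrow> (\<integral>\<^sup>+x. ennreal (Y x powr t) \<partial>Q) = ennreal ((Beta (a + t) b / Beta a b) ^ N)"
    interpret prob_space Q by fact
    define A1 where "A1 = {x \<in> space Q. real N * (m + d) < ln (Y x)}"
    define A2 where "A2 = {x \<in> space Q. ln (Y x) < real N * (m - d)}"
    have [measurable]: "A1 \<in> sets Q" "A2 \<in> sets Q" by (auto simp: A1_def A2_def)
    have "measure Q A1 \<le> r1 ^ N" unfolding r1_def
    proof (rule markov_power[OF Q _ _ _ mom[rule_format]])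
      show "AE x in Q. x \<in> A1 \<longrightarrow> exp (real N * (t1 * (m + d))) \<le> Y x powr t1"
        using Ypos
      proof eventually_elim
        case (elim x)
        show ?case
        proof
          assume "x \<in> A1"
          then have "t1 * (real N * (m + d)) \<le> t1 * ln (Y x)" using t1 by (intro mult_left_mono) (auto simp: A1_def)
          then show "exp (real N * (t1 * (m + d))) \<le> Y x powr t1" using elim by (simp add: powr_def mult_ac)
        qed
      qed
    qed (use assms t1 in \<open>auto intro!: divide_nonneg_nonneg less_imp_le[OF Beta_real_pos]\<close>)
    moreover have "measure Q A2 \<le> r2 ^ N" unfolding r2_def
    proof (rule markov_power[OF Q _ _ _ mom[rule_format]])
      show "AE x in Q. x \<in> A2 \<longrightarrow> exp (real N * (- t2 * (m - d))) \<le> Y x powr (- t2)"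
        using Ypos
      proof eventually_elim
        case (elim x)
        show ?case
        proof
          assume "x \<in> A2"
          then have "t2 * ln (Y x) \<le> t2 * (real N * (m - d))" using t2 by (intro mult_left_mono) (auto simp: A2_def)
          then show "exp (real N * (- t2 * (m - d))) \<le> Y x powr (- t2)" using elim by (simp add: powr_def mult_ac)
        qed
      qed
    qed (use assms t2 in \<open>auto intro!: divide_nonneg_nonneg less_imp_le[OF Beta_real_pos]\<close>)
    moreover have "r1 ^ N \<le> r ^ N" "r2 ^ N \<le> r ^ N" using pos by (auto simp: r_def intro!: power_mono)
    moreover have "{x \<in> space Q. real N * d < \<bar>ln (Y x) - real N * m\<bar>} \<subseteq> A1 \<union> A2"
      by (auto simp: A1_def A2_def abs_if algebra_simps split: if_splits)
    then have "measure Q {x \<in> space Q. real N * d < \<bar>ln (Y x) - real N * m\<bar>} \<le> measure Q A1 + measure Q A2"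
      by (intro order_trans[OF finite_measure_mono measure_Un_le]) auto
    ultimately show "measure Q {x \<in> space Q. real N * d < \<bar>ln (Y x) - real N * m\<bar>} \<le> 2 * r ^ N" by linarith
  qed
qed

section \<open>Deviation events of the stationary model\<close>

text \<open>Logarithmic increments of the harmonic function along the L-shaped path through (p, q),
  (p, n) and (m, n): one of the two legs misses its mean by more than d per step.\<close>

definition deviates :: "real \<Rightarrow> real \<Rightarrow> real \<Rightarrow> real \<Rightarrow> nat \<Rightarrow> nat \<Rightarrow> nat \<Rightarrow> nat \<Rightarrow> (nat \<times> nat \<Rightarrow> real) \<Rightarrow> bool" where
  "deviates a b l d p q m n f \<longleftrightarrow>
     real (m - p) * d < \<bar>ln (stat_h f m n / stat_h f p n) + real (m - p) * phi1 a b l\<bar> \<or>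
     real (n - q) * d < \<bar>ln (stat_h f p q / stat_h f p n) + real (n - q) * phi2 a b l\<bar>"

lemma deviates_bound:
  assumes l: "0 < a" "0 < b" "0 < l" and "0 < d"
  shows "\<exists>r. 0 < r \<and> r < 1 \<and> (\<forall>p q m n. p \<le> m \<longrightarrow> q \<le> n \<longrightarrow>
    measure (stat_measure a b l) {f \<in> space (stat_measure a b l). deviates a b l d p q m n f} \<le> 2 * (r ^ (m - p) + r ^ (n - q)))"
proof -
  let ?Q = "stat_measure a b l"
  interpret Q: prob_space ?Q using l by (intro prob_space_PiM prob_space_stat_law)
  obtain r1 where r1: "0 < r1" "r1 < 1" and R1: "\<And>Y N. Y \<in> borel_measurable ?Q \<Longrightarrow>
      (AE x in ?Q. 0 < Y x) \<Longrightarrow>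
      (\<forall>t. 0 < a + l + t \<longrightarrow> (\<integral>\<^sup>+x. ennreal (Y x powr t) \<partial>?Q) = ennreal ((Beta (a + l + t) b / Beta (a + l) b) ^ N)) \<Longrightarrow>
      measure ?Q {x \<in> space ?Q. real N * d < \<bar>ln (Y x) - real N * (Digamma (a + l) - Digamma (a + l + b))\<bar>} \<le> 2 * r1 ^ N"
    using product_deviation[of "a + l" b d, where 'x = "nat \<times> nat \<Rightarrow> real"] l \<open>0 < d\<close> Q.prob_space_axioms by (auto simp: add_pos_pos)
  obtain r2 where r2: "0 < r2" "r2 < 1" and R2: "\<And>Y N. Y \<in> borel_measurable ?Q \<Longrightarrow>
      (AE x in ?Q. 0 < Y x) \<Longrightarrow>
      (\<forall>t. 0 < l + t \<longrightarrow> (\<integral>\<^sup>+x. ennreal (Y x powr t) \<partial>?Q) = ennreal ((Beta (l + t) a / Beta l a) ^ N)) \<Longrightarrow>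
      measure ?Q {x \<in> space ?Q. real N * d < \<bar>ln (Y x) - real N * (Digamma l - Digamma (l + a))\<bar>} \<le> 2 * r2 ^ N"
    using product_deviation[of l a d, where 'x = "nat \<times> nat \<Rightarrow> real"] l \<open>0 < d\<close> Q.prob_space_axioms by auto
  have pos: "AE f in ?Q. 0 < stat_h f i j / stat_h f i' j'" for i j i' j'
    using AE_stat_measure[OF l] by eventually_elim (simp add: stat_h_pos)
  define r where "r = max r1 r2"
  show ?thesis
  proof (intro exI[of _ r] conjI allI impI)
    show "0 < r" "r < 1" using r1 r2 by (auto simp: r_def)
    fix p q m n :: nat assume "p \<le> m" "q \<le> n"
    define A1 where "A1 = {f \<in> space ?Q. real (m - p) * d < \<bar>ln (stat_h f m n / stat_h f p n) - real (m - p) * (Digamma (a + l) - Digamma (a + l + b))\<bar>}"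
    define A2 where "A2 = {f \<in> space ?Q. real (n - q) * d < \<bar>ln (stat_h f p q / stat_h f p n) - real (n - q) * (Digamma l - Digamma (l + a))\<bar>}"
    have [measurable]: "A1 \<in> sets ?Q" "A2 \<in> sets ?Q" by (auto simp: A1_def A2_def)
    have "measure ?Q A1 \<le> 2 * r1 ^ (m - p)"
      unfolding A1_def using row_moment[OF l \<open>p \<le> m\<close>] by (intro R1 pos) auto
    moreover have "measure ?Q A2 \<le> 2 * r2 ^ (n - q)"
      unfolding A2_def using col_moment[OF l \<open>q \<le> n\<close>] by (intro R2 pos) auto
    moreover have "r1 ^ (m - p) \<le> r ^ (m - p)" "r2 ^ (n - q) \<le> r ^ (n - q)"
      using r1 r2 by (auto simp: r_def intro!: power_mono)
    moreover have "{f \<in> space ?Q. deviates a b l d p q m n f} \<subseteq> A1 \<union> A2"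
      by (auto simp: A1_def A2_def deviates_def phi1_def phi2_def algebra_simps)
    then have "measure ?Q {f \<in> space ?Q. deviates a b l d p q m n f} \<le> measure ?Q A1 + measure ?Q A2"
      by (intro order_trans[OF Q.finite_measure_mono measure_Un_le]) auto
    ultimately show "measure ?Q {f \<in> space ?Q. deviates a b l d p q m n f} \<le> 2 * (r ^ (m - p) + r ^ (n - q))"
      unfolding distrib_left by (smt (verit))
  qed
qed

lemma deviates_measurable [measurable]:
  assumes [measurable]: "\<And>p. (\<lambda>x. g x p) \<in> borel_measurable M"
  shows "Measurable.pred M (\<lambda>x. deviates a b l d p q m n (g x))"
  unfolding deviates_def by measurable

section \<open>Coupling of two parameters\<close>

text \<open>The first component carries the larger parameter l. Boundary coordinates are coupled
  monotonically and environment weights are shared, so both components give harmonic functions of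
  the same walk.\<close>

definition coupling_law :: "real \<Rightarrow> real \<Rightarrow> real \<Rightarrow> real \<Rightarrow> nat \<times> nat \<Rightarrow> (real \<times> real) measure" where
  "coupling_law a b u l p = (if snd p = 0 then beta_coupling (a + u) (a + l) b
     else if fst p = 0 then beta_coupling u l a
     else distr (beta_distribution a b) (borel \<Otimes>\<^sub>M borel) (\<lambda>x. (x, x)))"

abbreviation coupling_measure :: "real \<Rightarrow> real \<Rightarrow> real \<Rightarrow> real \<Rightarrow> (nat \<times> nat \<Rightarrow> real \<times> real) measure" where
  "coupling_measure a b u l \<equiv> PiM UNIV (coupling_law a b u l)"

definition coupled :: "(nat \<times> nat \<Rightarrow> real) \<Rightarrow> (nat \<times> nat \<Rightarrow> real) \<Rightarrow> bool" where
  "coupled f g \<longleftrightarrow> unit_valued f \<and> unit_valued g \<and> (\<forall>p. g p \<le> f p) \<and> (\<forall>i j. g (Suc i, Suc j) = f (Suc i, Suc j))"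

context
  fixes a b u l :: real
  assumes pos: "0 < a" "0 < b" "0 < u" "u < l"
begin

lemma coupling_law_props:
  shows "sets (coupling_law a b u l p) = sets (borel \<Otimes>\<^sub>M borel)"
    and "prob_space (coupling_law a b u l p)"
    and "distr (coupling_law a b u l p) borel fst = stat_law a b l p"
    and "distr (coupling_law a b u l p) borel snd = stat_law a b u p"
    and "AE x in coupling_law a b u l p. snd x \<le> fst x"
    and "AE x in coupling_law a b u l (Suc i, Suc j). snd x = fst x"
proof -
  interpret B: prob_space "beta_distribution a b" using pos by (intro prob_space_beta_distribution)
  have c: "0 < a + u" "a + u < a + l" using pos by auto
  have dm: "(\<lambda>x. (x, x)) \<in> beta_distribution a b \<rightarrow>\<^sub>M borel \<Otimes>\<^sub>M borel"
    by (intro measurable_Pair measurable_ident_sets) simp_all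
  show "sets (coupling_law a b u l p) = sets (borel \<Otimes>\<^sub>M borel)"
    using beta_coupling(1)[OF c pos(2)] beta_coupling(1)[OF pos(3,4,1)] by (simp add: coupling_law_def)
  show "prob_space (coupling_law a b u l p)"
    using beta_coupling(2)[OF c pos(2)] beta_coupling(2)[OF pos(3,4,1)]
    by (auto simp: coupling_law_def intro!: B.prob_space_distr dm)
  show "distr (coupling_law a b u l p) borel fst = stat_law a b l p"
    using beta_coupling(3)[OF c pos(2)] beta_coupling(3)[OF pos(3,4,1)]
    by (auto simp: coupling_law_def stat_law_def distr_distr[OF _ dm] comp_def intro: distr_id2)
  show "distr (coupling_law a b u l p) borel snd = stat_law a b u p"
    using beta_coupling(4)[OF c pos(2)] beta_coupling(4)[OF pos(3,4,1)]
    by (auto simp: coupling_law_def stat_law_def distr_distr[OF _ dm] comp_def intro: distr_id2)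
  have d1: "AE x in distr (beta_distribution a b) (borel \<Otimes>\<^sub>M borel) (\<lambda>x. (x, x)). snd x \<le> fst x"
  proof (rule AE_distr_iff[OF dm, THEN iffD2])
    show "{x \<in> space (borel \<Otimes>\<^sub>M borel). snd x \<le> (fst x :: real)} \<in> sets (borel \<Otimes>\<^sub>M borel)"
      by measurable
  qed simp
  show "AE x in coupling_law a b u l p. snd x \<le> fst x"
    using beta_coupling(5)[OF c pos(2)] beta_coupling(5)[OF pos(3,4,1)] d1
    unfolding coupling_law_def by (cases "snd p = 0"; cases "fst p = 0") (simp_all only: if_True if_False refl)
  have d2: "AE x in distr (beta_distribution a b) (borel \<Otimes>\<^sub>M borel) (\<lambda>x. (x, x)). snd x = fst x"
  proof (rule AE_distr_iff[OF dm, THEN iffD2])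
    show "{x \<in> space (borel \<Otimes>\<^sub>M borel). snd x = (fst x :: real)} \<in> sets (borel \<Otimes>\<^sub>M borel)"
      by measurable
  qed simp
  moreover have "coupling_law a b u l (Suc i, Suc j) = distr (beta_distribution a b) (borel \<Otimes>\<^sub>M borel) (\<lambda>x. (x, x))"
    by (simp add: coupling_law_def)
  ultimately show "AE x in coupling_law a b u l (Suc i, Suc j). snd x = fst x"
    by (simp only:)
qed

lemma coupling_component [measurable]:
  "(\<lambda>f. fst (f p)) \<in> borel_measurable (coupling_measure a b u l)"
  "(\<lambda>f. snd (f p)) \<in> borel_measurable (coupling_measure a b u l)"
proof -
  have "(\<lambda>f. f p) \<in> coupling_measure a b u l \<rightarrow>\<^sub>M coupling_law a b u l p" by measurable
  then have "(\<lambda>f. f p) \<in> coupling_measure a b u l \<rightarrow>\<^sub>M borel \<Otimes>\<^sub>M borel"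
    using coupling_law_props(1) by (simp cong: measurable_cong_sets)
  then show "(\<lambda>f. fst (f p)) \<in> borel_measurable (coupling_measure a b u l)"
    "(\<lambda>f. snd (f p)) \<in> borel_measurable (coupling_measure a b u l)" by auto
qed

lemma coupling_marginals:
  shows "distr (coupling_measure a b u l) (stat_measure a b l) (\<lambda>f p. fst (f p)) = stat_measure a b l"
    and "distr (coupling_measure a b u l) (stat_measure a b u) (\<lambda>f p. snd (f p)) = stat_measure a b u"
proof -
  have l: "0 < l" using pos by simp
  have m: "fst \<in> coupling_law a b u l p \<rightarrow>\<^sub>M stat_law a b l p" "snd \<in> coupling_law a b u l p \<rightarrow>\<^sub>M stat_law a b u p" for p
    using coupling_law_props(1)[of p] by (simp_all cong: measurable_cong_sets)
  have e: "distr (coupling_law a b u l p) (stat_law a b l p) fst = stat_law a b l p"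
    "distr (coupling_law a b u l p) (stat_law a b u p) snd = stat_law a b u p" for p
    using coupling_law_props(3,4)[of p] by (simp_all cong: distr_cong)
  show "distr (coupling_measure a b u l) (stat_measure a b l) (\<lambda>f p. fst (f p)) = stat_measure a b l"
  proof -
    have "distr (coupling_measure a b u l) (stat_measure a b l) (\<lambda>f. \<lambda>p\<in>UNIV. fst (f p)) = stat_measure a b l"
      by (rule distr_PiM_map[where s = "\<lambda>p. p"])
         (simp_all add: coupling_law_props(2) prob_space_stat_law[OF pos(1,2) l] m e)
    then show ?thesis by (simp only: restrict_def UNIV_I if_True)
  qed
  show "distr (coupling_measure a b u l) (stat_measure a b u) (\<lambda>f p. snd (f p)) = stat_measure a b u"
  proof -
    have "distr (coupling_measure a b u l) (stat_measure a b u) (\<lambda>f. \<lambda>p\<in>UNIV. snd (f p)) = stat_measure a b u"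
      by (rule distr_PiM_map[where s = "\<lambda>p. p"])
         (simp_all add: coupling_law_props(2) prob_space_stat_law[OF pos(1,2,3)] m e)
    then show ?thesis by (simp only: restrict_def UNIV_I if_True)
  qed
qed

lemma measurable_coupling_fst [measurable]: "(\<lambda>f p. fst (f p)) \<in> coupling_measure a b u l \<rightarrow>\<^sub>M stat_measure a b l"
  by (rule measurable_into_stat_measure) measurable

lemma measurable_coupling_snd [measurable]: "(\<lambda>f p. snd (f p)) \<in> coupling_measure a b u l \<rightarrow>\<^sub>M stat_measure a b u"
  by (rule measurable_into_stat_measure) measurable

lemma AE_coupled: "AE f in coupling_measure a b u l. coupled (\<lambda>p. fst (f p)) (\<lambda>p. snd (f p))"
proof -
  have l: "0 < l" using pos by simp
  have 1: "AE f in coupling_measure a b u l. unit_valued (\<lambda>p. fst (f p))"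
  proof (rule AE_distrD[OF measurable_coupling_fst])
    show "AE f in distr (coupling_measure a b u l) (stat_measure a b l) (\<lambda>f p. fst (f p)). unit_valued f"
      unfolding coupling_marginals by (rule AE_stat_measure[OF pos(1,2) l])
  qed
  have 2: "AE f in coupling_measure a b u l. unit_valued (\<lambda>p. snd (f p))"
  proof (rule AE_distrD[OF measurable_coupling_snd])
    show "AE f in distr (coupling_measure a b u l) (stat_measure a b u) (\<lambda>f p. snd (f p)). unit_valued f"
      unfolding coupling_marginals by (rule AE_stat_measure[OF pos(1,2,3)])
  qed
  have 3: "AE f in coupling_measure a b u l. \<forall>p. snd (f p) \<le> fst (f p)"
    unfolding AE_all_countable by (intro allI AE_PiM_component coupling_law_props) auto
  have 4: "AE f in coupling_measure a b u l. \<forall>i j. snd (f (Suc i, Suc j)) = fst (f (Suc i, Suc j))"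
    unfolding AE_all_countable by (intro allI AE_PiM_component[where P = "\<lambda>x. snd x = fst x"] coupling_law_props) auto
  from 1 2 3 4 show ?thesis
    by eventually_elim (simp add: coupled_def)
qed

end

text \<open>Larger boundary coordinates mean larger horizontal and larger inverted vertical ratios;
  \<open>harmonic_ratio_mono\<close> carries this order into the quadrant.\<close>

lemma coupled_ratio_mono:
  assumes c: "coupled f g"
  shows "stat_h g (Suc i) j * stat_h f i j \<le> stat_h f (Suc i) j * stat_h g i j"
    and "stat_h g i j * stat_h f i (Suc j) \<le> stat_h f i j * stat_h g i (Suc j)"
proof -
  have fg: "unit_valued f" "unit_valued g" "\<And>p. g p \<le> f p" "stat_w g = stat_w f"
    using c by (auto simp: coupled_def stat_w_def fun_eq_iff)
  have P: "\<And>i j. 0 < stat_h f i j" "\<And>i j. 0 < stat_h g i j" using fg stat_h_pos by auto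
  have w: "0 < stat_w f i j \<and> stat_w f i j < 1" for i j using fg by (auto simp: stat_w_def unit_valued_def)
  have H: "harmonic (stat_w f) (stat_h f)" "harmonic (stat_w f) (stat_h g)"
    using harmonic_stat_h[of f] harmonic_stat_h[of g] fg(4) by auto
  have north: "stat_h g (Suc i) 0 * stat_h f i 0 \<le> stat_h f (Suc i) 0 * stat_h g i 0" for i
    using mult_right_mono[OF fg(3)[of "(Suc i, 0)"] less_imp_le[OF mult_pos_pos[OF P(1)[of i 0] P(2)[of i 0]]]]
    by (simp add: mult_ac)
  have east: "stat_h g 0 j * stat_h f 0 (Suc j) \<le> stat_h f 0 j * stat_h g 0 (Suc j)" for j
  proof -
    have "0 < g (0, Suc j)" using fg by (simp add: unit_valued_def)
    then have "stat_h f 0 j * stat_h g 0 j / f (0, Suc j) \<le> stat_h f 0 j * stat_h g 0 j / g (0, Suc j)"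
      using fg(3)[of "(0, Suc j)"] P by (intro divide_left_mono) (auto intro!: mult_pos_pos simp: less_imp_le fg(1)[unfolded unit_valued_def])
    then show ?thesis by (simp add: mult_ac)
  qed
  show "stat_h g (Suc i) j * stat_h f i j \<le> stat_h f (Suc i) j * stat_h g i j"
    by (rule harmonic_ratio_mono(1)[OF H P w north east])
  show "stat_h g i j * stat_h f i (Suc j) \<le> stat_h f i j * stat_h g i (Suc j)"
    by (rule harmonic_ratio_mono(2)[OF H P w north east])
qed

section \<open>Comparison with the stationary model\<close>

lemma point_hit_cong:
  assumes "\<And>i' j'. i' \<le> i \<Longrightarrow> j' \<le> j \<Longrightarrow> w i' j' = w' i' j'"
  shows "point_hit w i j = point_hit w' i j"
  using assms by (induction w i j rule: point_hit.induct) auto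

lemma point_hit_measurable [measurable]:
  assumes [measurable]: "\<And>i j. (\<lambda>x. w x i j) \<in> borel_measurable M"
  shows "(\<lambda>x. point_hit (w x) i j) \<in> borel_measurable M"
proof (induction i arbitrary: j)
  case 0
  show ?case by (induction j) auto
next
  case (Suc i)
  note [measurable] = Suc.IH
  show ?case by (induction j) auto
qed

text \<open>The Doob transform of the horizontal weight by the probability of hitting the corner. At
  i = 0 the subtraction is truncated; the cones of targets demand i \<ge> 1.\<close>

definition hit_kappa :: "(nat \<Rightarrow> nat \<Rightarrow> real) \<Rightarrow> nat \<Rightarrow> nat \<Rightarrow> real" where
  "hit_kappa w i j = w i j * point_hit w (i - 1) j / point_hit w i j"

lemma hit_kappa_cong:
  assumes "\<And>i' j'. i' \<le> i \<Longrightarrow> j' \<le> j \<Longrightarrow> w i' j' = w' i' j'"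
  shows "hit_kappa w i j = hit_kappa w' i j"
  using assms point_hit_cong[of i j w w'] point_hit_cong[of "i - 1" j w w'] by (simp add: hit_kappa_def)

lemma hit_kappa_measurable [measurable]:
  assumes [measurable]: "\<And>i j. (\<lambda>x. w x i j) \<in> borel_measurable M"
  shows "(\<lambda>x. hit_kappa (w x) i j) \<in> borel_measurable M"
  unfolding hit_kappa_def by measurable

lemma hit_kappa_compl:
  assumes "\<And>i j. 0 < w i j \<and> w i j < 1"
  shows "1 - hit_kappa w (Suc i) (Suc j) = (1 - w (Suc i) (Suc j)) * point_hit w (Suc i) j / point_hit w (Suc i) (Suc j)"
  using point_hit_pos[of w "Suc i" "Suc j"] assms by (simp add: hit_kappa_def field_simps)

definition translate :: "nat \<Rightarrow> nat \<Rightarrow> (nat \<Rightarrow> nat \<Rightarrow> real) \<Rightarrow> nat \<Rightarrow> nat \<Rightarrow> real" where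
  "translate p q h i j = h (p + i) (q + j)"

lemma harmonic_translate: "harmonic w h \<Longrightarrow> harmonic (translate p q w) (translate p q h)"
  by (simp add: harmonic_def translate_def)

text \<open>The left side is the error term C k / h of \<open>kappa_lower_bound\<close>. Its
  logarithm is the difference of the increments of h and k along the L-shaped path, so off the
  deviation events it is governed by the mean growth rates.\<close>

lemma bracket_bound:
  assumes f: "unit_valued f" "\<not> deviates a b l d p q m n f"
    and g: "unit_valued g" "\<not> deviates a b u d p q m n g"
  shows "stat_h f p q / stat_h g p q * stat_h g m n / stat_h f m n
    \<le> exp (real (m - p) * (phi1 a b l - phi1 a b u + 2 * d) + real (n - q) * (phi2 a b u - phi2 a b l + 2 * d))"
proof -
  have P: "0 < stat_h f i j" "0 < stat_h g i j" for i j using f g stat_h_pos by auto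
  have nz: "stat_h f i j \<noteq> 0" "stat_h g i j \<noteq> 0" for i j using P[of i j] by auto
  have "ln (stat_h f p q / stat_h g p q * stat_h g m n / stat_h f m n) =
      (ln (stat_h f p q / stat_h f p n) - ln (stat_h f m n / stat_h f p n))
    - (ln (stat_h g p q / stat_h g p n) - ln (stat_h g m n / stat_h g p n))"
    using P nz by (simp add: ln_mult ln_div)
  also have "\<dots> \<le> real (m - p) * (phi1 a b l - phi1 a b u + 2 * d) + real (n - q) * (phi2 a b u - phi2 a b l + 2 * d)"
    using f(2) g(2) unfolding deviates_def by (simp add: algebra_simps abs_le_iff not_less)
  finally show ?thesis
    using P by (subst (asm) ln_ge_iff[symmetric] | subst ln_le_cancel_iff[symmetric])+ (auto intro!: mult_pos_pos divide_pos_pos)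
qed

text \<open>The starting site has the fixed weight index (M, M) and only the target, at (M - z1, M -
  z2), depends on z. So one value \<open>stat_kappa M M f\<close> serves all targets. The function
  of g, with the smaller ratios, is the auxiliary one.\<close>

lemma hit_kappa_lower:
  assumes c: "coupled f g" and z: "1 \<le> z1" "z1 \<le> M" "z2 \<le> M"
    and dev: "\<not> deviates a b l d (M - z1) (Suc (M - z2)) M (Suc M) f"
      "\<not> deviates a b u d (M - z1) (Suc (M - z2)) M (Suc M) g"
    and e: "exp (real z1 * (phi1 a b l - phi1 a b u + 2 * d) + real z2 * (phi2 a b u - phi2 a b l + 2 * d)) \<le> e"
  shows "stat_kappa M M f * (1 - e) \<le> hit_kappa (translate (M - z1) (M - z2) (stat_w f)) z1 z2"
proof -
  define p where "p = M - z1"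
  define q where "q = M - z2"
  have fg: "unit_valued f" "unit_valued g" "stat_w g = stat_w f"
    using c by (auto simp: coupled_def stat_w_def fun_eq_iff)
  have P: "0 < stat_h f i j" "0 < stat_h g i j" for i j using fg stat_h_pos by auto
  have w: "0 < stat_w f i j \<and> stat_w f i j < 1" for i j using fg by (auto simp: stat_w_def unit_valued_def)
  have H: "harmonic (stat_w f) (stat_h f)" "harmonic (stat_w f) (stat_h g)"
    using harmonic_stat_h[of f] harmonic_stat_h[of g] fg(3) by auto
  obtain i where i: "z1 = Suc i" using z by (cases z1) auto
  have pq: "p + z1 = M" "q + z2 = M" using z by (auto simp: p_def q_def)
  have "translate p q (stat_w f) (Suc i) z2 * translate p q (stat_h f) (Suc i) (Suc z2) / translate p q (stat_h f) (Suc (Suc i)) (Suc z2)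
      * (1 - translate p q (stat_h f) 0 1 / translate p q (stat_h g) 0 1 * translate p q (stat_h g) (Suc i) (Suc z2) / translate p q (stat_h f) (Suc i) (Suc z2))
    \<le> translate p q (stat_w f) (Suc i) z2 * point_hit (translate p q (stat_w f)) i z2 / point_hit (translate p q (stat_w f)) (Suc i) z2"
  proof (rule kappa_lower_bound[OF harmonic_translate[OF H(1)] harmonic_translate[OF H(2)]])
    show "translate p q (stat_h g) 0 (Suc j) * translate p q (stat_h f) 0 (Suc (Suc j))
        \<le> translate p q (stat_h f) 0 (Suc j) * translate p q (stat_h g) 0 (Suc (Suc j))" for j
      using coupled_ratio_mono(2)[OF c, of p "q + Suc j"] by (simp add: translate_def)
  qed (use P w in \<open>auto simp: translate_def\<close>)
  \<comment> \<open>The error term runs from the first east site (p, Suc q) to the horizontal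
    successor (M, Suc M) of the starting site, which explains the shifts in
    \<open>deviates\<close>.\<close>
  then have "stat_kappa M M f * (1 - stat_h f p (Suc q) / stat_h g p (Suc q) * stat_h g M (Suc M) / stat_h f M (Suc M))
      \<le> hit_kappa (translate p q (stat_w f)) z1 z2"
    using pq i by (simp add: translate_def stat_kappa_def hit_kappa_def stat_w_def del: stat_h.simps)
  moreover have "stat_h f p (Suc q) / stat_h g p (Suc q) * stat_h g M (Suc M) / stat_h f M (Suc M) \<le> e"
    using bracket_bound[OF fg(1) dev(1) fg(2) dev(2)] e z
    by (simp add: p_def q_def Suc_diff_le del: stat_h.simps)
  moreover have "0 \<le> stat_kappa M M f"
    using less_imp_le[OF P(1)] fg(1)[unfolded unit_valued_def] unfolding stat_kappa_def
    by (intro divide_nonneg_nonneg mult_nonneg_nonneg) (auto simp: less_imp_le)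
  ultimately show ?thesis unfolding p_def q_def
    by (meson diff_left_mono mult_left_mono order_trans)
qed

text \<open>Transposed situation: the auxiliary g now has the larger ratios, and the error term runs
  from (Suc p, q) to the vertical successor (Suc M, M).\<close>

lemma hit_kappa_upper:
  assumes c: "coupled g f" and z: "1 \<le> z1" "z1 \<le> M" "1 \<le> z2" "z2 \<le> M"
    and dev: "\<not> deviates a b l d (Suc (M - z1)) (M - z2) (Suc M) M f"
      "\<not> deviates a b u d (Suc (M - z1)) (M - z2) (Suc M) M g"
    and e: "exp (real z1 * (phi1 a b l - phi1 a b u + 2 * d) + real z2 * (phi2 a b u - phi2 a b l + 2 * d)) \<le> e"
  shows "(1 - stat_kappa M M f) * (1 - e) \<le> 1 - hit_kappa (translate (M - z1) (M - z2) (stat_w f)) z1 z2"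
proof -
  define p where "p = M - z1"
  define q where "q = M - z2"
  have fg: "unit_valued f" "unit_valued g" "stat_w g = stat_w f"
    using c by (auto simp: coupled_def stat_w_def fun_eq_iff)
  have P: "0 < stat_h f i j" "0 < stat_h g i j" for i j using fg stat_h_pos by auto
  have w: "0 < stat_w f i j \<and> stat_w f i j < 1" for i j using fg by (auto simp: stat_w_def unit_valued_def)
  have H: "harmonic (stat_w f) (stat_h f)" "harmonic (stat_w f) (stat_h g)"
    using harmonic_stat_h[of f] harmonic_stat_h[of g] fg(3) by auto
  obtain i where i: "z1 = Suc i" using z by (cases z1) auto
  obtain j where j: "z2 = Suc j" using z by (cases z2) auto
  have pq: "p + z1 = M" "q + z2 = M" using z by (auto simp: p_def q_def)
  have "(1 - translate p q (stat_w f) z1 (Suc j)) * translate p q (stat_h f) (Suc z1) (Suc j) / translate p q (stat_h f) (Suc z1) (Suc (Suc j))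
      * (1 - translate p q (stat_h f) 1 0 / translate p q (stat_h g) 1 0 * translate p q (stat_h g) (Suc z1) (Suc j) / translate p q (stat_h f) (Suc z1) (Suc j))
    \<le> (1 - translate p q (stat_w f) z1 (Suc j)) * point_hit (translate p q (stat_w f)) z1 j / point_hit (translate p q (stat_w f)) z1 (Suc j)"
  proof (rule kappa_upper_bound[OF harmonic_translate[OF H(1)] harmonic_translate[OF H(2)]])
    show "translate p q (stat_h g) (Suc i) 0 * translate p q (stat_h f) (Suc (Suc i)) 0
        \<le> translate p q (stat_h f) (Suc i) 0 * translate p q (stat_h g) (Suc (Suc i)) 0" for i
      using coupled_ratio_mono(1)[OF c, of "p + Suc i" q] by (simp add: translate_def mult.commute)
  qed (use P w in \<open>auto simp: translate_def\<close>)
  note main = this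
  have kap: "(1 - stat_w f M M) * stat_h f (Suc M) M / stat_h f (Suc M) (Suc M) = 1 - stat_kappa M M f"
    using P(1)[of "Suc M" "Suc M"] by (simp add: stat_kappa_def stat_w_def field_simps)
  have compl: "1 - hit_kappa (translate p q (stat_w f)) z1 z2 =
      (1 - translate p q (stat_w f) z1 (Suc j)) * point_hit (translate p q (stat_w f)) z1 j / point_hit (translate p q (stat_w f)) z1 (Suc j)"
    unfolding i j using w by (intro hit_kappa_compl) (auto simp: translate_def)
  have eqs: "p + z1 = M" "p + Suc z1 = Suc M" "q + Suc j = M" "q + Suc (Suc j) = Suc M" "p + 0 = p" "p + 1 = Suc p" "q + 0 = q"
    using pq j by auto
  from main have "(1 - stat_kappa M M f) * (1 - stat_h f (Suc p) q / stat_h g (Suc p) q * stat_h g (Suc M) M / stat_h f (Suc M) M)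
      \<le> 1 - hit_kappa (translate p q (stat_w f)) z1 z2"
    unfolding compl[symmetric] by (simp only: translate_def eqs kap)
  moreover have "stat_h f (Suc p) q / stat_h g (Suc p) q * stat_h g (Suc M) M / stat_h f (Suc M) M \<le> e"
    using bracket_bound[OF fg(1) dev(1) fg(2) dev(2)] e z
    by (simp add: p_def q_def Suc_diff_le del: stat_h.simps)
  moreover have "0 \<le> 1 - stat_kappa M M f"
    unfolding kap[symmetric]
    using less_imp_le[OF P(1)] w[of M M] by (intro divide_nonneg_nonneg mult_nonneg_nonneg) (auto simp del: stat_h.simps)
  ultimately show ?thesis unfolding p_def q_def
    by (meson diff_left_mono mult_left_mono order_trans)
qed

section \<open>Uniform bounds over a cone of targets\<close>

text \<open>The angular tolerance is e and the least distance n. The cap M makes the set finite and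
  fits it into the box that has the starting site at its corner.\<close>

definition direction_cone :: "real \<Rightarrow> real \<Rightarrow> nat \<Rightarrow> nat \<Rightarrow> (nat \<times> nat) set" where
  "direction_cone t e n M = {(z1, z2). 1 \<le> z1 \<and> z1 \<le> M \<and> 1 \<le> z2 \<and> z2 \<le> M \<and> n \<le> z1 + z2 \<and>
     \<bar>real z1 - t * real (z1 + z2)\<bar> \<le> e * real (z1 + z2)}"

lemma finite_direction_cone [simp]: "finite (direction_cone t e n M)"
  by (rule finite_subset[of _ "{..M} \<times> {..M}"]) (auto simp: direction_cone_def)

text \<open>On the cone both coordinates are at least a fixed fraction of z1 + z2, so the bounds
  decay exponentially in z1 + z2 and are summable over all sites. The tail beyond n is then small
  uniformly in M.\<close>

lemma cone_union_bound:
  assumes r: "0 < r" "r < 1" and t: "0 < t" "t < 1" and "0 < eps"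
  shows "\<exists>n0. \<forall>n\<ge>n0. \<forall>e M (Q :: 'x measure) B. e \<le> min t (1 - t) / 2 \<longrightarrow>
    (\<forall>z\<in>direction_cone t e n M. B z \<in> sets Q \<and> measure Q (B z) \<le> 4 * (r ^ fst z + r ^ snd z)) \<longrightarrow>
    finite_measure Q \<longrightarrow> measure Q (\<Union>z\<in>direction_cone t e n M. B z) \<le> eps"
proof -
  define c where "c = min t (1 - t) / 2"
  have c: "0 < c" using t by (simp add: c_def)
  \<comment> \<open>Half of the exponential decay pays for the double geometric series over z1 and
    z2, the other half leaves the factor s^n.\<close>
  define s where "s = r powr (c / 2)"
  have s: "0 < s" "s < 1" using r c powr_less_mono2[of "c / 2" r 1] by (auto simp: s_def)
  \<comment> \<open>The factor 4 of the hypothesis, a 2 for the two powers of r, and the square of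
    the geometric sum 1 / (1 - s).\<close>
  define K where "K = 8 / (1 - s)\<^sup>2"
  have K: "0 < K" using s by (simp add: K_def)
  obtain n0 where n0: "s ^ n0 < eps / K"
    using real_arch_pow_inv[of "eps / K" s] s K \<open>0 < eps\<close> by auto
  show ?thesis
  proof (intro exI[of _ n0] allI impI)
    fix n e M and Q :: "'x measure" and B
    assume n: "n0 \<le> n" and e: "e \<le> min t (1 - t) / 2"
      and B: "\<forall>z\<in>direction_cone t e n M. B z \<in> sets Q \<and> measure Q (B z) \<le> 4 * (r ^ fst z + r ^ snd z)"
      and Q: "finite_measure Q"
    interpret finite_measure Q by fact
    have pw: "r ^ k \<le> s ^ n * (s ^ z1 * s ^ z2)"
      if z: "(z1, z2) \<in> direction_cone t e n M" and k: "c * real (z1 + z2) \<le> real k" for z1 z2 k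
    proof -
      have "r ^ k = r powr real k" using r by (simp add: powr_realpow)
      also have "\<dots> \<le> r powr (c * real (z1 + z2))" using k r by (intro powr_mono') auto
      also have "c * real (z1 + z2) = (c / 2) * real (2 * (z1 + z2))" by simp
      also have "r powr \<dots> = s powr real (2 * (z1 + z2))" unfolding s_def powr_powr ..
      also have "\<dots> = s ^ (2 * (z1 + z2))" using s by (simp add: powr_realpow del: of_nat_mult of_nat_add)
      also have "\<dots> = s ^ (z1 + z2) * (s ^ z1 * s ^ z2)" by (simp add: power_add mult_2)
      also have "\<dots> \<le> s ^ n * (s ^ z1 * s ^ z2)"
        using s z by (intro mult_right_mono power_decreasing) (auto simp: direction_cone_def)
      finally show ?thesis .
    qed
    have "measure Q (\<Union>z\<in>direction_cone t e n M. B z) \<le> (\<Sum>z\<in>direction_cone t e n M. measure Q (B z))"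
      using B by (intro measure_UNION_le) auto
    also have "\<dots> \<le> (\<Sum>(z1, z2)\<in>direction_cone t e n M. 8 * s ^ n * (s ^ z1 * s ^ z2))"
    proof (intro sum_mono, clarify)
      fix z1 z2 assume z: "(z1, z2) \<in> direction_cone t e n M"
      have abs: "\<bar>real z1 - t * real (z1 + z2)\<bar> \<le> c * real (z1 + z2)"
        using z e order_trans[OF _ mult_right_mono[of e c "real (z1 + z2)"]] by (auto simp: direction_cone_def c_def)
      have "2 * c * real (z1 + z2) \<le> t * real (z1 + z2)" "2 * c * real (z1 + z2) \<le> (1 - t) * real (z1 + z2)"
        by (auto simp: c_def intro!: mult_right_mono)
      with abs have "c * real (z1 + z2) \<le> real z1" "c * real (z1 + z2) \<le> real z2"
        by (auto simp: abs_le_iff algebra_simps)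
      then have X: "r ^ z1 \<le> s ^ n * (s ^ z1 * s ^ z2)" "r ^ z2 \<le> s ^ n * (s ^ z1 * s ^ z2)"
        using pw[OF z] by auto
      have "measure Q (B (z1, z2)) \<le> 4 * (r ^ z1 + r ^ z2)" using B z by fastforce
      also have "\<dots> \<le> 4 * (s ^ n * (s ^ z1 * s ^ z2) + s ^ n * (s ^ z1 * s ^ z2))"
        using X by (intro mult_left_mono add_mono) auto
      finally show "measure Q (B (z1, z2)) \<le> 8 * s ^ n * (s ^ z1 * s ^ z2)" by simp
    qed
    also have "\<dots> \<le> (\<Sum>(z1, z2)\<in>{..M} \<times> {..M}. 8 * s ^ n * (s ^ z1 * s ^ z2))"
      using s by (intro sum_mono2) (auto simp: direction_cone_def)
    also have "\<dots> = 8 * s ^ n * ((\<Sum>i\<le>M. s ^ i) * (\<Sum>j\<le>M. s ^ j))"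
      by (simp add: sum_product sum.cartesian_product sum_distrib_left case_prod_beta mult_ac)
    also have "\<dots> \<le> 8 * s ^ n * (1 / (1 - s) * (1 / (1 - s)))"
    proof -
      have "(\<Sum>i\<le>M. s ^ i) \<le> (\<Sum>i. s ^ i)" using s by (intro sum_le_suminf) auto
      then have "(\<Sum>i\<le>M. s ^ i) \<le> 1 / (1 - s)" using s by (simp add: suminf_geometric)
      then show ?thesis using s by (intro mult_left_mono mult_mono) (auto intro!: sum_nonneg)
    qed
    also have "\<dots> = K * s ^ n" by (simp add: K_def power2_eq_square)
    also have "\<dots> \<le> K * s ^ n0" using K s n by (intro mult_left_mono power_decreasing) auto
    also have "\<dots> \<le> eps" using n0 K by (simp add: field_simps)
    finally show "measure Q (\<Union>z\<in>direction_cone t e n M. B z) \<le> eps" .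
  qed
qed

text \<open>With N = z1 + z2 the exponent is - D N plus the tolerance 2 d N plus an angular error of
  at most e K N. The choices d = D / 8 and e \<le> D / (4 K) cost a quarter of the gap D each, so at
  most - N D / 2 is left.\<close>

lemma cone_drift:
  assumes t: "0 < t" "t < 1" and D: "t * A + (1 - t) * B < 0" and "0 < eps"
  shows "\<exists>d e n0. 0 < d \<and> 0 < e \<and> e \<le> min t (1 - t) / 2 \<and>
    (\<forall>n\<ge>n0. \<forall>M z1 z2. (z1, z2) \<in> direction_cone t e n M \<longrightarrow> exp (real z1 * (A + 2 * d) + real z2 * (B + 2 * d)) \<le> eps)"
proof -
  define D where "D = - (t * A + (1 - t) * B)"
  have Dp: "0 < D" using D by (simp add: D_def)
  define d where "d = D / 8"
  define K where "K = \<bar>A\<bar> + \<bar>B\<bar> + 1"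
  have K: "0 < K" by (simp add: K_def add_nonneg_pos)
  define e where "e = min (min t (1 - t) / 2) (D / (4 * K))"
  obtain n0 :: nat where n0: "- 2 * ln eps / D \<le> real n0" using real_arch_simple by blast
  have "0 < d" using Dp by (simp add: d_def)
  moreover have "0 < e" unfolding e_def min_less_iff_conj using Dp K t by simp
  moreover have "e \<le> min t (1 - t) / 2" unfolding e_def by (rule min.cobounded1)
  ultimately have de: "0 < d" "0 < e" "e \<le> min t (1 - t) / 2" by blast+
  have "exp (real z1 * (A + 2 * d) + real z2 * (B + 2 * d)) \<le> eps"
    if n: "n0 \<le> n" and z: "(z1, z2) \<in> direction_cone t e n M" for n M z1 z2
  proof -
    define N where "N = real (z1 + z2)"
    define v where "v = real z1 - t * N"
    have v: "\<bar>v\<bar> \<le> e * N" using z by (simp add: direction_cone_def v_def N_def)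
    have N: "real n0 \<le> N" using z n by (simp add: direction_cone_def N_def)
    have "real z1 * (A + 2 * d) + real z2 * (B + 2 * d) = N * (- D + 2 * d) + v * (A - B)"
      unfolding D_def N_def v_def by (simp add: algebra_simps)
    also have "v * (A - B) \<le> \<bar>v\<bar> * \<bar>A - B\<bar>" by (metis abs_ge_self abs_mult)
    also have "\<dots> \<le> (e * N) * K" using v by (intro mult_mono) (auto simp: K_def)
    also have "\<dots> \<le> D / (4 * K) * N * K"
      using K N by (intro mult_right_mono) (auto simp: e_def)
    also have "\<dots> = N * (D / 4)" using K by simp
    finally have "real z1 * (A + 2 * d) + real z2 * (B + 2 * d) \<le> - (N * (D / 2))"
      by (simp add: d_def algebra_simps)
    also have "\<dots> \<le> - (real n0 * (D / 2))" using N Dp by (simp add: mult_right_mono)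
    also have "\<dots> \<le> ln eps" using n0 Dp by (simp add: field_simps)
    finally show ?thesis
      using \<open>0 < eps\<close> by (subst (asm) ln_ge_iff) auto
  qed
  with de show ?thesis by blast
qed

definition drift :: "real \<Rightarrow> real \<Rightarrow> real \<Rightarrow> real \<Rightarrow> real" where
  "drift a b t l = t * phi1 a b l - (1 - t) * phi2 a b l"

definition kappa_measure :: "real \<Rightarrow> real \<Rightarrow> real \<Rightarrow> real measure" where
  "kappa_measure a b l = density lborel (\<lambda>x. ennreal (kappa_density a b l x))"

lemma sets_kappa_measure [simp, measurable_cong]: "sets (kappa_measure a b l) = sets borel"
  by (simp add: kappa_measure_def)

lemma prob_space_kappa_measure:
  assumes "0 < a" "0 < b" "0 < l" shows "prob_space (kappa_measure a b l)"
proof -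
  interpret prob_space "stat_measure a b l" using assms by (intro prob_space_PiM prob_space_stat_law)
  show ?thesis unfolding kappa_measure_def distr_stat_kappa[OF assms, of 0 0, symmetric]
    by (intro prob_space_distr) measurable
qed

definition cell_weights :: "nat \<Rightarrow> nat \<Rightarrow> nat \<Rightarrow> (nat \<times> nat \<Rightarrow> real) \<Rightarrow> nat \<Rightarrow> nat \<Rightarrow> real" where
  "cell_weights M z1 z2 f = translate (M - z1) (M - z2) (stat_w f)"

lemma cell_weights_measurable [measurable]:
  assumes [measurable]: "\<And>p. (\<lambda>x. g x p) \<in> borel_measurable M"
  shows "(\<lambda>x. cell_weights m z1 z2 (g x) i j) \<in> borel_measurable M"
  unfolding cell_weights_def translate_def stat_w_def by measurable

lemma measure_stat_kappa:
  assumes l: "0 < a" "0 < b" "0 < l" and [measurable]: "S \<in> sets borel"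
    and T [measurable]: "T \<in> N \<rightarrow>\<^sub>M stat_measure a b l" and d: "distr N (stat_measure a b l) T = stat_measure a b l"
  shows "measure N {f \<in> space N. stat_kappa i j (T f) \<in> S} = measure (kappa_measure a b l) S"
proof -
  have [measurable]: "stat_kappa i j \<in> borel_measurable (stat_measure a b l)" by measurable
  have "kappa_measure a b l = distr (distr N (stat_measure a b l) T) borel (stat_kappa i j)"
    unfolding d kappa_measure_def by (rule distr_stat_kappa[OF l, symmetric])
  also have "\<dots> = distr N borel (stat_kappa i j \<circ> T)" by (intro distr_distr) measurable
  finally have "measure (kappa_measure a b l) S = measure (distr N borel (stat_kappa i j \<circ> T)) S" by simp
  also have "\<dots> = measure N ((stat_kappa i j \<circ> T) -` S \<inter> space N)"
    by (intro measure_distr) measurable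
  also have "(stat_kappa i j \<circ> T) -` S \<inter> space N = {f \<in> space N. stat_kappa i j (T f) \<in> S}" by auto
  finally show ?thesis ..
qed

lemma deviation_prob:
  assumes l: "0 < a" "0 < b" "0 < l"
    and T [measurable]: "T \<in> N \<rightarrow>\<^sub>M stat_measure a b l" and d: "distr N (stat_measure a b l) T = stat_measure a b l"
  shows "measure N {f \<in> space N. deviates a b l d p q m n (T f)}
    = measure (stat_measure a b l) {f \<in> space (stat_measure a b l). deviates a b l d p q m n f}"
proof -
  have "measure (stat_measure a b l) {f \<in> space (stat_measure a b l). deviates a b l d p q m n f}
     = measure (distr N (stat_measure a b l) T) {f \<in> space (stat_measure a b l). deviates a b l d p q m n f}"
    unfolding d ..
  also have "\<dots> = measure N (T -` {f \<in> space (stat_measure a b l). deviates a b l d p q m n f} \<inter> space N)"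
    by (intro measure_distr) measurable
  also have "T -` {f \<in> space (stat_measure a b l). deviates a b l d p q m n f} \<inter> space N
      = {f \<in> space N. deviates a b l d p q m n (T f)}"
    using measurable_space[OF T] by auto
  finally show ?thesis ..
qed

text \<open>What the comparison requires of a cone: the mean part of the error is at most eps at
  every target, and all deviation events together have probability at most eps. The endpoints p, q,
  m, k are free since the lower and the upper bound use differently shifted paths.\<close>

definition cone_controlled ::
    "real \<Rightarrow> real \<Rightarrow> real \<Rightarrow> real \<Rightarrow> real \<Rightarrow> real \<Rightarrow> 'x measure \<Rightarrow> real \<Rightarrow> real \<Rightarrow> nat \<Rightarrow> bool" where
  "cone_controlled a b l u t eps N d e n \<longleftrightarrow>
    (\<forall>M z1 z2. (z1, z2) \<in> direction_cone t e n M \<longrightarrow>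
      exp (real z1 * (phi1 a b l - phi1 a b u + 2 * d) + real z2 * (phi2 a b u - phi2 a b l + 2 * d)) \<le> eps) \<and>
    (\<forall>S T M p q m k. S \<in> N \<rightarrow>\<^sub>M stat_measure a b l \<longrightarrow> distr N (stat_measure a b l) S = stat_measure a b l \<longrightarrow>
      T \<in> N \<rightarrow>\<^sub>M stat_measure a b u \<longrightarrow> distr N (stat_measure a b u) T = stat_measure a b u \<longrightarrow>
      (\<forall>z. z \<in> direction_cone t e n M \<longrightarrow> p z \<le> m \<and> q z \<le> k \<and> m - p z = fst z \<and> k - q z = snd z) \<longrightarrow>
      measure N (\<Union>z\<in>direction_cone t e n M. {f \<in> space N. deviates a b l d (p z) (q z) m k (S f)}
        \<union> {f \<in> space N. deviates a b u d (p z) (q z) m k (T f)}) \<le> eps)"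

lemma cone_controlledD:
  assumes "cone_controlled a b l u t eps N d e n"
  shows "(z1, z2) \<in> direction_cone t e n M \<Longrightarrow>
      exp (real z1 * (phi1 a b l - phi1 a b u + 2 * d) + real z2 * (phi2 a b u - phi2 a b l + 2 * d)) \<le> eps"
    and "S \<in> N \<rightarrow>\<^sub>M stat_measure a b l \<Longrightarrow> distr N (stat_measure a b l) S = stat_measure a b l \<Longrightarrow>
      T \<in> N \<rightarrow>\<^sub>M stat_measure a b u \<Longrightarrow> distr N (stat_measure a b u) T = stat_measure a b u \<Longrightarrow>
      (\<And>z. z \<in> direction_cone t e n M \<Longrightarrow> p z \<le> m \<and> q z \<le> k \<and> m - p z = fst z \<and> k - q z = snd z) \<Longrightarrow>
      measure N (\<Union>z\<in>direction_cone t e n M. {f \<in> space N. deviates a b l d (p z) (q z) m k (S f)}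
        \<union> {f \<in> space N. deviates a b u d (p z) (q z) m k (T f)}) \<le> eps"
  using assms unfolding cone_controlled_def by blast+

lemma cone_deviation_bound:
  fixes N :: "'x measure"
  assumes pos: "0 < a" "0 < b" "0 < l" "0 < u" and t: "0 < t" "t < 1"
    and dr: "drift a b t l < drift a b t u" and eps: "0 < eps" and N: "prob_space N"
  shows "\<exists>d e n. 0 < e \<and> cone_controlled a b l u t eps N d e n"
proof -
  interpret prob_space N by fact
  have D: "t * (phi1 a b l - phi1 a b u) + (1 - t) * (phi2 a b u - phi2 a b l) < 0"
    using dr by (simp add: drift_def algebra_simps)
  obtain d e n0 where d: "0 < d" "0 < e" "e \<le> min t (1 - t) / 2"
    and E: "\<And>n M z1 z2. n0 \<le> n \<Longrightarrow> (z1, z2) \<in> direction_cone t e n M \<Longrightarrow>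
      exp (real z1 * (phi1 a b l - phi1 a b u + 2 * d) + real z2 * (phi2 a b u - phi2 a b l + 2 * d)) \<le> eps"
    using cone_drift[OF t D eps] by blast
  obtain r1 where r1: "0 < r1" "r1 < 1" and R1: "\<And>p q m n. p \<le> m \<Longrightarrow> q \<le> n \<Longrightarrow>
    measure (stat_measure a b l) {f \<in> space (stat_measure a b l). deviates a b l d p q m n f} \<le> 2 * (r1 ^ (m - p) + r1 ^ (n - q))"
    using deviates_bound[OF pos(1,2,3) d(1)] by blast
  obtain r2 where r2: "0 < r2" "r2 < 1" and R2: "\<And>p q m n. p \<le> m \<Longrightarrow> q \<le> n \<Longrightarrow>
    measure (stat_measure a b u) {f \<in> space (stat_measure a b u). deviates a b u d p q m n f} \<le> 2 * (r2 ^ (m - p) + r2 ^ (n - q))"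
    using deviates_bound[OF pos(1,2,4) d(1)] by blast
  define r where "r = max r1 r2"
  have r: "0 < r" "r < 1" "r1 \<le> r" "r2 \<le> r" using r1 r2 by (auto simp: r_def)
  obtain n1 where n1: "\<And>n e M (Q :: 'x measure) B. n1 \<le> n \<Longrightarrow> e \<le> min t (1 - t) / 2 \<Longrightarrow>
    (\<forall>z\<in>direction_cone t e n M. B z \<in> sets Q \<and> measure Q (B z) \<le> 4 * (r ^ fst z + r ^ snd z)) \<Longrightarrow>
    finite_measure Q \<Longrightarrow> measure Q (\<Union>z\<in>direction_cone t e n M. B z) \<le> eps"
    using cone_union_bound[OF r(1,2) t eps, where 'x = 'x] by blast
  define n where "n = max n0 n1"
  have "measure N (\<Union>z\<in>direction_cone t e n M. {f \<in> space N. deviates a b l d (p z) (q z) m k (S f)}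
        \<union> {f \<in> space N. deviates a b u d (p z) (q z) m k (T f)}) \<le> eps"
    if S: "S \<in> N \<rightarrow>\<^sub>M stat_measure a b l" "distr N (stat_measure a b l) S = stat_measure a b l"
      and T: "T \<in> N \<rightarrow>\<^sub>M stat_measure a b u" "distr N (stat_measure a b u) T = stat_measure a b u"
      and pq: "\<And>z. z \<in> direction_cone t e n M \<Longrightarrow> p z \<le> m \<and> q z \<le> k \<and> m - p z = fst z \<and> k - q z = snd z"
    for S T M p q m k
  proof (intro n1 ballI conjI finite_measure_axioms d(3))
    note [measurable] = S(1) T(1)
    have [measurable]: "(\<lambda>f. S f p) \<in> borel_measurable N" "(\<lambda>f. T f p) \<in> borel_measurable N" for p
      using measurable_compose[OF S(1) stat_measurable_component] measurable_compose[OF T(1) stat_measurable_component] by auto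
    show "n1 \<le> n" by (simp add: n_def)
    fix z assume z: "z \<in> direction_cone t e n M"
    show "{f \<in> space N. deviates a b l d (p z) (q z) m k (S f)} \<union> {f \<in> space N. deviates a b u d (p z) (q z) m k (T f)} \<in> sets N"
      by measurable
    have "measure N ({f \<in> space N. deviates a b l d (p z) (q z) m k (S f)} \<union> {f \<in> space N. deviates a b u d (p z) (q z) m k (T f)})
      \<le> measure N {f \<in> space N. deviates a b l d (p z) (q z) m k (S f)} + measure N {f \<in> space N. deviates a b u d (p z) (q z) m k (T f)}"
      by (intro measure_Un_le) measurable
    also have "\<dots> \<le> 2 * (r1 ^ fst z + r1 ^ snd z) + 2 * (r2 ^ fst z + r2 ^ snd z)"
      using R1[of "p z" m "q z" k] R2[of "p z" m "q z" k] pq[OF z]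
        deviation_prob[OF pos(1-3) S] deviation_prob[OF pos(1,2,4) T]
      by (intro add_mono) auto
    also have "\<dots> \<le> 2 * (r ^ fst z + r ^ snd z) + 2 * (r ^ fst z + r ^ snd z)"
      using r r1 r2 by (intro add_mono mult_left_mono power_mono) auto
    finally show "measure N ({f \<in> space N. deviates a b l d (p z) (q z) m k (S f)} \<union> {f \<in> space N. deviates a b u d (p z) (q z) m k (T f)})
      \<le> 4 * (r ^ fst z + r ^ snd z)" by simp
  qed
  moreover have "n0 \<le> n" by (simp add: n_def)
  ultimately have "cone_controlled a b l u t eps N d e n" using E unfolding cone_controlled_def by blast
  with d(2) show ?thesis by blast
qed

text \<open>All targets share the starting site. Off the deviation events a value below x at any
  target forces the single variable \<open>stat_kappa M M\<close> below x / (1 - eps), and its law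
  does not depend on M.\<close>

lemma coupling_hit_lower:
  assumes pos: "0 < a" "0 < b" "0 < u" "u < l" and t: "0 < t" "t < 1"
    and dr: "drift a b t l < drift a b t u" and eps: "0 < eps" "eps < 1"
  shows "\<exists>e>0. \<exists>n. \<forall>M x. measure (coupling_measure a b u l) {f \<in> space (coupling_measure a b u l).
      \<exists>z\<in>direction_cone t e n M. hit_kappa (cell_weights M (fst z) (snd z) (\<lambda>p. fst (f p))) (fst z) (snd z) < x}
    \<le> measure (kappa_measure a b l) {..< x / (1 - eps)} + eps"
proof -
  let ?C = "coupling_measure a b u l"
  interpret C: prob_space ?C by (intro prob_space_PiM coupling_law_props pos)
  note [measurable] = coupling_component[OF pos] measurable_coupling_fst[OF pos] measurable_coupling_snd[OF pos]
  have lu: "0 < l" "0 < u" using pos by auto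
  obtain d e n where e: "0 < e" and ctl: "cone_controlled a b l u t eps ?C d e n"
    using cone_deviation_bound[OF pos(1,2) lu t dr eps(1) C.prob_space_axioms] by blast
  show ?thesis
  proof (intro exI[of _ e] conjI exI[of _ n] allI e)
    fix M x
    define B where "B z = {f \<in> space ?C. deviates a b l d (M - fst z) (Suc (M - snd z)) (M) (Suc M) (\<lambda>p. fst (f p))}
      \<union> {f \<in> space ?C. deviates a b u d (M - fst z) (Suc (M - snd z)) (M) (Suc M) (\<lambda>p. snd (f p))}" for z
    define A where "A = {f \<in> space ?C. stat_kappa M M (\<lambda>p. fst (f p)) \<in> {..< x / (1 - eps)}}"
    have [measurable]: "B z \<in> sets ?C" for z unfolding B_def by measurable
    have [measurable]: "A \<in> sets ?C" unfolding A_def by measurable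
    have "measure ?C {f \<in> space ?C. \<exists>z\<in>direction_cone t e n M. hit_kappa (cell_weights M (fst z) (snd z) (\<lambda>p. fst (f p))) (fst z) (snd z) < x}
      \<le> measure ?C (A \<union> (\<Union>z\<in>direction_cone t e n M. B z))"
    proof (rule C.finite_measure_mono_AE)
      show "AE f in ?C. f \<in> {f \<in> space ?C. \<exists>z\<in>direction_cone t e n M. hit_kappa (cell_weights M (fst z) (snd z) (\<lambda>p. fst (f p))) (fst z) (snd z) < x}
          \<longrightarrow> f \<in> A \<union> (\<Union>z\<in>direction_cone t e n M. B z)"
        using AE_coupled[OF pos] AE_space
      proof eventually_elim
        case (elim f)
        show ?case
        proof
          assume "f \<in> {f \<in> space ?C. \<exists>z\<in>direction_cone t e n M. hit_kappa (cell_weights M (fst z) (snd z) (\<lambda>p. fst (f p))) (fst z) (snd z) < x}"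
          then obtain z1 z2 where z: "(z1, z2) \<in> direction_cone t e n M" "hit_kappa (cell_weights M z1 z2 (\<lambda>p. fst (f p))) z1 z2 < x" by auto
          note expb = cone_controlledD(1)[OF ctl z(1)]
          show "f \<in> A \<union> (\<Union>z\<in>direction_cone t e n M. B z)"
          proof (cases "f \<in> B (z1, z2)")
            case False
            have "stat_kappa M M (\<lambda>p. fst (f p)) * (1 - eps) \<le> hit_kappa (translate (M - z1) (M - z2) (stat_w (\<lambda>p. fst (f p)))) z1 z2"
              using z(1) False elim expb by (intro hit_kappa_lower[where d = d and a = a and b = b and l = l and u = u]) (auto simp: direction_cone_def B_def)
            then have "stat_kappa M M (\<lambda>p. fst (f p)) * (1 - eps) < x" using z(2) by (simp add: cell_weights_def)
            then have "f \<in> A" using eps elim by (simp add: A_def pos_less_divide_eq)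
            then show ?thesis by simp
          qed (use z in auto)
        qed
      qed
    qed measurable
    also have "\<dots> \<le> measure ?C A + measure ?C (\<Union>z\<in>direction_cone t e n M. B z)"
      by (intro measure_Un_le) measurable
    also have "measure ?C A = measure (kappa_measure a b l) {..< x / (1 - eps)}"
      unfolding A_def by (intro measure_stat_kappa pos lu measurable_coupling_fst coupling_marginals) auto
    also have "measure ?C (\<Union>z\<in>direction_cone t e n M. B z) \<le> eps"
      unfolding B_def
      by (intro cone_controlledD(2)[OF ctl] measurable_coupling_fst measurable_coupling_snd coupling_marginals pos) (auto simp: direction_cone_def)
    finally show "measure ?C {f \<in> space ?C. \<exists>z\<in>direction_cone t e n M. hit_kappa (cell_weights M (fst z) (snd z) (\<lambda>p. fst (f p))) (fst z) (snd z) < x}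
        \<le> measure (kappa_measure a b l) {..< x / (1 - eps)} + eps" by simp
  qed
qed

text \<open>The main function now has the smaller parameter l and sits in the second component. The
  estimate concerns 1 minus the transition probability, hence the form of the threshold.\<close>

lemma coupling_hit_upper:
  assumes pos: "0 < a" "0 < b" "0 < l" "l < u" and t: "0 < t" "t < 1"
    and dr: "drift a b t l < drift a b t u" and eps: "0 < eps" "eps < 1"
  shows "\<exists>e>0. \<exists>n. \<forall>M x. measure (coupling_measure a b l u) {f \<in> space (coupling_measure a b l u).
      \<exists>z\<in>direction_cone t e n M. x < hit_kappa (cell_weights M (fst z) (snd z) (\<lambda>p. snd (f p))) (fst z) (snd z)}
    \<le> measure (kappa_measure a b l) {1 - (1 - x) / (1 - eps) <..} + eps"
proof -
  let ?C = "coupling_measure a b l u"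
  interpret C: prob_space ?C by (intro prob_space_PiM coupling_law_props pos)
  note [measurable] = coupling_component[OF pos] measurable_coupling_fst[OF pos] measurable_coupling_snd[OF pos]
  have lu: "0 < l" "0 < u" using pos by auto
  obtain d e n where e: "0 < e" and ctl: "cone_controlled a b l u t eps ?C d e n"
    using cone_deviation_bound[OF pos(1,2) lu t dr eps(1) C.prob_space_axioms] by blast
  show ?thesis
  proof (intro exI[of _ e] conjI exI[of _ n] allI e)
    fix M x
    define B where "B z = {f \<in> space ?C. deviates a b l d (Suc (M - fst z)) (M - snd z) (Suc M) (M) (\<lambda>p. snd (f p))}
      \<union> {f \<in> space ?C. deviates a b u d (Suc (M - fst z)) (M - snd z) (Suc M) (M) (\<lambda>p. fst (f p))}" for z
    define A where "A = {f \<in> space ?C. stat_kappa M M (\<lambda>p. snd (f p)) \<in> {1 - (1 - x) / (1 - eps) <..}}"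
    have [measurable]: "B z \<in> sets ?C" for z unfolding B_def by measurable
    have [measurable]: "A \<in> sets ?C" unfolding A_def by measurable
    have "measure ?C {f \<in> space ?C. \<exists>z\<in>direction_cone t e n M. x < hit_kappa (cell_weights M (fst z) (snd z) (\<lambda>p. snd (f p))) (fst z) (snd z)}
      \<le> measure ?C (A \<union> (\<Union>z\<in>direction_cone t e n M. B z))"
    proof (rule C.finite_measure_mono_AE)
      show "AE f in ?C. f \<in> {f \<in> space ?C. \<exists>z\<in>direction_cone t e n M. x < hit_kappa (cell_weights M (fst z) (snd z) (\<lambda>p. snd (f p))) (fst z) (snd z)}
          \<longrightarrow> f \<in> A \<union> (\<Union>z\<in>direction_cone t e n M. B z)"
        using AE_coupled[OF pos] AE_space
      proof eventually_elim
        case (elim f)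
        show ?case
        proof
          assume "f \<in> {f \<in> space ?C. \<exists>z\<in>direction_cone t e n M. x < hit_kappa (cell_weights M (fst z) (snd z) (\<lambda>p. snd (f p))) (fst z) (snd z)}"
          then obtain z1 z2 where z: "(z1, z2) \<in> direction_cone t e n M" "x < hit_kappa (cell_weights M z1 z2 (\<lambda>p. snd (f p))) z1 z2" by auto
          note expb = cone_controlledD(1)[OF ctl z(1)]
          show "f \<in> A \<union> (\<Union>z\<in>direction_cone t e n M. B z)"
          proof (cases "f \<in> B (z1, z2)")
            case False
            have "(1 - stat_kappa M M (\<lambda>p. snd (f p))) * (1 - eps) \<le> 1 - hit_kappa (translate (M - z1) (M - z2) (stat_w (\<lambda>p. snd (f p)))) z1 z2"
              using z(1) False elim expb by (intro hit_kappa_upper[where d = d and a = a and b = b and l = l and u = u and g = "\<lambda>p. fst (f p)"]) (auto simp: direction_cone_def B_def)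
            then have "(1 - stat_kappa M M (\<lambda>p. snd (f p))) * (1 - eps) < 1 - x" using z(2) by (simp add: cell_weights_def)
            then have "1 - stat_kappa M M (\<lambda>p. snd (f p)) < (1 - x) / (1 - eps)" using eps by (simp add: pos_less_divide_eq)
            then have "f \<in> A" using elim by (simp add: A_def)
            then show ?thesis by simp
          qed (use z in auto)
        qed
      qed
    qed measurable
    also have "\<dots> \<le> measure ?C A + measure ?C (\<Union>z\<in>direction_cone t e n M. B z)"
      by (intro measure_Un_le) measurable
    also have "measure ?C A = measure (kappa_measure a b l) {1 - (1 - x) / (1 - eps) <..}"
      unfolding A_def by (intro measure_stat_kappa pos lu measurable_coupling_snd coupling_marginals) auto
    also have "measure ?C (\<Union>z\<in>direction_cone t e n M. B z) \<le> eps"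
      unfolding B_def
      by (intro cone_controlledD(2)[OF ctl] measurable_coupling_fst measurable_coupling_snd coupling_marginals pos) (auto simp: direction_cone_def)
    finally show "measure ?C {f \<in> space ?C. \<exists>z\<in>direction_cone t e n M. x < hit_kappa (cell_weights M (fst z) (snd z) (\<lambda>p. snd (f p))) (fst z) (snd z)}
        \<le> measure (kappa_measure a b l) {1 - (1 - x) / (1 - eps) <..} + eps" by simp
  qed
qed

section \<open>Transfer from the coupled model to the environment\<close>

definition env_weights :: "nat \<Rightarrow> nat \<Rightarrow> env \<Rightarrow> nat \<Rightarrow> nat \<Rightarrow> real" where
  "env_weights z1 z2 w i j = w (int z1 - int i, int z2 - int j)"

text \<open>The event involves only the weights of the box from 0 to M, and these are independent
  Beta(a, b) variables in the environment as well as in the interior of the noise. Both sides are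
  the measure of one event of a finite product.\<close>

lemma env_box_transfer:
  assumes pos: "0 < a" "0 < b" and D: "\<And>p. prob_space (D p)"
    and phi: "\<And>i j. phi \<in> borel_measurable (D (Suc i, Suc j))"
    and eq: "\<And>i j. distr (D (Suc i, Suc j)) borel phi = beta_distribution a b"
    and S: "\<And>z. S z \<in> sets borel"
  shows "measure (environment a b) {w \<in> space (environment a b). \<exists>z\<in>direction_cone t e n M. hit_kappa (env_weights (fst z) (snd z) w) (fst z) (snd z) \<in> S z}
    = measure (PiM UNIV D) {f \<in> space (PiM UNIV D). \<exists>z\<in>direction_cone t e n M.
        hit_kappa (cell_weights M (fst z) (snd z) (\<lambda>p. phi (f p))) (fst z) (snd z) \<in> S z}"
proof -
  note [measurable] = S
  let ?B = "{0..int M} \<times> {0..int M}"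
  let ?N = "PiM ?B (\<lambda>_. beta_distribution a b)"
  \<comment> \<open>The value 0 outside the rectangle between origin and target makes the event a
    function of the coordinates in the box.\<close>
  let ?E = "{g \<in> space ?N. \<exists>z\<in>direction_cone t e n M. hit_kappa (\<lambda>i j. if i \<le> fst z \<and> j \<le> snd z then env_weights (fst z) (snd z) g i j else 0) (fst z) (snd z) \<in> S z}"
  have pb: "prob_space (beta_distribution a b)" using pos by (rule prob_space_beta_distribution)
  have comp [measurable]: "(\<lambda>g. g p) \<in> borel_measurable ?N" if "p \<in> ?B" for p
  proof -
    have "(\<lambda>g. g p) \<in> ?N \<rightarrow>\<^sub>M beta_distribution a b" using that by measurable
    then show ?thesis by (simp cong: measurable_cong_sets)
  qed
  have meas: "(\<lambda>g. hit_kappa (\<lambda>i j. if i \<le> fst z \<and> j \<le> snd z then env_weights (fst z) (snd z) g i j else 0) (fst z) (snd z)) \<in> borel_measurable ?N"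
    if z: "z \<in> direction_cone t e n M" for z
  proof (rule hit_kappa_measurable)
    fix i j
    show "(\<lambda>g. if i \<le> fst z \<and> j \<le> snd z then env_weights (fst z) (snd z) g i j else 0) \<in> borel_measurable ?N"
    proof (cases "i \<le> fst z \<and> j \<le> snd z")
      case True
      then have "(int (fst z) - int i, int (snd z) - int j) \<in> ?B" using z by (auto simp: direction_cone_def)
      from comp[OF this] True show ?thesis by (simp add: env_weights_def)
    qed auto
  qed
  have E: "?E \<in> sets ?N"
  proof (rule sets.sets_Collect_finite_Ex)
    fix z assume z: "z \<in> direction_cone t e n M"
    show "{g \<in> space ?N. hit_kappa (\<lambda>i j. if i \<le> fst z \<and> j \<le> snd z then env_weights (fst z) (snd z) g i j else 0) (fst z) (snd z) \<in> S z} \<in> sets ?N"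
      using measurable_sets[OF meas[OF z] S[of z]] by (simp add: vimage_def Int_def conj_commute)
  qed simp
  have 1: "distr (environment a b) ?N (\<lambda>w. \<lambda>p\<in>?B. w p) = ?N"
    unfolding environment_def
    by (rule distr_PiM_map[where s = "\<lambda>p. p" and phi = "\<lambda>x. x"]) (simp_all add: pb distr_id2)
  have m1: "(\<lambda>w. \<lambda>p\<in>?B. w p) \<in> environment a b \<rightarrow>\<^sub>M ?N"
    unfolding environment_def by (intro measurable_restrict measurable_component_singleton) auto
  \<comment> \<open>The noise counts backwards and reserves index 0 for the boundary, so the origin
    goes to (Suc M, Suc M).\<close>
  define s where "s p = (Suc (nat (int M - fst p)), Suc (nat (int M - snd p)))" for p :: "int \<times> int"
  have 2: "distr (PiM UNIV D) ?N (\<lambda>f. \<lambda>p\<in>?B. phi (f (s p))) = ?N"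
  proof (rule distr_PiM_map[where s = s])
    show "inj_on s ?B" by (auto simp: inj_on_def s_def)
    show "phi \<in> D (s p) \<rightarrow>\<^sub>M beta_distribution a b" for p
      using phi by (simp add: s_def cong: measurable_cong_sets)
    show "distr (D (s p)) (beta_distribution a b) phi = beta_distribution a b" for p
      using eq by (simp add: s_def cong: distr_cong)
  qed (auto simp: D pb)
  have m2: "(\<lambda>f. \<lambda>p\<in>?B. phi (f (s p))) \<in> PiM UNIV D \<rightarrow>\<^sub>M ?N"
  proof (rule measurable_restrict)
    fix p
    have "(\<lambda>f. f (s p)) \<in> PiM UNIV D \<rightarrow>\<^sub>M D (s p)" by measurable
    moreover have "phi \<in> D (s p) \<rightarrow>\<^sub>M beta_distribution a b"
      using phi by (simp add: s_def cong: measurable_cong_sets)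
    ultimately show "(\<lambda>f. phi (f (s p))) \<in> PiM UNIV D \<rightarrow>\<^sub>M beta_distribution a b" by (rule measurable_compose)
  qed
  have e1: "hit_kappa (env_weights z1 z2 w) z1 z2 = hit_kappa (\<lambda>i j. if i \<le> z1 \<and> j \<le> z2 then env_weights z1 z2 (\<lambda>p\<in>?B. w p) i j else 0) z1 z2"
    if "(z1, z2) \<in> direction_cone t e n M" for z1 z2 w
    using that by (intro hit_kappa_cong) (auto simp: env_weights_def direction_cone_def)
  have e2: "hit_kappa (cell_weights M z1 z2 (\<lambda>p. phi (f p))) z1 z2 = hit_kappa (\<lambda>i j. if i \<le> z1 \<and> j \<le> z2 then env_weights z1 z2 (\<lambda>p\<in>?B. phi (f (s p))) i j else 0) z1 z2"
    if "(z1, z2) \<in> direction_cone t e n M" for z1 z2 f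
    using that by (intro hit_kappa_cong)
      (auto simp: env_weights_def direction_cone_def cell_weights_def translate_def stat_w_def s_def nat_diff_distrib' intro!: arg_cong[where f = phi] arg_cong[where f = f])
  have "measure (environment a b) {w \<in> space (environment a b). \<exists>z\<in>direction_cone t e n M. hit_kappa (env_weights (fst z) (snd z) w) (fst z) (snd z) \<in> S z}
      = measure (environment a b) ((\<lambda>w. \<lambda>p\<in>?B. w p) -` ?E \<inter> space (environment a b))"
    using measurable_space[OF m1] e1 by (intro arg_cong[where f = "measure _"]) auto
  also have "\<dots> = measure (distr (environment a b) ?N (\<lambda>w. \<lambda>p\<in>?B. w p)) ?E"
    by (rule measure_distr[OF m1 E, symmetric])
  also have "\<dots> = measure (distr (PiM UNIV D) ?N (\<lambda>f. \<lambda>p\<in>?B. phi (f (s p)))) ?E"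
    unfolding 1 2 ..
  also have "\<dots> = measure (PiM UNIV D) ((\<lambda>f. \<lambda>p\<in>?B. phi (f (s p))) -` ?E \<inter> space (PiM UNIV D))"
    by (rule measure_distr[OF m2 E])
  also have "\<dots> = measure (PiM UNIV D) {f \<in> space (PiM UNIV D). \<exists>z\<in>direction_cone t e n M.
        hit_kappa (cell_weights M (fst z) (snd z) (\<lambda>p. phi (f p))) (fst z) (snd z) \<in> S z}"
    using measurable_space[OF m2] e2 by (intro arg_cong[where f = "measure _"]) auto
  finally show ?thesis .
qed

section \<open>The quenched hitting probabilities\<close>

lemma sets_walk_law: "sets (walk_law w x) = sets (PiM UNIV (\<lambda>_. count_space UNIV))"
proof -
  interpret IT: Ionescu_Tulcea "walk_kernel w x" "\<lambda>_. count_space UNIV"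
    by (rule Ionescu_Tulcea_walk_kernel)
  show ?thesis unfolding walk_law_def by (rule IT.PF.sets_lim)
qed

lemma space_walk_law [simp]: "space (walk_law w x) = UNIV"
  using sets_eq_imp_space_eq[OF sets_walk_law] by (simp add: space_PiM)

lemma prob_space_walk_law: "prob_space (walk_law w x)"
proof
  interpret IT: Ionescu_Tulcea "walk_kernel w x" "\<lambda>_. count_space UNIV"
    by (rule Ionescu_Tulcea_walk_kernel)
  let ?M = "\<lambda>_::nat. count_space (UNIV :: (int \<times> int) set)"
  interpret P: prob_space "IT.CI {0..<1}" by (rule IT.PF.prob_space_P) auto
  have "emeasure (walk_law w x) (prod_emb UNIV ?M {0..<1} (space (PiM {0..<1} ?M))) = emeasure (IT.CI {0..<1}) (space (PiM {0..<1} ?M))"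
    unfolding walk_law_def by (rule IT.lim) auto
  also have "space (PiM {0..<1} ?M) = space (IT.CI {0..<1})"
    using IT.PF.sets_P[of "{0..<1}"] by (intro sets_eq_imp_space_eq) auto
  also have "emeasure (IT.CI {0..<1}) (space (IT.CI {0..<1})) = 1" by (rule P.emeasure_space_1)
  also have "prod_emb UNIV ?M {0..<1} (space (IT.CI {0..<1})) = UNIV"
    unfolding \<open>space (PiM {0..<1} ?M) = space (IT.CI {0..<1})\<close>[symmetric]
    by (auto simp: prod_emb_def space_PiM)
  finally show "emeasure (walk_law w x) (space (walk_law w x)) = 1" by simp
qed

section \<open>Path events and their weights\<close>

definition step_vec :: "bool \<Rightarrow> int \<times> int" where
  "step_vec c = (if c then e1 else e2)"

fun path_end :: "int \<times> int \<Rightarrow> bool list \<Rightarrow> int \<times> int" where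
  "path_end x [] = x"
| "path_end x (c # cs) = path_end (x + step_vec c) cs"

fun path_weight :: "env \<Rightarrow> int \<times> int \<Rightarrow> bool list \<Rightarrow> real" where
  "path_weight w x [] = 1"
| "path_weight w x (c # cs) = pmf (bernoulli_pmf (w x)) c * path_weight w (x + step_vec c) cs"

lemma pmf_walk_step_dir: "pmf (walk_step w y) (y + step_vec c) = pmf (bernoulli_pmf (w y)) c"
proof -
  have "walk_step w y = map_pmf (\<lambda>c. y + step_vec c) (bernoulli_pmf (w y))"
    by (auto simp: walk_step_def step_vec_def intro!: arg_cong2[where f = map_pmf])
  moreover have "inj (\<lambda>c. y + step_vec c)" by (auto simp: inj_def step_vec_def split: if_splits)
  ultimately show ?thesis using pmf_map_inj'[of "\<lambda>c. y + step_vec c" "bernoulli_pmf (w y)" c] by simp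
qed

definition path_event :: "int \<times> int \<Rightarrow> bool list \<Rightarrow> (nat \<Rightarrow> int \<times> int) set" where
  "path_event x cs = {X. \<forall>i\<le>length cs. X i = path_end x (take i cs)}"

lemma measure_path_event: "measure (walk_law w x) (path_event x cs) = path_weight w x cs"
proof -
  have "(\<Prod>i<length cs. pmf (walk_step w (path_end x (take i cs))) (path_end x (take (Suc i) cs))) = path_weight w x cs"
  proof (induction cs arbitrary: x)
    case (Cons c cs)
    have "(\<Prod>i<length (c # cs). pmf (walk_step w (path_end x (take i (c # cs)))) (path_end x (take (Suc i) (c # cs))))
        = pmf (walk_step w x) (x + step_vec c) *
          (\<Prod>i<length cs. pmf (walk_step w (path_end (x + step_vec c) (take i cs))) (path_end (x + step_vec c) (take (Suc i) cs)))"
      by (simp add: prod.lessThan_Suc_shift del: prod.lessThan_Suc)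
    then show ?case using Cons[of "x + step_vec c"] by (simp add: pmf_walk_step_dir)
  qed simp
  then show ?thesis
    unfolding path_event_def by (subst measure_walk_law_cylinder) simp
qed

lemma path_event_sets [measurable]: "path_event x cs \<in> sets (walk_law w x)"
proof -
  have "path_event x cs = {X \<in> space (PiM UNIV (\<lambda>_. count_space UNIV)). \<forall>i\<in>{..length cs}. X i = path_end x (take i cs)}"
    by (auto simp: path_event_def space_PiM)
  also have "\<dots> \<in> sets (PiM UNIV (\<lambda>_. count_space UNIV))"
    by measurable
  finally show ?thesis by (simp add: sets_walk_law)
qed

lemma path_event_disjoint:
  assumes "X \<in> path_event x cs" "X \<in> path_event x cs'" "length cs = length cs'"
  shows "cs = cs'"
proof -
  have "\<forall>i\<le>length cs. path_end x (take i cs) = path_end x (take i cs')"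
    using assms by (auto simp: path_event_def)
  with assms(3) show ?thesis
  proof (induction cs arbitrary: x cs')
    case (Cons c cs)
    then obtain d ds where cs': "cs' = d # ds" by (cases cs') auto
    have "path_end x (take 1 (c # cs)) = path_end x (take 1 (d # ds))"
      using Cons.prems(2) unfolding cs' by (metis One_nat_def Suc_leI length_Cons zero_less_Suc)
    then have "c = d" by (auto simp: step_vec_def split: if_splits)
    moreover have "cs = ds"
    proof (rule Cons.IH)
      show "length cs = length ds" using Cons.prems cs' by simp
      show "\<forall>i\<le>length cs. path_end (x + step_vec c) (take i cs) = path_end (x + step_vec c) (take i ds)"
      proof (intro allI impI)
        fix i assume "i \<le> length cs"
        then have "path_end x (take (Suc i) (c # cs)) = path_end x (take (Suc i) (d # ds))"
          using Cons.prems(2) cs' by (metis Suc_le_mono length_Cons)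
        then show "path_end (x + step_vec c) (take i cs) = path_end (x + step_vec c) (take i ds)"
          using \<open>c = d\<close> by simp
      qed
    qed
    ultimately show ?case by (simp add: cs')
  qed simp
qed

definition paths :: "nat \<Rightarrow> bool list set" where
  "paths n = {cs. length cs = n}"

lemma finite_paths [simp]: "finite (paths n)"
  using finite_lists_length_eq[of "UNIV :: bool set" n] by (simp add: paths_def)

lemma sum_paths_Suc: "(\<Sum>cs\<in>paths (Suc n). f cs) = (\<Sum>cs\<in>paths n. f (True # cs)) + (\<Sum>cs\<in>paths n. f (False # cs))"
  for f :: "bool list \<Rightarrow> real"
proof -
  have "paths (Suc n) = (#) True ` paths n \<union> (#) False ` paths n"
    by (auto simp: paths_def length_Suc_conv image_iff)
  then have "(\<Sum>cs\<in>paths (Suc n). f cs) = (\<Sum>cs\<in>(#) True ` paths n. f cs) + (\<Sum>cs\<in>(#) False ` paths n. f cs)"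
    using sum.union_disjoint[of "(#) True ` paths n" "(#) False ` paths n" f] by auto
  then show ?thesis by (simp add: sum.reindex)
qed

lemma pmf_bernoulli_sum: "pmf (bernoulli_pmf p) True + pmf (bernoulli_pmf p) False = 1"
proof -
  have "set_pmf (bernoulli_pmf p) \<subseteq> {False, True}" by auto
  then show ?thesis using sum_pmf_eq_1[of "{False, True}" "bernoulli_pmf p"] by (simp add: add.commute)
qed

lemma sum_path_weight: "(\<Sum>cs\<in>paths n. path_weight w x cs) = 1"
proof (induction n arbitrary: x)
  case (Suc n)
  then show ?case
    by (simp add: sum_paths_Suc sum_distrib_left[symmetric] pmf_bernoulli_sum)
qed (simp add: paths_def)

section \<open>First-step recursion for the position of the walk\<close>

text \<open>The recursion is valid in every environment, also for values outside the unit interval,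
  since \<open>bernoulli_pmf\<close> clips them. Measurability of hitting probabilities then needs
  no exceptional set.\<close>

primrec reach_prob :: "env \<Rightarrow> nat \<Rightarrow> int \<times> int \<Rightarrow> int \<times> int \<Rightarrow> real" where
  "reach_prob w 0 x z = (if x = z then 1 else 0)"
| "reach_prob w (Suc n) x z = pmf (bernoulli_pmf (w x)) True * reach_prob w n (x + e1) z
     + pmf (bernoulli_pmf (w x)) False * reach_prob w n (x + e2) z"

lemma reach_prob_sum: "reach_prob w n x z = (\<Sum>cs\<in>paths n. if path_end x cs = z then path_weight w x cs else 0)"
proof (induction n arbitrary: x)
  case 0
  then show ?case by (simp add: paths_def)
next
  case (Suc n)
  have "(\<Sum>cs\<in>paths n. if path_end x (c # cs) = z then path_weight w x (c # cs) else 0)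
      = pmf (bernoulli_pmf (w x)) c * reach_prob w n (x + step_vec c) z" for c
    unfolding Suc by (simp add: sum_distrib_left if_distrib cong: if_cong)
  from this[of True] this[of False] show ?case by (simp add: sum_paths_Suc step_vec_def)
qed

text \<open>The cylinder events bound the probability of the event and of its complement from below; since
  the path weights sum to one, both bounds are attained.\<close>

lemma measure_walk_law_position: "measure (walk_law w x) {X. X n = z} = reach_prob w n x z"
proof -
  interpret prob_space "walk_law w x" by (rule prob_space_walk_law)
  have ev: "{X. X n = z} \<in> sets (walk_law w x)"
  proof -
    have "{X \<in> space (PiM UNIV (\<lambda>_. count_space UNIV)). X n = z} \<in> sets (PiM UNIV (\<lambda>_. count_space (UNIV :: (int \<times> int) set)))"
      by measurable
    then show ?thesis by (simp add: sets_walk_law space_PiM)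
  qed
  have lower: "(\<Sum>cs\<in>{cs \<in> paths n. Q (path_end x cs)}. path_weight w x cs) \<le> measure (walk_law w x) {X. Q (X n)}"
    if m: "{X. Q (X n)} \<in> sets (walk_law w x)" for Q
  proof -
    have "(\<Sum>cs\<in>{cs \<in> paths n. Q (path_end x cs)}. path_weight w x cs)
        = (\<Sum>cs\<in>{cs \<in> paths n. Q (path_end x cs)}. measure (walk_law w x) (path_event x cs))"
      by (simp add: measure_path_event)
    also have "\<dots> = measure (walk_law w x) (\<Union>cs\<in>{cs \<in> paths n. Q (path_end x cs)}. path_event x cs)"
    proof (rule finite_measure_finite_Union[symmetric])
      show "disjoint_family_on (path_event x) {cs \<in> paths n. Q (path_end x cs)}"
        unfolding disjoint_family_on_def
      proof (intro ballI impI)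
        fix cs cs' assume "cs \<in> {cs \<in> paths n. Q (path_end x cs)}" "cs' \<in> {cs \<in> paths n. Q (path_end x cs)}" "cs \<noteq> cs'"
        then show "path_event x cs \<inter> path_event x cs' = {}"
          using path_event_disjoint[of _ x cs cs'] by (auto simp: paths_def)
      qed
    qed auto
    also have "\<dots> \<le> measure (walk_law w x) {X. Q (X n)}"
      by (rule finite_measure_mono[OF _ m]) (auto simp: path_event_def paths_def)
    finally show ?thesis .
  qed
  have split: "(\<Sum>cs\<in>{cs \<in> paths n. path_end x cs = z}. path_weight w x cs)
      + (\<Sum>cs\<in>{cs \<in> paths n. path_end x cs \<noteq> z}. path_weight w x cs) = 1"
    unfolding sum_path_weight[of w x n, symmetric]
    by (subst sum.union_disjoint[symmetric]) (auto intro!: sum.cong)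
  have co: "{X. X n \<noteq> z} = space (walk_law w x) - {X. X n = z}" by auto
  have "{X. X n \<noteq> z} \<in> sets (walk_law w x)" unfolding co using ev by (rule sets.compl_sets)
  from lower[of "\<lambda>y. y \<noteq> z", OF this] lower[of "\<lambda>y. y = z", OF ev]
  have "measure (walk_law w x) {X. X n = z} = (\<Sum>cs\<in>{cs \<in> paths n. path_end x cs = z}. path_weight w x cs)"
    using split prob_compl[OF ev] unfolding co by simp
  also have "\<dots> = reach_prob w n x z"
    unfolding reach_prob_sum by (simp add: sum.inter_filter)
  finally show ?thesis .
qed

lemma hit_prob_eq: "hit_prob w x z = reach_prob w (nat (norm1 (z - x))) x z"
  by (simp add: hit_prob_def measure_walk_law_position)

lemma pmf_bernoulli_clip:
  shows "pmf (bernoulli_pmf p) True = min 1 (max 0 p)"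
    and "pmf (bernoulli_pmf p) False = 1 - min 1 (max 0 p)"
proof -
  have e: "bernoulli_pmf p = bernoulli_pmf (min 1 (max 0 p))"
  proof -
    have "min 1 (max 0 (min 1 (max 0 p))) = min 1 (max 0 p)" by (auto simp: min_def max_def)
    then show ?thesis by (simp only: bernoulli_pmf_def map_fun_def comp_def id_def)
  qed
  show "pmf (bernoulli_pmf p) True = min 1 (max 0 p)"
    by (subst e) simp
  show "pmf (bernoulli_pmf p) False = 1 - min 1 (max 0 p)"
    by (subst e) simp
qed

lemma pmf_bernoulli_measurable [measurable]: "(\<lambda>p. pmf (bernoulli_pmf p) c) \<in> borel_measurable borel"
proof -
  show ?thesis by (cases c) (simp_all add: pmf_bernoulli_clip)
qed

lemma env_component [measurable]: "(\<lambda>w. w p) \<in> borel_measurable (environment a b)"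
proof -
  have "(\<lambda>w. w p) \<in> environment a b \<rightarrow>\<^sub>M beta_distribution a b"
    unfolding environment_def by (rule measurable_component_singleton) simp
  then show ?thesis by (simp cong: measurable_cong_sets)
qed

lemma hit_prob_measurable [measurable]: "(\<lambda>w. hit_prob w x z) \<in> borel_measurable (environment a b)"
proof -
  have "(\<lambda>w. reach_prob w n x z) \<in> borel_measurable (environment a b)" for n
    by (induction n arbitrary: x) auto
  then show ?thesis by (simp add: hit_prob_eq)
qed

lemma reach_prob_0: "fst z < fst x \<or> snd z < snd x \<Longrightarrow> reach_prob w n x z = 0"
  by (induction n arbitrary: x) auto

text \<open>In reversed coordinates the two recursions coincide. On the axes the second term of the
  walk's recursion vanishes by \<open>reach_prob_0\<close>, as a coordinate that has overshot the
  target never comes back.\<close>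

lemma reach_prob_point_hit:
  assumes w: "unit_valued w"
  shows "reach_prob w (i + j) (int z1 - int i, int z2 - int j) (int z1, int z2) = point_hit (env_weights z1 z2 w) i j"
proof -
  have p: "pmf (bernoulli_pmf (w x)) True = w x" "pmf (bernoulli_pmf (w x)) False = 1 - w x" for x
  proof -
    have "0 < w x" "w x < 1" using w unfolding unit_valued_def by blast+
    then show "pmf (bernoulli_pmf (w x)) True = w x" "pmf (bernoulli_pmf (w x)) False = 1 - w x" by auto
  qed
  show ?thesis
  proof (induction "env_weights z1 z2 w" i j rule: point_hit.induct)
    case (2 i)
    then show ?case by (simp add: p env_weights_def reach_prob_0)
  next
    case (3 j)
    then show ?case by (simp add: p env_weights_def reach_prob_0)
  next
    case (4 i j)
    then show ?case by (simp add: p env_weights_def)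
  qed simp
qed

lemma hit_prob_point_hit:
  assumes "unit_valued w"
  shows "hit_prob w 0 (int z1, int z2) = point_hit (env_weights z1 z2 w) z1 z2"
    and "1 \<le> z1 \<Longrightarrow> hit_prob w e1 (int z1, int z2) = point_hit (env_weights z1 z2 w) (z1 - 1) z2"
proof -
  show "hit_prob w 0 (int z1, int z2) = point_hit (env_weights z1 z2 w) z1 z2"
    using reach_prob_point_hit[OF assms, of z1 z2 z1 z2]
    by (simp add: hit_prob_eq norm1_def zero_prod_def nat_add_distrib)
  assume "1 \<le> z1"
  then have "nat (norm1 ((int z1, int z2) - e1)) = (z1 - 1) + z2" "int z1 - int (z1 - 1) = 1"
    by (auto simp: norm1_def)
  then show "hit_prob w e1 (int z1, int z2) = point_hit (env_weights z1 z2 w) (z1 - 1) z2"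
    using reach_prob_point_hit[OF assms, of "z1 - 1" z2 z1 z2] by (simp add: hit_prob_eq)
qed

section \<open>Almost sure limits along a direction\<close>

lemma beta_density_comparison:
  assumes "0 < l1" "l1 \<le> l2" "0 < c"
  shows "beta_density l2 c x \<le> Beta l1 c / Beta l2 c * beta_density l1 c x"
proof (cases "0 < x \<and> x < 1")
  case True
  have B: "0 < Beta l1 c" "0 < Beta l2 c" using assms by (auto intro: Beta_real_pos)
  have "x powr (l2 - 1) \<le> x powr (l1 - 1)" using True assms by (intro powr_mono') auto
  then have "x powr (l2 - 1) * (1 - x) powr (c - 1) / Beta l2 c \<le> x powr (l1 - 1) * (1 - x) powr (c - 1) / Beta l2 c"
    using B by (intro divide_right_mono mult_right_mono) auto
  also have "\<dots> = Beta l1 c / Beta l2 c * (x powr (l1 - 1) * (1 - x) powr (c - 1) / Beta l1 c)"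
    using B by simp
  finally show ?thesis using True by (simp add: beta_density_def)
qed (auto simp: beta_density_def)

text \<open>Domination of the density of the ratio variable passes to the law of the Doob weight.
  The constant tends to 1 as the parameters approach each other, and this one-sided inequality
  provides the continuity for limits from either side.\<close>

lemma kappa_measure_comparison:
  assumes "0 < a" "0 < b" "0 < l1" "l1 \<le> l2" and S: "S \<in> sets borel"
  shows "measure (kappa_measure a b l2) S \<le> Beta l1 (a + b) / Beta l2 (a + b) * measure (kappa_measure a b l1) S"
proof -
  note [measurable] = S
  have l2: "0 < l2" using assms by simp
  let ?c = "Beta l1 (a + b) / Beta l2 (a + b)"
  have c: "0 < ?c" using assms by (intro divide_pos_pos Beta_real_pos) auto
  have e: "emeasure (kappa_measure a b l) S = (\<integral>\<^sup>+x. \<integral>\<^sup>+y. ennreal (beta_density a b x * beta_density l (a + b) y)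
      * indicator S (kappa_of x y) \<partial>lborel \<partial>lborel)" if "0 < l" for l
  proof -
    have "emeasure (kappa_measure a b l) S = (\<integral>\<^sup>+x. indicator S x \<partial>kappa_measure a b l)" using S by simp
    also have "\<dots> = (\<integral>\<^sup>+x. indicator S x \<partial>distr (beta_distribution a b \<Otimes>\<^sub>M beta_distribution l (a + b)) borel (\<lambda>p. kappa_of (fst p) (snd p)))"
      using assms that by (simp add: distr_kappa_of kappa_measure_def)
    also have "\<dots> = (\<integral>\<^sup>+p. indicator S (kappa_of (fst p) (snd p)) \<partial>(beta_distribution a b \<Otimes>\<^sub>M beta_distribution l (a + b)))"
      by (subst nn_integral_distr) auto
    also have "\<dots> = (\<integral>\<^sup>+x. \<integral>\<^sup>+y. ennreal (beta_density a b x * beta_density l (a + b) y)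
      * indicator S (kappa_of x y) \<partial>lborel \<partial>lborel)"
      using assms that by (subst nn_integral_beta_pair) auto
    finally show ?thesis .
  qed
  have "emeasure (kappa_measure a b l2) S \<le> (\<integral>\<^sup>+x. \<integral>\<^sup>+y. ennreal ?c * (ennreal (beta_density a b x * beta_density l1 (a + b) y)
      * indicator S (kappa_of x y)) \<partial>lborel \<partial>lborel)"
    unfolding e[OF l2]
  proof (intro nn_integral_mono)
    fix x y
    have "beta_density a b x * beta_density l2 (a + b) y \<le> beta_density a b x * (?c * beta_density l1 (a + b) y)"
      using assms by (intro mult_left_mono beta_density_comparison beta_density_nonneg) auto
    then have "ennreal (beta_density a b x * beta_density l2 (a + b) y) \<le> ennreal ?c * ennreal (beta_density a b x * beta_density l1 (a + b) y)"
      using c by (subst ennreal_mult'[symmetric]) (auto intro!: ennreal_leI simp: mult_ac)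
    then show "ennreal (beta_density a b x * beta_density l2 (a + b) y) * indicator S (kappa_of x y)
        \<le> ennreal ?c * (ennreal (beta_density a b x * beta_density l1 (a + b) y) * indicator S (kappa_of x y))"
      by (auto simp: indicator_def)
  qed
  also have "\<dots> = ennreal ?c * emeasure (kappa_measure a b l1) S"
    unfolding e[OF assms(3)] by (simp add: nn_integral_cmult)
  finally have le: "emeasure (kappa_measure a b l2) S \<le> ennreal ?c * emeasure (kappa_measure a b l1) S" .
  interpret K1: prob_space "kappa_measure a b l1" using assms by (intro prob_space_kappa_measure)
  interpret K2: prob_space "kappa_measure a b l2" using assms by (intro prob_space_kappa_measure) auto
  have "ennreal (measure (kappa_measure a b l2) S) \<le> ennreal (?c * measure (kappa_measure a b l1) S)"
    using le c unfolding K1.emeasure_eq_measure K2.emeasure_eq_measure by (subst ennreal_mult) auto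
  then show ?thesis
    using mult_nonneg_nonneg[OF less_imp_le[OF c] measure_nonneg[of "kappa_measure a b l1" S]]
    by (subst (asm) ennreal_le_iff) auto
qed

lemma real_distribution_kappa_measure:
  assumes "0 < a" "0 < b" "0 < l" shows "real_distribution (kappa_measure a b l)"
  using prob_space_kappa_measure[OF assms]
  by (simp add: real_distribution_def real_distribution_axioms_def kappa_measure_def)

lemma isCont_cdf_kappa_measure:
  assumes "0 < a" "0 < b" "0 < l" shows "isCont (cdf (kappa_measure a b l)) x"
proof -
  interpret real_distribution "kappa_measure a b l" using assms by (rule real_distribution_kappa_measure)
  have [measurable]: "kappa_density a b l \<in> borel_measurable borel" using assms by (rule kappa_density_measurable)
  have "emeasure (kappa_measure a b l) {x} = (\<integral>\<^sup>+y. ennreal (kappa_density a b l y) * indicator {x} y \<partial>lborel)"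
    unfolding kappa_measure_def by (subst emeasure_density) auto
  also have "\<dots> = (\<integral>\<^sup>+y. 0 \<partial>(lborel :: real measure))"
  proof (intro nn_integral_cong_AE)
    show "AE y in lborel. ennreal (kappa_density a b l y) * indicator {x} y = 0"
      using AE_lborel_singleton[of x] by eventually_elim auto
  qed
  finally have "measure (kappa_measure a b l) {x} = 0" by (simp add: measure_def)
  then show ?thesis by (simp add: isCont_cdf)
qed

lemma tendsto_Beta_ratio:
  assumes "0 < l" "0 < (c::real)"
  shows "((\<lambda>k. Beta l c / Beta k c) \<longlongrightarrow> 1) (at l within A)" and "((\<lambda>k. Beta k c / Beta l c) \<longlongrightarrow> 1) (at l within A)"
proof -
  have B: "0 < Beta l c" using assms by (rule Beta_real_pos)
  have "((\<lambda>k. Beta k c) has_field_derivative (Beta l c * (Digamma l - Digamma (l + c)))) (at l within A)"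
    using assms by (intro derivative_intros) (auto simp: not_nonpos_Ints_real add_pos_pos)
  then have t: "((\<lambda>k. Beta k c) \<longlongrightarrow> Beta l c) (at l within A)"
    using DERIV_continuous by (auto simp: continuous_within)
  show "((\<lambda>k. Beta l c / Beta k c) \<longlongrightarrow> 1) (at l within A)"
    using tendsto_divide[OF tendsto_const[of "Beta l c"] t] B by simp
  show "((\<lambda>k. Beta k c / Beta l c) \<longlongrightarrow> 1) (at l within A)"
    using tendsto_divide[OF t tendsto_const[of "Beta l c"]] B by simp
qed

section \<open>Cones around a direction\<close>

definition site_kappa :: "nat \<times> nat \<Rightarrow> env \<Rightarrow> real" where
  "site_kappa z w = hit_kappa (env_weights (fst z) (snd z) w) (fst z) (snd z)"

lemma site_kappa_measurable [measurable]: "site_kappa z \<in> borel_measurable (environment a b)"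
  unfolding site_kappa_def[abs_def] env_weights_def[abs_def] by measurable

lemma prob_space_environment: "0 < a \<Longrightarrow> 0 < b \<Longrightarrow> prob_space (environment a b)"
  unfolding environment_def by (intro prob_space_PiM prob_space_beta_distribution)

lemma AE_environment: "0 < a \<Longrightarrow> 0 < b \<Longrightarrow> AE w in environment a b. unit_valued w"
  unfolding unit_valued_def AE_all_countable environment_def
  by (intro allI AE_PiM_component prob_space_beta_distribution AE_beta_distribution) auto

text \<open>One index controls both the least distance and the angular tolerance. The sets decrease
  in k and form a countable base for going to infinity in the direction (t, 1 - t).\<close>

definition dcone :: "real \<Rightarrow> nat \<Rightarrow> (nat \<times> nat) set" where
  "dcone t k = {(z1, z2). 1 \<le> z1 \<and> 1 \<le> z2 \<and> k \<le> z1 + z2 \<and>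
     \<bar>real z1 - t * real (z1 + z2)\<bar> \<le> real (z1 + z2) / real (Suc k)}"

lemma dcone_mono: "k \<le> k' \<Longrightarrow> dcone t k' \<subseteq> dcone t k"
proof -
  assume k: "k \<le> k'"
  have "real (z1 + z2) / real (Suc k') \<le> real (z1 + z2) / real (Suc k)" for z1 z2
    using k by (intro divide_left_mono) auto
  then show ?thesis using k unfolding dcone_def by (auto intro: order_trans)
qed

lemma dcone_subset_cone:
  assumes "0 < e"
  shows "\<exists>k. \<forall>z\<in>dcone t k. \<exists>M. z \<in> direction_cone t e n M"
proof -
  obtain m where m: "1 / real (Suc m) < e" using assms nat_approx_posE by blast
  define k where "k = max m n"
  have "z \<in> direction_cone t e n (fst z + snd z)" if z: "z \<in> dcone t k" for z
  proof -
    have "real (fst z + snd z) / real (Suc k) \<le> real (fst z + snd z) * (1 / real (Suc m))"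
      by (simp add: k_def frac_le)
    also have "\<dots> \<le> real (fst z + snd z) * e" using m by (intro mult_left_mono) auto
    finally show ?thesis using z by (auto simp: dcone_def direction_cone_def k_def mult.commute)
  qed
  then show ?thesis by blast
qed

definition direction_site :: "real \<Rightarrow> nat \<Rightarrow> nat \<times> nat" where
  "direction_site t N = (nat \<lfloor>t * real N\<rfloor>, N - nat \<lfloor>t * real N\<rfloor>)"

lemma direction_site_in_dcone:
  assumes t: "0 < t" "t < 1"
  shows "\<forall>\<^sub>F N in sequentially. direction_site t N \<in> dcone t k"
proof -
  have "\<forall>\<^sub>F N in sequentially. 1 / t \<le> real N" "\<forall>\<^sub>F N in sequentially. 1 / (1 - t) \<le> real N"
    by (intro eventually_compose_filterlim[OF eventually_ge_at_top filterlim_real_sequentially])+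
  then show ?thesis using eventually_ge_at_top[of "Suc k"]
  proof eventually_elim
    case (elim N)
    have 1: "1 \<le> t * real N" using elim(1) t by (simp add: field_simps)
    have 2: "1 \<le> real N - t * real N" using elim(2) t by (simp add: field_simps)
    define m where "m = nat \<lfloor>t * real N\<rfloor>"
    have m: "real m \<le> t * real N" "t * real N < real m + 1" "1 \<le> m"
      using 1 by (auto simp: m_def) linarith+
    have mN: "m < N" using m 2 by linarith
    have "\<bar>real m - t * real N\<bar> \<le> 1" using m by linarith
    also have "1 \<le> real N / real (Suc k)" using elim(3) by (simp add: field_simps)
    finally have "\<bar>real m - t * real N\<bar> \<le> real N / real (Suc k)" .
    then show ?case using mN m elim(3) by (auto simp: direction_site_def dcone_def m_def[symmetric])
  qed
qed

lemma dcone_nonempty: "0 < t \<Longrightarrow> t < 1 \<Longrightarrow> dcone t k \<noteq> {}"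
  using eventually_happens'[OF sequentially_bot direction_site_in_dcone[of t k]] by auto

definition conv_along :: "real \<Rightarrow> env \<Rightarrow> real \<Rightarrow> bool" where
  "conv_along t w L \<longleftrightarrow> (\<forall>e>0. \<exists>k. \<forall>z\<in>dcone t k. \<bar>site_kappa z w - L\<bar> \<le> e)"

text \<open>Up to the case of equality: the lower limit along the cones lies below x. As a countable
  combination of events at single sites it is measurable.\<close>

definition often_less :: "real \<Rightarrow> real \<Rightarrow> env \<Rightarrow> bool" where
  "often_less t x w \<longleftrightarrow> (\<forall>k. \<exists>z\<in>dcone t k. site_kappa z w < x)"

definition often_greater :: "real \<Rightarrow> real \<Rightarrow> env \<Rightarrow> bool" where
  "often_greater t x w \<longleftrightarrow> (\<forall>k. \<exists>z\<in>dcone t k. x < site_kappa z w)"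

lemma often_measurable [measurable]:
  "Measurable.pred (environment a b) (often_less t x)"
  "Measurable.pred (environment a b) (often_greater t x)"
  unfolding often_less_def[abs_def] often_greater_def[abs_def] by measurable

text \<open>The capped cones increase with M, so a bound uniform in M passes to their union by
  continuity from below, and a sufficiently deep \<open>dcone\<close> lies in that union.\<close>

lemma env_unbounded_cone:
  assumes ab: "0 < a" "0 < b" and S: "S \<in> sets borel" and "0 < e"
    and bound: "\<And>M. measure (environment a b) {w \<in> space (environment a b). \<exists>z\<in>direction_cone t e n M. site_kappa z w \<in> S} \<le> B"
  shows "measure (environment a b) {w \<in> space (environment a b). \<forall>k. \<exists>z\<in>dcone t k. site_kappa z w \<in> S} \<le> B"
proof -
  let ?E = "environment a b"
  note [measurable] = S
  interpret prob_space ?E using ab by (rule prob_space_environment)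
  define A where "A M = {w \<in> space ?E. \<exists>z\<in>direction_cone t e n M. site_kappa z w \<in> S}" for M
  have [measurable]: "A M \<in> sets ?E" for M unfolding A_def by measurable
  have "incseq A" unfolding A_def by (auto simp: incseq_def direction_cone_def) (metis order_trans)
  then have "(\<lambda>M. measure ?E (A M)) \<longlonglongrightarrow> measure ?E (\<Union>M. A M)"
    by (intro finite_Lim_measure_incseq) auto
  then have U: "measure ?E (\<Union>M. A M) \<le> B"
    using bound by (intro LIMSEQ_le_const2) (auto simp: A_def)
  obtain k where k: "\<And>z. z \<in> dcone t k \<Longrightarrow> \<exists>M. z \<in> direction_cone t e n M" using dcone_subset_cone[OF \<open>0 < e\<close>] by blast
  have "measure ?E {w \<in> space ?E. \<forall>k. \<exists>z\<in>dcone t k. site_kappa z w \<in> S} \<le> measure ?E (\<Union>M. A M)"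
  proof (rule finite_measure_mono)
    show "{w \<in> space ?E. \<forall>k. \<exists>z\<in>dcone t k. site_kappa z w \<in> S} \<subseteq> (\<Union>M. A M)"
    proof
      fix w assume w: "w \<in> {w \<in> space ?E. \<forall>k. \<exists>z\<in>dcone t k. site_kappa z w \<in> S}"
      then obtain z where z: "z \<in> dcone t k" "site_kappa z w \<in> S" by blast
      obtain M where "z \<in> direction_cone t e n M" using k[OF z(1)] by auto
      with z w have "w \<in> A M" by (auto simp: A_def)
      then show "w \<in> (\<Union>M. A M)" by auto
    qed
    show "(\<Union>M. A M) \<in> sets ?E" by (rule sets.countable_UN) auto
  qed
  with U show ?thesis by simp
qed

section \<open>Lower and upper limits along the cones\<close>

context
  fixes a b l0 t :: real
  assumes pos: "0 < a" "0 < b" "0 < l0" and t: "0 < t" "t < 1" "t = psi_ratio a b l0"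
begin

interpretation E: prob_space "environment a b" using pos(1,2) by (rule prob_space_environment)
interpretation K: real_distribution "kappa_measure a b l0" using pos by (rule real_distribution_kappa_measure)

lemma often_less_bound_eps:
  assumes l: "l0 < l" and eps: "0 < eps" "eps < 1"
  shows "measure (environment a b) {w \<in> space (environment a b). often_less t x w}
    \<le> measure (kappa_measure a b l) {..< x / (1 - eps)} + eps"
proof -
  \<comment> \<open>Above l0 the drift decreases, so a parameter between l0 and l has a larger drift
    than l.\<close>
  define u where "u = (l0 + l) / 2"
  have u: "0 < u" "u < l" "l0 < u" using l pos by (auto simp: u_def)
  have dr: "drift a b t l < drift a b t u"
    unfolding drift_def using u by (intro drift_strict_antimono[OF pos t(3)]) auto
  obtain e n where e: "0 < e" and B: "\<And>M x. measure (coupling_measure a b u l) {f \<in> space (coupling_measure a b u l).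
      \<exists>z\<in>direction_cone t e n M. hit_kappa (cell_weights M (fst z) (snd z) (\<lambda>p. fst (f p))) (fst z) (snd z) < x}
    \<le> measure (kappa_measure a b l) {..< x / (1 - eps)} + eps"
    using coupling_hit_lower[OF pos(1,2) u(1,2) t(1,2) dr eps] by blast
  have "measure (environment a b) {w \<in> space (environment a b). \<forall>k. \<exists>z\<in>dcone t k. site_kappa z w \<in> {..<x}}
      \<le> measure (kappa_measure a b l) {..< x / (1 - eps)} + eps"
  proof (rule env_unbounded_cone[OF pos(1,2) _ e])
    fix M
    have "measure (environment a b) {w \<in> space (environment a b). \<exists>z\<in>direction_cone t e n M. site_kappa z w \<in> {..<x}}
      = measure (coupling_measure a b u l) {f \<in> space (coupling_measure a b u l). \<exists>z\<in>direction_cone t e n M.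
          hit_kappa (cell_weights M (fst z) (snd z) (\<lambda>p. fst (f p))) (fst z) (snd z) \<in> {..<x}}"
      unfolding site_kappa_def
    proof (rule env_box_transfer[OF pos(1,2)])
      show "prob_space (coupling_law a b u l p)" for p by (rule coupling_law_props(2)[OF pos(1,2) u(1,2)])
      show "fst \<in> borel_measurable (coupling_law a b u l (Suc i, Suc j))" for i j
        using coupling_law_props(1)[OF pos(1,2) u(1,2)] by (simp cong: measurable_cong_sets)
      show "distr (coupling_law a b u l (Suc i, Suc j)) borel fst = beta_distribution a b" for i j
        using coupling_law_props(3)[OF pos(1,2) u(1,2), of "(Suc i, Suc j)"] by (simp add: stat_law_def)
    qed simp
    then show "measure (environment a b) {w \<in> space (environment a b). \<exists>z\<in>direction_cone t e n M. site_kappa z w \<in> {..<x}}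
      \<le> measure (kappa_measure a b l) {..< x / (1 - eps)} + eps"
      using B[of M x] by simp
  qed simp
  then show ?thesis by (simp add: often_less_def)
qed

lemma often_greater_bound_eps:
  assumes l: "0 < l" "l < l0" and eps: "0 < eps" "eps < 1"
  shows "measure (environment a b) {w \<in> space (environment a b). often_greater t x w}
    \<le> measure (kappa_measure a b l) {1 - (1 - x) / (1 - eps) <..} + eps"
proof -
  \<comment> \<open>Below l0 the drift increases, so again a parameter between l and l0 has a larger
    drift than l.\<close>
  define u where "u = (l0 + l) / 2"
  have u: "l < u" "u < l0" using l pos by (auto simp: u_def)
  have dr: "drift a b t l < drift a b t u"
    unfolding drift_def using u l by (intro drift_strict_mono[OF pos t(3)]) auto
  obtain e n where e: "0 < e" and B: "\<And>M x. measure (coupling_measure a b l u) {f \<in> space (coupling_measure a b l u).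
      \<exists>z\<in>direction_cone t e n M. x < hit_kappa (cell_weights M (fst z) (snd z) (\<lambda>p. snd (f p))) (fst z) (snd z)}
    \<le> measure (kappa_measure a b l) {1 - (1 - x) / (1 - eps) <..} + eps"
    using coupling_hit_upper[OF pos(1,2) l(1) u(1) t(1,2) dr eps] by blast
  have "measure (environment a b) {w \<in> space (environment a b). \<forall>k. \<exists>z\<in>dcone t k. site_kappa z w \<in> {x<..}}
      \<le> measure (kappa_measure a b l) {1 - (1 - x) / (1 - eps) <..} + eps"
  proof (rule env_unbounded_cone[OF pos(1,2) _ e])
    fix M
    have "measure (environment a b) {w \<in> space (environment a b). \<exists>z\<in>direction_cone t e n M. site_kappa z w \<in> {x<..}}
      = measure (coupling_measure a b l u) {f \<in> space (coupling_measure a b l u). \<exists>z\<in>direction_cone t e n M.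
          hit_kappa (cell_weights M (fst z) (snd z) (\<lambda>p. snd (f p))) (fst z) (snd z) \<in> {x<..}}"
      unfolding site_kappa_def
    proof (rule env_box_transfer[OF pos(1,2)])
      show "prob_space (coupling_law a b l u p)" for p by (rule coupling_law_props(2)[OF pos(1,2) l(1) u(1)])
      show "snd \<in> borel_measurable (coupling_law a b l u (Suc i, Suc j))" for i j
        using coupling_law_props(1)[OF pos(1,2) l(1) u(1)] by (simp cong: measurable_cong_sets)
      show "distr (coupling_law a b l u (Suc i, Suc j)) borel snd = beta_distribution a b" for i j
        using coupling_law_props(4)[OF pos(1,2) l(1) u(1), of "(Suc i, Suc j)"] by (simp add: stat_law_def)
    qed simp
    then show "measure (environment a b) {w \<in> space (environment a b). \<exists>z\<in>direction_cone t e n M. site_kappa z w \<in> {x<..}}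
      \<le> measure (kappa_measure a b l) {1 - (1 - x) / (1 - eps) <..} + eps"
      using B[of M x] by simp
  qed simp
  then show ?thesis by (simp add: often_greater_def)
qed

text \<open>The limits are taken from the inside out: l to l0 by comparison of the laws, then eps to
  0, where y > x leaves room for the factor 1 / (1 - eps), and last y to x by continuity of the
  distribution function.\<close>

lemma often_less_bound:
  "measure (environment a b) {w \<in> space (environment a b). often_less t x w} \<le> cdf (kappa_measure a b l0) x"
proof -
  let ?P = "measure (environment a b) {w \<in> space (environment a b). often_less t x w}"
  let ?K = "kappa_measure a b"
  have y: "?P \<le> cdf (?K l0) y" if xy: "x < y" for y
  proof -
    have e: "?P \<le> cdf (?K l0) y + eps" if eps: "0 < eps" "eps < 1" "x / (1 - eps) < y" for eps
    proof -
      have "?P \<le> Beta l0 (a + b) / Beta l (a + b) * cdf (?K l0) y + eps" if l: "l0 < l" for l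
      proof -
        interpret L: prob_space "?K l" using pos l by (intro prob_space_kappa_measure) auto
        have "?P \<le> measure (?K l) {..< x / (1 - eps)} + eps" by (rule often_less_bound_eps[OF l eps(1,2)])
        also have "measure (?K l) {..< x / (1 - eps)} \<le> measure (?K l) {..y}"
          using eps by (intro L.finite_measure_mono) auto
        also have "\<dots> \<le> Beta l0 (a + b) / Beta l (a + b) * measure (?K l0) {..y}"
          using pos l by (intro kappa_measure_comparison) auto
        finally show ?thesis by (simp add: cdf_def)
      qed
      then have ev: "\<forall>\<^sub>F l in at_right l0. ?P \<le> Beta l0 (a + b) / Beta l (a + b) * cdf (?K l0) y + eps"
        by (auto simp: eventually_at_right[of l0 "l0 + 1"] intro!: exI[of _ "l0 + 1"])
      have "((\<lambda>l. Beta l0 (a + b) / Beta l (a + b) * cdf (?K l0) y + eps) \<longlongrightarrow> 1 * cdf (?K l0) y + eps) (at_right l0)"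
        using pos by (intro tendsto_intros tendsto_Beta_ratio) auto
      from tendsto_lowerbound[OF this ev] show ?thesis by simp
    qed
    have "((\<lambda>eps. x / (1 - eps)) \<longlongrightarrow> x / (1 - 0)) (at_right 0)" by (intro tendsto_intros) auto
    then have "\<forall>\<^sub>F eps in at_right 0. x / (1 - eps) < y" using xy by (intro order_tendstoD) auto
    moreover have "\<forall>\<^sub>F eps in at_right 0. 0 < eps \<and> eps < (1::real)"
      by (auto simp: eventually_at_right[of 0 1] intro!: exI[of _ 1])
    ultimately have ev: "\<forall>\<^sub>F eps in at_right 0. ?P \<le> cdf (?K l0) y + eps"
      by eventually_elim (use e in auto)
    have "((\<lambda>eps. cdf (?K l0) y + eps) \<longlongrightarrow> cdf (?K l0) y + 0) (at_right 0)" by (intro tendsto_intros)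
    from tendsto_lowerbound[OF this ev] show ?thesis by simp
  qed
  have ev: "\<forall>\<^sub>F y in at_right x. ?P \<le> cdf (?K l0) y"
    using y by (auto simp: eventually_at_right[of x "x + 1"] intro!: exI[of _ "x + 1"])
  have "(cdf (?K l0) \<longlongrightarrow> cdf (?K l0) x) (at_right x)"
    using isCont_cdf_kappa_measure[OF pos, of x] by (auto simp: isCont_def intro: filterlim_mono at_le)
  from tendsto_lowerbound[OF this ev] show ?thesis by simp
qed

lemma often_greater_bound:
  "measure (environment a b) {w \<in> space (environment a b). often_greater t x w} \<le> 1 - cdf (kappa_measure a b l0) x"
proof -
  let ?P = "measure (environment a b) {w \<in> space (environment a b). often_greater t x w}"
  let ?K = "kappa_measure a b"
  have y: "?P \<le> 1 - cdf (?K l0) y" if xy: "y < x" for y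
  proof -
    have e: "?P \<le> 1 - cdf (?K l0) y + eps" if eps: "0 < eps" "eps < 1" "y < 1 - (1 - x) / (1 - eps)" for eps
    proof -
      \<comment> \<open>For l < l0 the comparison bounds the law at l0 by the one at l. Multiplying
        the estimate by its constant allows it to be inserted, and the constant tends to 1.\<close>
      have "(?P - 1 - eps) * (Beta l (a + b) / Beta l0 (a + b)) + cdf (?K l0) y \<le> 0" if l: "0 < l" "l < l0" for l
      proof -
        interpret L: real_distribution "?K l" using pos l by (intro real_distribution_kappa_measure) auto
        let ?c = "Beta l (a + b) / Beta l0 (a + b)"
        have c: "0 < ?c" using pos l by (intro divide_pos_pos Beta_real_pos) auto
        have "?P \<le> measure (?K l) {1 - (1 - x) / (1 - eps) <..} + eps" by (rule often_greater_bound_eps[OF l eps(1,2)])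
        also have "measure (?K l) {1 - (1 - x) / (1 - eps) <..} \<le> measure (?K l) (space (?K l) - {..y})"
          using eps by (intro L.finite_measure_mono) auto
        also have "\<dots> = 1 - measure (?K l) {..y}" by (rule L.prob_compl) auto
        finally have "?P - 1 - eps \<le> - measure (?K l) {..y}" by simp
        then have "(?P - 1 - eps) * ?c \<le> - measure (?K l) {..y} * ?c" using c by (intro mult_right_mono) auto
        moreover have "measure (?K l0) {..y} \<le> ?c * measure (?K l) {..y}"
          using pos l by (intro kappa_measure_comparison) auto
        ultimately show ?thesis by (simp add: cdf_def mult.commute)
      qed
      then have ev: "\<forall>\<^sub>F l in at_left l0. (?P - 1 - eps) * (Beta l (a + b) / Beta l0 (a + b)) + cdf (?K l0) y \<le> 0"
        using pos by (auto simp: eventually_at_left[of 0 l0] intro!: exI[of _ 0])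
      have "((\<lambda>l. (?P - 1 - eps) * (Beta l (a + b) / Beta l0 (a + b)) + cdf (?K l0) y) \<longlongrightarrow> (?P - 1 - eps) * 1 + cdf (?K l0) y) (at_left l0)"
        using pos by (intro tendsto_intros tendsto_Beta_ratio) auto
      from tendsto_upperbound[OF this ev] show ?thesis by simp
    qed
    have "((\<lambda>eps. 1 - (1 - x) / (1 - eps)) \<longlongrightarrow> 1 - (1 - x) / (1 - 0)) (at_right 0)" by (intro tendsto_intros) auto
    then have "\<forall>\<^sub>F eps in at_right 0. y < 1 - (1 - x) / (1 - eps)" using xy by (intro order_tendstoD) auto
    moreover have "\<forall>\<^sub>F eps in at_right 0. 0 < eps \<and> eps < (1::real)"
      by (auto simp: eventually_at_right[of 0 1] intro!: exI[of _ 1])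
    ultimately have ev: "\<forall>\<^sub>F eps in at_right 0. ?P \<le> 1 - cdf (?K l0) y + eps"
      by eventually_elim (use e in auto)
    have "((\<lambda>eps. 1 - cdf (?K l0) y + eps) \<longlongrightarrow> 1 - cdf (?K l0) y + 0) (at_right 0)" by (intro tendsto_intros)
    from tendsto_lowerbound[OF this ev] show ?thesis by simp
  qed
  have ev: "\<forall>\<^sub>F y in at_left x. ?P \<le> 1 - cdf (?K l0) y"
    using y by (auto simp: eventually_at_left[of "x - 1" x] intro!: exI[of _ "x - 1"])
  have "(cdf (?K l0) \<longlongrightarrow> cdf (?K l0) x) (at_left x)"
    using isCont_cdf_kappa_measure[OF pos, of x] by (auto simp: isCont_def intro: filterlim_mono at_le)
  then have "((\<lambda>y. 1 - cdf (?K l0) y) \<longlongrightarrow> 1 - cdf (?K l0) x) (at_left x)" by (intro tendsto_intros)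
  from tendsto_lowerbound[OF this ev] show ?thesis by simp
qed


lemma often_trichotomy:
  assumes "x < y" shows "often_less t y w \<or> often_greater t x w"
proof (rule ccontr)
  assume "\<not> ?thesis"
  then obtain k k' where k: "\<And>z. z \<in> dcone t k \<Longrightarrow> y \<le> site_kappa z w" "\<And>z. z \<in> dcone t k' \<Longrightarrow> site_kappa z w \<le> x"
    by (auto simp: often_less_def often_greater_def not_less)
  obtain z where z: "z \<in> dcone t (max k k')" using dcone_nonempty[OF t(1,2)] by blast
  then have "z \<in> dcone t k" "z \<in> dcone t k'" using dcone_mono[of k "max k k'" t] dcone_mono[of k' "max k k'" t] by auto
  with k[of z] assms show False by auto
qed

text \<open>For x < u < y the events \<open>often_less\<close> at u and \<open>often_greater\<close>
  at x cover the whole space, so their intersection has probability at most cdf u + (1 - cdf x) - 1.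
  It contains the event in question, and u can decrease to x.\<close>

lemma often_both_null:
  assumes "x < y"
  shows "AE w in environment a b. \<not> (often_less t x w \<and> often_greater t y w)"
proof -
  let ?E = "environment a b"
  let ?B = "{w \<in> space ?E. often_less t x w \<and> often_greater t y w}"
  have "measure ?E ?B \<le> cdf (kappa_measure a b l0) u - cdf (kappa_measure a b l0) x" if u: "x < u" "u < y" for u
  proof -
    let ?L = "{w \<in> space ?E. often_less t u w}" and ?G = "{w \<in> space ?E. often_greater t x w}"
    have "measure ?E ?B \<le> measure ?E (?L \<inter> ?G)"
      using u by (intro E.finite_measure_mono) (auto simp: often_less_def often_greater_def, force+)
    also have "\<dots> = measure ?E ?L + measure ?E ?G - measure ?E (?L \<union> ?G)"
      by (subst E.finite_measure_Union') (auto simp: E.finite_measure_Diff' Int_commute)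
    also have "?L \<union> ?G = space ?E" using often_trichotomy[OF u(1)] by auto
    finally show ?thesis
      using often_less_bound[of u] often_greater_bound[of x] by (simp add: E.prob_space)
  qed
  then have ev: "\<forall>\<^sub>F u in at_right x. measure ?E ?B \<le> cdf (kappa_measure a b l0) u - cdf (kappa_measure a b l0) x"
    using assms by (auto simp: eventually_at_right[of x y] intro!: exI[of _ y])
  have "(cdf (kappa_measure a b l0) \<longlongrightarrow> cdf (kappa_measure a b l0) x) (at_right x)"
    using isCont_cdf_kappa_measure[OF pos, of x] by (auto simp: isCont_def intro: filterlim_mono at_le)
  then have "((\<lambda>u. cdf (kappa_measure a b l0) u - cdf (kappa_measure a b l0) x) \<longlongrightarrow> cdf (kappa_measure a b l0) x - cdf (kappa_measure a b l0) x) (at_right x)"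
    by (intro tendsto_intros)
  from tendsto_lowerbound[OF this ev] have "measure ?E ?B = 0" using measure_nonneg[of ?E ?B] by simp
  then show ?thesis by (subst AE_iff_measurable[OF _ refl]) (auto simp: E.emeasure_eq_measure)
qed

lemma site_kappa_bounds:
  assumes w: "unit_valued w" and z: "z \<in> dcone t k"
  shows "0 < site_kappa z w" "site_kappa z w < 1"
proof -
  obtain i j where ij: "z = (Suc i, Suc j)" using z by (cases z; cases "fst z"; cases "snd z") (auto simp: dcone_def)
  have u: "0 < env_weights (fst z) (snd z) w i j \<and> env_weights (fst z) (snd z) w i j < 1" for i j
    using w unfolding unit_valued_def env_weights_def by blast
  have p: "0 < point_hit (env_weights (fst z) (snd z) w) i j" for i j using u by (rule point_hit_pos)
  show "0 < site_kappa z w"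
    using u p unfolding site_kappa_def hit_kappa_def by (intro divide_pos_pos mult_pos_pos) auto
  have "0 < 1 - site_kappa z w"
    using hit_kappa_compl[of "env_weights (fst z) (snd z) w" i j, OF u] u p unfolding site_kappa_def
    by (simp add: ij del: point_hit.simps)
  then show "site_kappa z w < 1" by simp
qed

text \<open>The null sets of \<open>often_both_null\<close> are collected over rational pairs. The
  limit is the infimum L of all x with \<open>often_less\<close>, and a rational pair between L and
  L + e excludes a larger upper limit.\<close>

lemma conv_along_AE: "AE w in environment a b. \<exists>L. conv_along t w L"
proof -
  have "AE w in environment a b. \<forall>q r. q < r \<longrightarrow> \<not> (often_less t (of_rat q) w \<and> often_greater t (of_rat r) w)"
    unfolding AE_all_countable by (intro allI AE_impI often_both_null) (simp add: of_rat_less)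
  with AE_environment[OF pos(1,2)] show ?thesis
  proof eventually_elim
    case (elim w)
    define S where "S = {x. often_less t x w}"
    have S1: "2 \<in> S"
    proof -
      have "\<exists>z\<in>dcone t k. site_kappa z w < 2" for k
      proof -
        obtain z where z: "z \<in> dcone t k" using dcone_nonempty[OF t(1,2)] by blast
        with site_kappa_bounds(2)[OF elim(1) z] show ?thesis by force
      qed
      then show ?thesis by (simp add: S_def often_less_def)
    qed
    have S0: "0 \<le> x" if "x \<in> S" for x
    proof -
      obtain z where z: "z \<in> dcone t 0" "site_kappa z w < x" using \<open>x \<in> S\<close> unfolding S_def often_less_def by blast
      with site_kappa_bounds(1)[OF elim(1) z(1)] show ?thesis by simp
    qed
    have bdd: "bdd_below S" using S0 by (rule bdd_belowI)
    define L where "L = Inf S"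
    have "\<exists>k. \<forall>z\<in>dcone t k. \<bar>site_kappa z w - L\<bar> \<le> e" if e: "0 < e" for e
    proof -
      have "L - e \<notin> S" using cInf_lower[OF _ bdd, of "L - e"] e by (auto simp: L_def)
      then obtain k1 where k1: "\<And>z. z \<in> dcone t k1 \<Longrightarrow> L - e \<le> site_kappa z w"
        by (auto simp: S_def often_less_def not_less)
      obtain q where q: "L < of_rat q" "of_rat q < L + e / 2" using of_rat_dense[of L "L + e / 2"] e by auto
      obtain r where r: "of_rat q < (of_rat r :: real)" "of_rat r < L + e" using of_rat_dense[of "of_rat q" "L + e"] e q by auto
      obtain s where s: "s \<in> S" "s < of_rat q" using cInf_lessD[of S "of_rat q"] S1 q by (auto simp: L_def)
      then have "often_less t (of_rat q) w" unfolding S_def often_less_def by force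
      then have "\<not> often_greater t (of_rat r) w" using elim(2) r(1) by (auto simp: of_rat_less)
      then obtain k2 where k2: "\<And>z. z \<in> dcone t k2 \<Longrightarrow> site_kappa z w \<le> of_rat r"
        by (auto simp: often_greater_def not_less)
      show ?thesis
      proof (intro exI[of _ "max k1 k2"] ballI)
        fix z assume "z \<in> dcone t (max k1 k2)"
        then have "z \<in> dcone t k1" "z \<in> dcone t k2" using dcone_mono[of k1 "max k1 k2" t] dcone_mono[of k2 "max k1 k2" t] by auto
        then show "\<bar>site_kappa z w - L\<bar> \<le> e" using k1[of z] k2[of z] r by auto
      qed
    qed
    then show ?case unfolding conv_along_def by blast
  qed
qed

text \<open>The distribution function of L is squeezed: L \<le> x implies \<open>often_less\<close>
  at every y > x, and L > x implies \<open>often_greater\<close> at x. The two bounds meet because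
  the limiting distribution function is continuous.\<close>

lemma site_kappa_limit:
  "\<exists>L \<in> borel_measurable (environment a b). (AE w in environment a b. conv_along t w (L w)) \<and>
     distr (environment a b) borel L = kappa_measure a b l0"
proof -
  let ?E = "environment a b"
  \<comment> \<open>A fixed sequence of sites makes measurability evident; almost surely L is the
    limit along the cones.\<close>
  define L where "L w = lim (\<lambda>N. site_kappa (direction_site t N) w)" for w
  have L [measurable]: "L \<in> borel_measurable ?E" unfolding L_def by measurable
  have c: "AE w in ?E. conv_along t w (L w)"
    using conv_along_AE
  proof eventually_elim
    case (elim w)
    then obtain c where c: "conv_along t w c" by blast
    have "(\<lambda>N. site_kappa (direction_site t N) w) \<longlonglongrightarrow> c"
    proof (rule LIMSEQ_I)
      fix e :: real assume "0 < e"
      then obtain k where k: "\<And>z. z \<in> dcone t k \<Longrightarrow> \<bar>site_kappa z w - c\<bar> \<le> e / 2"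
        using c unfolding conv_along_def by (meson half_gt_zero)
      obtain N0 where "\<And>N. N0 \<le> N \<Longrightarrow> direction_site t N \<in> dcone t k"
        using direction_site_in_dcone[OF t(1,2), of k] by (auto simp: eventually_sequentially)
      then have "norm (site_kappa (direction_site t n) w - c) < e" if "N0 \<le> n" for n
        using k[of "direction_site t n"] \<open>0 < e\<close> that by simp
      then show "\<exists>no. \<forall>n\<ge>no. norm (site_kappa (direction_site t n) w - c) < e" by blast
    qed
    then have "L w = c" unfolding L_def by (rule limI)
    with c show ?case by simp
  qed
  have nl: "often_less t x w" if cv: "conv_along t w (L w)" and lt: "L w < x" for x w
    unfolding often_less_def
  proof
    fix k
    have "0 < (x - L w) / 2" using lt by simp
    then obtain k' where k': "\<And>z. z \<in> dcone t k' \<Longrightarrow> \<bar>site_kappa z w - L w\<bar> \<le> (x - L w) / 2"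
      using cv unfolding conv_along_def by blast
    obtain z where z: "z \<in> dcone t (max k k')" using dcone_nonempty[OF t(1,2)] by blast
    then have zz: "z \<in> dcone t k" "z \<in> dcone t k'" using dcone_mono[of k "max k k'" t] dcone_mono[of k' "max k k'" t] by auto
    have "site_kappa z w < x" using abs_le_D1[OF k'[OF zz(2)]] lt by (simp add: field_simps)
    with zz show "\<exists>z\<in>dcone t k. site_kappa z w < x" by blast
  qed
  have ng: "often_greater t x w" if cv: "conv_along t w (L w)" and lt: "x < L w" for x w
    unfolding often_greater_def
  proof
    fix k
    have "0 < (L w - x) / 2" using lt by simp
    then obtain k' where k': "\<And>z. z \<in> dcone t k' \<Longrightarrow> \<bar>site_kappa z w - L w\<bar> \<le> (L w - x) / 2"
      using cv unfolding conv_along_def by blast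
    obtain z where z: "z \<in> dcone t (max k k')" using dcone_nonempty[OF t(1,2)] by blast
    then have zz: "z \<in> dcone t k" "z \<in> dcone t k'" using dcone_mono[of k "max k k'" t] dcone_mono[of k' "max k k'" t] by auto
    have "x < site_kappa z w" using abs_le_D2[OF k'[OF zz(2)]] lt by (simp add: field_simps)
    with zz show "\<exists>z\<in>dcone t k. x < site_kappa z w" by blast
  qed
  interpret D: real_distribution "distr ?E borel L" by (rule E.real_distribution_distr) measurable
  have cdfL: "cdf (distr ?E borel L) x = measure ?E {w \<in> space ?E. L w \<le> x}" for x
    by (simp add: cdf_def measure_distr vimage_def Int_def conj_commute)
  have "cdf (distr ?E borel L) x = cdf (kappa_measure a b l0) x" for x
  proof (rule antisym)
    have le: "cdf (distr ?E borel L) x \<le> cdf (kappa_measure a b l0) y" if "x < y" for y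
    proof -
      have "cdf (distr ?E borel L) x \<le> measure ?E {w \<in> space ?E. often_less t y w}"
        unfolding cdfL
      proof (rule E.finite_measure_mono_AE)
        show "AE w in ?E. w \<in> {w \<in> space ?E. L w \<le> x} \<longrightarrow> w \<in> {w \<in> space ?E. often_less t y w}"
          using c by eventually_elim (use nl that in auto)
      qed measurable
      with often_less_bound[of y] show ?thesis by simp
    qed
    have ev: "\<forall>\<^sub>F y in at_right x. cdf (distr ?E borel L) x \<le> cdf (kappa_measure a b l0) y"
      using le by (auto simp: eventually_at_right[of x "x + 1"] intro!: exI[of _ "x + 1"])
    have "(cdf (kappa_measure a b l0) \<longlongrightarrow> cdf (kappa_measure a b l0) x) (at_right x)"
      using isCont_cdf_kappa_measure[OF pos, of x] by (auto simp: isCont_def intro: filterlim_mono at_le)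
    from tendsto_lowerbound[OF this ev] show "cdf (distr ?E borel L) x \<le> cdf (kappa_measure a b l0) x" by simp
    have "measure ?E (space ?E - {w \<in> space ?E. L w \<le> x}) \<le> measure ?E {w \<in> space ?E. often_greater t x w}"
    proof (rule E.finite_measure_mono_AE)
      show "AE w in ?E. w \<in> space ?E - {w \<in> space ?E. L w \<le> x} \<longrightarrow> w \<in> {w \<in> space ?E. often_greater t x w}"
        using c by eventually_elim (use ng in auto)
    qed measurable
    moreover have "measure ?E (space ?E - {w \<in> space ?E. L w \<le> x}) = 1 - measure ?E {w \<in> space ?E. L w \<le> x}"
      by (rule E.prob_compl) measurable
    ultimately show "cdf (kappa_measure a b l0) x \<le> cdf (distr ?E borel L) x"
      using often_greater_bound[of x] by (simp add: cdfL)
  qed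
  then have "distr ?E borel L = kappa_measure a b l0"
    by (intro cdf_unique D.real_distribution_axioms K.real_distribution_axioms ext)
  with c L show ?thesis by blast
qed

end

section \<open>Busemann functions\<close>

definition site :: "nat \<times> nat \<Rightarrow> int \<times> int" where
  "site p = (int (fst p), int (snd p))"

text \<open>This replaces the uncountably many sequences in the definition of
  \<open>busemann\<close> by countably many sets of sites.\<close>

lemma goes_in_direction_iff:
  assumes t: "0 < t" "t < 1"
  shows "goes_in_direction (t, 1 - t) z \<longleftrightarrow> (\<forall>k. \<forall>\<^sub>F N in sequentially. z N \<in> site ` dcone t k)"
proof
  assume g: "goes_in_direction (t, 1 - t) z"
  have lim: "filterlim (\<lambda>N. norm1 (z N)) at_top sequentially"
    and c: "(\<lambda>N. (real_of_int (fst (z N)) / real_of_int (norm1 (z N)), real_of_int (snd (z N)) / real_of_int (norm1 (z N)))) \<longlonglongrightarrow> (t, 1 - t)"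
    using g by (auto simp: goes_in_direction_def)
  have c1: "(\<lambda>N. real_of_int (fst (z N)) / real_of_int (norm1 (z N))) \<longlonglongrightarrow> t"
    and c2: "(\<lambda>N. real_of_int (snd (z N)) / real_of_int (norm1 (z N))) \<longlonglongrightarrow> 1 - t"
    using tendsto_fst[OF c] tendsto_snd[OF c] by auto
  show "\<forall>k. \<forall>\<^sub>F N in sequentially. z N \<in> site ` dcone t k"
  proof
    fix k
    have "\<forall>\<^sub>F N in sequentially. int (Suc k) \<le> norm1 (z N)" using lim by (simp add: filterlim_at_top)
    moreover have "\<forall>\<^sub>F N in sequentially. 0 < real_of_int (fst (z N)) / real_of_int (norm1 (z N))"
      using c1 t by (intro order_tendstoD) auto
    moreover have "\<forall>\<^sub>F N in sequentially. 0 < real_of_int (snd (z N)) / real_of_int (norm1 (z N))"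
      using order_tendstoD(1)[OF c2, of 0] t by simp
    moreover have "\<forall>\<^sub>F N in sequentially. \<bar>real_of_int (fst (z N)) / real_of_int (norm1 (z N)) - t\<bar> < 1 / real (Suc k)"
      using tendstoD[OF c1, of "1 / real (Suc k)"] by (simp add: dist_real_def)
    ultimately show "\<forall>\<^sub>F N in sequentially. z N \<in> site ` dcone t k"
    proof eventually_elim
      case (elim N)
      obtain x y where z: "z N = (x, y)" by (cases "z N")
      define n where "n = norm1 (z N)"
      have n: "0 < n" "int (Suc k) \<le> n" using elim(1) by (auto simp: n_def)
      have nz: "norm1 (x, y) = n" by (simp add: n_def z)
      have x: "0 < x" and y: "0 < y" using elim(2,3) n(1) by (auto simp: z nz zero_less_divide_iff)
      have nxy: "n = x + y" using x y by (simp add: n_def z norm1_def)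
      have "\<bar>real_of_int x - t * real_of_int n\<bar> = \<bar>real_of_int x / real_of_int n - t\<bar> * real_of_int n"
      proof -
        have "real_of_int x - t * real_of_int n = (real_of_int x / real_of_int n - t) * real_of_int n"
          using n(1) by (simp add: left_diff_distrib)
        then show ?thesis using n(1) by (simp only: abs_mult abs_of_pos of_int_0_less_iff)
      qed
      also have "\<dots> \<le> 1 / real (Suc k) * real_of_int n"
        using elim(4) n(1) by (intro mult_right_mono) (auto simp: z nz)
      finally have "\<bar>real_of_int x - t * real_of_int n\<bar> \<le> real_of_int n / real (Suc k)" by simp
      then have "(nat x, nat y) \<in> dcone t k"
        using x y n(2) by (auto simp: dcone_def nxy)
      moreover have "z N = site (nat x, nat y)" using x y by (simp add: z site_def)
      ultimately show ?case by blast
    qed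
  qed
next
  assume ev: "\<forall>k. \<forall>\<^sub>F N in sequentially. z N \<in> site ` dcone t k"
  have n1: "norm1 (site p) = int (fst p + snd p)" for p by (simp add: norm1_def site_def)
  have b: "\<bar>real_of_int (fst (site p)) / real_of_int (norm1 (site p)) - t\<bar> \<le> 1 / real (Suc k)
      \<and> real_of_int (snd (site p)) / real_of_int (norm1 (site p)) = 1 - real_of_int (fst (site p)) / real_of_int (norm1 (site p))"
    if p: "p \<in> dcone t k" for p k
  proof -
    define n where "n = real (fst p + snd p)"
    have n: "0 < n" using p by (auto simp: dcone_def n_def)
    have "\<bar>real (fst p) - t * n\<bar> \<le> n / real (Suc k)" using p by (auto simp: dcone_def n_def)
    then have "\<bar>real (fst p) - t * n\<bar> / n \<le> (n / real (Suc k)) / n" using n by (intro divide_right_mono) auto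
    moreover have "\<bar>real (fst p) - t * n\<bar> / n = \<bar>real (fst p) / n - t\<bar>"
    proof -
      have "real (fst p) / n - t = (real (fst p) - t * n) / n"
        using n by (simp add: diff_divide_distrib)
      then show ?thesis by (simp only: abs_divide abs_of_pos[OF n])
    qed
    ultimately have "\<bar>real (fst p) / n - t\<bar> \<le> 1 / real (Suc k)" using n by simp
    moreover have "real (snd p) / n = 1 - real (fst p) / n" using n by (simp add: n_def field_simps)
    moreover have "real_of_int (fst (site p)) = real (fst p)" "real_of_int (snd (site p)) = real (snd p)"
        "real_of_int (norm1 (site p)) = n"
      unfolding n1 by (simp_all add: site_def n_def)
    ultimately show ?thesis by simp
  qed
  have lim: "filterlim (\<lambda>N. norm1 (z N)) at_top sequentially"
    unfolding filterlim_at_top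
  proof
    fix Z :: int
    show "\<forall>\<^sub>F N in sequentially. Z \<le> norm1 (z N)"
      using ev[rule_format, of "nat Z"] by eventually_elim (auto simp: n1 dcone_def)
  qed
  have e: "\<forall>\<^sub>F N in sequentially. \<bar>real_of_int (fst (z N)) / real_of_int (norm1 (z N)) - t\<bar> < e" if "0 < e" for e
  proof -
    obtain k where k: "1 / real (Suc k) < e" using \<open>0 < e\<close> nat_approx_posE by blast
    show ?thesis using ev[rule_format, of k]
    proof eventually_elim
      case (elim N)
      then obtain p where p: "p \<in> dcone t k" "z N = site p" by blast
      show ?case using b[OF p(1)] k p(2) by auto
    qed
  qed
  have c1: "(\<lambda>N. real_of_int (fst (z N)) / real_of_int (norm1 (z N))) \<longlonglongrightarrow> t"
    using e by (intro tendstoI) (simp add: dist_real_def)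
  then have "(\<lambda>N. 1 - real_of_int (fst (z N)) / real_of_int (norm1 (z N))) \<longlonglongrightarrow> 1 - t"
    by (intro tendsto_intros)
  moreover have "\<forall>\<^sub>F N in sequentially. 1 - real_of_int (fst (z N)) / real_of_int (norm1 (z N)) = real_of_int (snd (z N)) / real_of_int (norm1 (z N))"
    using ev[rule_format, of 0]
  proof eventually_elim
    case (elim N)
    then obtain p where p: "p \<in> dcone t 0" "z N = site p" by blast
    show ?case using b[OF p(1)] p(2) by auto
  qed
  ultimately have "(\<lambda>N. real_of_int (snd (z N)) / real_of_int (norm1 (z N))) \<longlonglongrightarrow> 1 - t"
    by (rule Lim_transform_eventually)
  with c1 lim show "goes_in_direction (t, 1 - t) z"
    by (auto simp: goes_in_direction_def intro!: tendsto_Pair)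
qed

section \<open>Existence and measurability of the common limit\<close>

definition log_ratio :: "nat \<times> nat \<Rightarrow> env \<Rightarrow> real" where
  "log_ratio p w = ln (hit_prob w 0 (site p)) - ln (hit_prob w e1 (site p))"

text \<open>Equivalent to the existence of a \<open>common_limit\<close>, but phrased with countably
  many sites, hence measurable in the environment.\<close>

definition cauchy_along :: "real \<Rightarrow> env \<Rightarrow> bool" where
  "cauchy_along t w \<longleftrightarrow> (\<forall>m. \<exists>k. \<forall>p\<in>dcone t k. \<forall>q\<in>dcone t k. \<bar>log_ratio p w - log_ratio q w\<bar> < 1 / real (Suc m))"

lemma log_ratio_measurable [measurable]: "log_ratio p \<in> borel_measurable (environment a b)"
  unfolding log_ratio_def[abs_def] by measurable

lemma cauchy_along_measurable [measurable]: "Measurable.pred (environment a b) (cauchy_along t)"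
  unfolding cauchy_along_def[abs_def] by measurable

definition common_limit :: "real \<Rightarrow> env \<Rightarrow> real \<Rightarrow> bool" where
  "common_limit t w c \<longleftrightarrow> (\<forall>z. goes_in_direction (t, 1 - t) z \<longrightarrow>
     (\<lambda>N. ln (hit_prob w 0 (z N)) - ln (hit_prob w e1 (z N))) \<longlonglongrightarrow> c)"

lemma goes_direction_site:
  assumes "0 < t" "t < 1" shows "goes_in_direction (t, 1 - t) (\<lambda>N. site (direction_site t N))"
  unfolding goes_in_direction_iff[OF assms]
proof
  fix k
  show "\<forall>\<^sub>F N in sequentially. site (direction_site t N) \<in> site ` dcone t k"
    using direction_site_in_dcone[OF assms, of k] by eventually_elim auto
qed

lemma common_limit_unique:
  assumes t: "0 < t" "t < 1" and c: "common_limit t w c"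
  shows "busemann (t, 1 - t) 0 e1 w = c" "(\<lambda>N. log_ratio (direction_site t N) w) \<longlonglongrightarrow> c"
proof -
  show l: "(\<lambda>N. log_ratio (direction_site t N) w) \<longlonglongrightarrow> c"
    using c goes_direction_site[OF t] by (auto simp: common_limit_def log_ratio_def)
  have "(THE c. common_limit t w c) = c"
  proof (rule the_equality[where P = "common_limit t w"])
    fix d assume "common_limit t w d"
    then have "(\<lambda>N. log_ratio (direction_site t N) w) \<longlonglongrightarrow> d"
      using goes_direction_site[OF t] by (auto simp: common_limit_def log_ratio_def)
    with l show "d = c" by (rule LIMSEQ_unique[rotated])
  qed (rule c)
  then show "busemann (t, 1 - t) 0 e1 w = c" by (simp add: busemann_def common_limit_def)
qed

lemma cauchy_along_imp_common_limit:
  assumes t: "0 < t" "t < 1" and w: "cauchy_along t w"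
  shows "common_limit t w (lim (\<lambda>N. log_ratio (direction_site t N) w))"
proof -
  let ?s = "\<lambda>N. log_ratio (direction_site t N) w"
  have "Cauchy ?s"
  proof (rule metric_CauchyI)
    fix e :: real assume "0 < e"
    then obtain m where m: "1 / real (Suc m) < e" using nat_approx_posE by blast
    obtain k where k: "\<And>p q. p \<in> dcone t k \<Longrightarrow> q \<in> dcone t k \<Longrightarrow> \<bar>log_ratio p w - log_ratio q w\<bar> < 1 / real (Suc m)"
      using w unfolding cauchy_along_def by blast
    obtain N0 where N0: "\<And>N. N0 \<le> N \<Longrightarrow> direction_site t N \<in> dcone t k"
      using direction_site_in_dcone[OF t, of k] by (auto simp: eventually_sequentially)
    have "dist (?s i) (?s j) < e" if "N0 \<le> i" "N0 \<le> j" for i j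
      using k[OF N0[OF that(1)] N0[OF that(2)]] m by (simp add: dist_real_def)
    then show "\<exists>M. \<forall>i\<ge>M. \<forall>j\<ge>M. dist (?s i) (?s j) < e" by blast
  qed
  then have L: "?s \<longlonglongrightarrow> lim ?s" by (simp add: Cauchy_convergent_iff convergent_LIMSEQ_iff)
  have "(\<lambda>N. ln (hit_prob w 0 (z N)) - ln (hit_prob w e1 (z N))) \<longlonglongrightarrow> lim ?s"
    if z: "goes_in_direction (t, 1 - t) z" for z
  proof -
    have "(\<lambda>N. (ln (hit_prob w 0 (z N)) - ln (hit_prob w e1 (z N))) - ?s N) \<longlonglongrightarrow> 0"
    proof (rule tendstoI)
      fix e :: real assume "0 < e"
      then obtain m where m: "1 / real (Suc m) < e" using nat_approx_posE by blast
      obtain k where k: "\<And>p q. p \<in> dcone t k \<Longrightarrow> q \<in> dcone t k \<Longrightarrow> \<bar>log_ratio p w - log_ratio q w\<bar> < 1 / real (Suc m)"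
        using w unfolding cauchy_along_def by blast
      have "\<forall>\<^sub>F N in sequentially. z N \<in> site ` dcone t k" using z goes_in_direction_iff[OF t] by blast
      then show "\<forall>\<^sub>F N in sequentially. dist ((ln (hit_prob w 0 (z N)) - ln (hit_prob w e1 (z N))) - ?s N) 0 < e"
        using direction_site_in_dcone[OF t, of k]
      proof eventually_elim
        case (elim N)
        then obtain p where p: "p \<in> dcone t k" "z N = site p" by blast
        have "ln (hit_prob w 0 (z N)) - ln (hit_prob w e1 (z N)) = log_ratio p w" by (simp add: p(2) log_ratio_def)
        then show ?case using k[OF p(1) elim(2)] m by (simp add: dist_real_def)
      qed
    qed
    from tendsto_add[OF this L] show ?thesis by simp
  qed
  then show ?thesis by (simp add: common_limit_def)
qed

text \<open>Otherwise there are sites p k and q k in the k-th cone whose values stay a fixed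
  distance apart, although both sequences go in the direction and must share the limit.\<close>

lemma common_limit_imp_cauchy_along:
  assumes t: "0 < t" "t < 1" and c: "common_limit t w c"
  shows "cauchy_along t w"
proof (rule ccontr)
  assume "\<not> cauchy_along t w"
  then obtain m where "\<forall>k. \<exists>p\<in>dcone t k. \<exists>q\<in>dcone t k. 1 / real (Suc m) \<le> \<bar>log_ratio p w - log_ratio q w\<bar>"
    unfolding cauchy_along_def by (meson not_less)
  then obtain p q where pq: "\<And>k. p k \<in> dcone t k" "\<And>k. q k \<in> dcone t k"
      "\<And>k. 1 / real (Suc m) \<le> \<bar>log_ratio (p k) w - log_ratio (q k) w\<bar>" by metis
  have lim: "(\<lambda>k. log_ratio (s k) w) \<longlonglongrightarrow> c" if s: "\<And>k. s k \<in> dcone t k" for s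
  proof -
    have "goes_in_direction (t, 1 - t) (\<lambda>k. site (s k))"
      unfolding goes_in_direction_iff[OF t]
    proof
      fix k
      show "\<forall>\<^sub>F N in sequentially. site (s N) \<in> site ` dcone t k"
        using eventually_ge_at_top[of k] by eventually_elim (use s dcone_mono in blast)
    qed
    then show ?thesis using c by (auto simp: common_limit_def log_ratio_def)
  qed
  have "(\<lambda>k. log_ratio (p k) w - log_ratio (q k) w) \<longlonglongrightarrow> c - c"
    by (intro tendsto_diff lim pq)
  then have "(\<lambda>k. \<bar>log_ratio (p k) w - log_ratio (q k) w\<bar>) \<longlonglongrightarrow> 0"
    using tendsto_rabs_zero by simp
  then have "1 / real (Suc m) \<le> 0"
    using pq(3) by (intro LIMSEQ_le_const) auto
  then show False by simp
qed

text \<open>Where no common limit exists, the description ranges over the empty predicate and has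
  one constant value. So the function is measurable as it stands, without changing it on a null
  set.\<close>

lemma busemann_eq:
  assumes t: "0 < t" "t < 1"
  shows "busemann (t, 1 - t) 0 e1 w =
    (if cauchy_along t w then lim (\<lambda>N. log_ratio (direction_site t N) w) else (THE c. False))"
proof (cases "cauchy_along t w")
  case True
  then show ?thesis using common_limit_unique(1)[OF t cauchy_along_imp_common_limit[OF t True]] by simp
next
  case False
  then have "common_limit t w = (\<lambda>c. False)" using common_limit_imp_cauchy_along[OF t] by blast
  then have "(THE c. common_limit t w c) = (THE c. False)" by simp
  then show ?thesis using False by (simp add: busemann_def common_limit_def)
qed

lemma doob_kappa_measurable:
  assumes t: "0 < t" "t < 1"
  shows "doob_kappa (t, 1 - t) 0 e1 \<in> borel_measurable (environment a b)"
proof -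
  have "doob_kappa (t, 1 - t) 0 e1 = (\<lambda>w. w 0 * exp (- (if cauchy_along t w then lim (\<lambda>N. log_ratio (direction_site t N) w) else (THE c. False))))"
    by (auto simp: fun_eq_iff doob_kappa_def edge_weight_def busemann_eq[OF t])
  also have "\<dots> \<in> borel_measurable (environment a b)" by measurable
  finally show ?thesis .
qed

section \<open>Identification of the Doob transform with the limit\<close>

text \<open>\<open>site_kappa\<close> is the weight of the origin times the quotient of the hitting
  probabilities from e1 and from 0. Taking logarithms, the Busemann value is ln (w 0) - ln L, and
  the factor w 0 in the Doob transform cancels.\<close>

lemma doob_kappa_eq_limit:
  assumes t: "0 < t" "t < 1" and w: "unit_valued w" and c: "conv_along t w L" and L: "0 < L"
  shows "doob_kappa (t, 1 - t) 0 e1 w = L"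
proof -
  have w0: "0 < w 0" using w unfolding unit_valued_def by blast
  have lr: "log_ratio p w = ln (w 0) - ln (site_kappa p w)" if p: "p \<in> dcone t k" for p k
  proof -
    obtain z1 z2 where z: "p = (z1, z2)" "1 \<le> z1" "1 \<le> z2" using p by (cases p) (auto simp: dcone_def)
    have u: "0 < env_weights z1 z2 w i j \<and> env_weights z1 z2 w i j < 1" for i j
      using w unfolding unit_valued_def env_weights_def by blast
    have pos: "0 < point_hit (env_weights z1 z2 w) i j" for i j using u by (rule point_hit_pos)
    have h: "hit_prob w 0 (site p) = point_hit (env_weights z1 z2 w) z1 z2"
      "hit_prob w e1 (site p) = point_hit (env_weights z1 z2 w) (z1 - 1) z2"
      using hit_prob_point_hit[OF w] z by (simp_all add: site_def)
    have "site_kappa p w = w 0 * hit_prob w e1 (site p) / hit_prob w 0 (site p)"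
      unfolding h by (simp add: site_kappa_def hit_kappa_def z env_weights_def zero_prod_def)
    then show ?thesis
      using w0 pos[of z1 z2] pos[of "z1 - 1" z2] unfolding log_ratio_def h by (simp add: ln_mult ln_div)
  qed
  have "common_limit t w (ln (w 0) - ln L)"
    unfolding common_limit_def
  proof (intro allI impI)
    fix z assume z: "goes_in_direction (t, 1 - t) z"
    then have ev: "\<forall>\<^sub>F N in sequentially. z N \<in> site ` dcone t k" for k using goes_in_direction_iff[OF t] by blast
    define s where "s N = (nat (fst (z N)), nat (snd (z N)))" for N
    have s: "\<forall>\<^sub>F N in sequentially. z N = site (s N) \<and> s N \<in> dcone t k" for k
      using ev[of k] by eventually_elim (auto simp: s_def site_def)
    have "(\<lambda>N. site_kappa (s N) w) \<longlonglongrightarrow> L"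
    proof (rule tendstoI)
      fix e :: real assume "0 < e"
      then obtain k where k: "\<And>z. z \<in> dcone t k \<Longrightarrow> \<bar>site_kappa z w - L\<bar> \<le> e / 2"
        using c unfolding conv_along_def by (meson half_gt_zero)
      show "\<forall>\<^sub>F N in sequentially. dist (site_kappa (s N) w) L < e"
        using s[of k]
      proof eventually_elim
        case (elim N)
        then have "\<bar>site_kappa (s N) w - L\<bar> \<le> e / 2" by (intro k) simp
        then show ?case using \<open>0 < e\<close> by (simp add: dist_real_def)
      qed
    qed
    then have "(\<lambda>N. ln (w 0) - ln (site_kappa (s N) w)) \<longlonglongrightarrow> ln (w 0) - ln L"
      using L by (intro tendsto_intros) auto
    moreover have "\<forall>\<^sub>F N in sequentially. ln (w 0) - ln (site_kappa (s N) w) = ln (hit_prob w 0 (z N)) - ln (hit_prob w e1 (z N))"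
      using s[of 0]
    proof eventually_elim
      case (elim N)
      then show ?case using lr[of "s N" 0] by (simp add: log_ratio_def)
    qed
    ultimately show "(\<lambda>N. ln (hit_prob w 0 (z N)) - ln (hit_prob w e1 (z N))) \<longlonglongrightarrow> ln (w 0) - ln L"
      by (rule Lim_transform_eventually)
  qed
  then have "busemann (t, 1 - t) 0 e1 w = ln (w 0) - ln L" by (rule common_limit_unique(1)[OF t])
  then show ?thesis using w0 L by (simp add: doob_kappa_def edge_weight_def exp_diff)
qed

lemma distr_doob_kappa:
  assumes ab: "0 < a" "0 < b" and t: "0 < t" "t < 1" and L [measurable]: "L \<in> borel_measurable (environment a b)"
    and c: "AE w in environment a b. conv_along t w (L w)" and Lpos: "AE w in environment a b. 0 < L w"
  shows "distr (environment a b) borel (doob_kappa (t, 1 - t) 0 e1) = distr (environment a b) borel L"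
proof (rule distr_cong_AE)
  show "AE w in environment a b. doob_kappa (t, 1 - t) 0 e1 w = L w"
    using AE_environment[OF ab] c Lpos by eventually_elim (rule doob_kappa_eq_limit[OF t])
qed (use doob_kappa_measurable[OF t] L in auto)

section \<open>Distribution of the Doob transform\<close>

lemma kappa_density_nonneg:
  assumes "0 < a" "0 < b" "0 < l" shows "0 \<le> kappa_density a b l x"
proof (cases "0 < x \<and> x < 1")
  case True
  have e: "2 * a + b + l = a + l + (a + b)" by simp
  have sm: "summable (\<lambda>k. pochhammer (a + l) k * pochhammer (a + l) k / pochhammer (a + l + (a + b)) k * (x ^ k / fact k))"
    using assms True by (intro hyp2F1_euler(2)) auto
  have "0 \<le> hyp2F1 (a + l) (a + l) (2 * a + b + l) x"
    unfolding hyp2F1_def e using assms True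
    by (intro suminf_nonneg[OF sm] mult_nonneg_nonneg divide_nonneg_nonneg pochhammer_nonneg) auto
  moreover have "0 < Beta (a + l) (a + b)" "0 < Beta (a + l) b" "0 < Beta l a"
    using assms by (auto intro!: Beta_real_pos)
  ultimately show ?thesis
    using True by (auto simp: kappa_density_def g_density_def intro!: mult_nonneg_nonneg)
qed (auto simp: kappa_density_def)

lemma AE_kappa_measure:
  assumes "0 < a" "0 < b" "0 < l" shows "AE x in kappa_measure a b l. 0 < x \<and> x < 1"
proof -
  have m: "(\<lambda>x. ennreal (kappa_density a b l x)) \<in> borel_measurable lborel"
    using measurable_compose[OF kappa_density_measurable[OF assms] measurable_ennreal] by simp
  show ?thesis unfolding kappa_measure_def AE_density[OF m]
    by (auto simp: kappa_density_def intro!: AE_I2 split: if_splits)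
qed

lemma continuous_on_beta_density:
  assumes "0 < p" "0 < q" shows "continuous_on {0<..<1} (beta_density p q)"
proof -
  have "continuous_on {0<..<1} (\<lambda>x. x powr (p - 1) * (1 - x) powr (q - 1) / Beta p q)"
    using less_imp_neq[OF Beta_real_pos[OF assms]] by (intro continuous_intros) auto
  then show ?thesis by (rule continuous_on_eq) (auto simp: beta_density_def)
qed

lemma kappa_measure_not_beta:
  assumes "0 < a" "0 < b" "0 < l" "0 < p" "0 < q"
  shows "kappa_measure a b l \<noteq> beta_distribution p q"
proof
  assume eq: "kappa_measure a b l = beta_distribution p q"
  interpret prob_space "kappa_measure a b l" using assms by (intro prob_space_kappa_measure)
  have "kappa_density a b l x = beta_density p q x" if "0 < x" "x < 1" for x
  proof (rule density_eq_imp_eq_on_open[where S = "{0<..<1}" and f = "kappa_density a b l" and g = "beta_density p q"])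
    show "finite_measure (density lborel (\<lambda>x. ennreal (kappa_density a b l x)))"
      using finite_measure_axioms by (simp add: kappa_measure_def)
    show "density lborel (\<lambda>x. ennreal (kappa_density a b l x)) = density lborel (\<lambda>x. ennreal (beta_density p q x))"
      using eq by (simp add: kappa_measure_def beta_distribution_def)
  qed (use assms that in \<open>auto intro: kappa_density_measurable kappa_density_nonneg beta_density_nonneg
        continuous_on_kappa_density continuous_on_beta_density\<close>)
  moreover obtain x where "0 < x" "x < 1" "g_density a b l x \<noteq> beta_density p q x"
    using g_density_not_beta[OF assms] by blast
  ultimately show False by (auto simp: kappa_density_def)
qed

section \<open>Reflection in the diagonal\<close>

definition reflect_env :: "env \<Rightarrow> env" where
  "reflect_env w p = 1 - w (prod.swap p)"

lemma distr_reflect_env: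
  assumes "0 < a" "0 < b"
  shows "reflect_env \<in> environment a b \<rightarrow>\<^sub>M environment b a"
    and "distr (environment a b) (environment b a) reflect_env = environment b a"
proof -
  have r: "reflect_env = (\<lambda>w. \<lambda>p\<in>UNIV. 1 - w (prod.swap p))" by (simp add: fun_eq_iff reflect_env_def)
  show "reflect_env \<in> environment a b \<rightarrow>\<^sub>M environment b a"
    unfolding environment_def[of b a]
  proof (rule measurable_PiM_UNIV)
    fix p
    have "(\<lambda>w. reflect_env w p) \<in> borel_measurable (environment a b)" unfolding reflect_env_def by measurable
    then show "(\<lambda>w. reflect_env w p) \<in> environment a b \<rightarrow>\<^sub>M beta_distribution b a"
      by (simp cong: measurable_cong_sets)
  qed
  show "distr (environment a b) (environment b a) reflect_env = environment b a"
    unfolding environment_def r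
  proof (rule distr_PiM_map)
    show "(-) 1 \<in> beta_distribution a b \<rightarrow>\<^sub>M beta_distribution b a"
      by (simp cong: measurable_cong_sets)
    show "distr (beta_distribution a b) (beta_distribution b a) ((-) 1) = beta_distribution b a"
      using distr_beta_reflect[OF assms] by (simp cong: distr_cong)
  qed (use assms in \<open>auto intro: prob_space_beta_distribution\<close>)
qed

text \<open>Reflection exchanges the two steps, so the horizontal transition probability of the
  reflected environment is the vertical one of the original.\<close>

lemma site_kappa_reflect:
  assumes w: "unit_valued w" and z: "z \<in> dcone t k"
  shows "site_kappa (prod.swap z) (reflect_env w) = 1 - site_kappa z w"
proof -
  obtain i j where ij: "z = (Suc i, Suc j)" using z by (cases z; cases "fst z"; cases "snd z") (auto simp: dcone_def)
  let ?W = "env_weights (Suc i) (Suc j) w"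
  have u: "0 < ?W i' j' \<and> ?W i' j' < 1" for i' j'
    using w unfolding unit_valued_def env_weights_def by blast
  have "env_weights (Suc j) (Suc i) (reflect_env w) = transp_weight ?W"
    by (simp add: fun_eq_iff env_weights_def reflect_env_def transp_weight_def)
  then have "site_kappa (prod.swap z) (reflect_env w) = hit_kappa (transp_weight ?W) (Suc j) (Suc i)"
    by (simp add: ij site_kappa_def)
  also have "\<dots> = (1 - ?W (Suc i) (Suc j)) * point_hit ?W (Suc i) j / point_hit ?W (Suc i) (Suc j)"
    unfolding hit_kappa_def point_hit_transp by (simp add: transp_weight_def)
  also have "\<dots> = 1 - hit_kappa ?W (Suc i) (Suc j)" by (rule hit_kappa_compl[OF u, symmetric])
  finally show ?thesis by (simp add: ij site_kappa_def)
qed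

lemma dcone_swap: "z \<in> dcone t k \<Longrightarrow> prod.swap z \<in> dcone (1 - t) k"
proof -
  assume z: "z \<in> dcone t k"
  have "real (snd z) - (1 - t) * real (snd z + fst z) = - (real (fst z) - t * real (fst z + snd z))"
    by (simp add: algebra_simps)
  then have "\<bar>real (snd z) - (1 - t) * real (snd z + fst z)\<bar> = \<bar>real (fst z) - t * real (fst z + snd z)\<bar>"
    by (simp only: abs_minus_cancel)
  then show ?thesis using z by (auto simp: dcone_def add.commute)
qed

lemma conv_along_reflect:
  assumes w: "unit_valued w" and c: "conv_along (1 - t) (reflect_env w) L"
  shows "conv_along t w (1 - L)"
  unfolding conv_along_def
proof (intro allI impI)
  fix e :: real assume "0 < e"
  then obtain k where k: "\<And>z. z \<in> dcone (1 - t) k \<Longrightarrow> \<bar>site_kappa z (reflect_env w) - L\<bar> \<le> e"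
    using c unfolding conv_along_def by blast
  have "\<bar>site_kappa z w - (1 - L)\<bar> \<le> e" if z: "z \<in> dcone t k" for z
    using k[OF dcone_swap[OF z]] unfolding site_kappa_reflect[OF w z] by linarith
  then show "\<exists>k. \<forall>z\<in>dcone t k. \<bar>site_kappa z w - (1 - L)\<bar> \<le> e" by blast
qed

lemma distr_doob_kappa_right:
  assumes pos: "0 < a" "0 < b" "0 < l" and t: "0 < t" "t < 1" "t = psi_ratio a b l"
  shows "distr (environment a b) borel (doob_kappa (t, 1 - t) 0 e1) = kappa_measure a b l"
proof -
  obtain L where L: "L \<in> borel_measurable (environment a b)" "AE w in environment a b. conv_along t w (L w)"
      "distr (environment a b) borel L = kappa_measure a b l"
    using site_kappa_limit[OF pos t] by blast
  have "AE x in distr (environment a b) borel L. 0 < x \<and> x < 1"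
    unfolding L(3) by (rule AE_kappa_measure[OF pos])
  then have "AE w in environment a b. 0 < L w \<and> L w < 1" by (rule AE_distrD[OF L(1)])
  then have "AE w in environment a b. 0 < L w" by eventually_elim auto
  from distr_doob_kappa[OF pos(1,2) t(1,2) L(1,2) this] show ?thesis by (simp add: L(3))
qed

text \<open>The reflected environment has parameters (b, a) and direction 1 - t, where
  \<open>site_kappa_limit\<close> applies; pulling back replaces the limit by its
  complement.\<close>

lemma distr_doob_kappa_left:
  assumes pos: "0 < a" "0 < b" "0 < l" and t: "0 < t" "t < 1" "1 - t = psi_ratio b a l"
  shows "distr (environment a b) borel (doob_kappa (t, 1 - t) 0 e1) = distr (kappa_measure b a l) borel (\<lambda>x. 1 - x)"
proof -
  have t': "0 < 1 - t" "1 - t < 1" using t by auto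
  obtain L where L [measurable]: "L \<in> borel_measurable (environment b a)" and c: "AE w in environment b a. conv_along (1 - t) w (L w)"
      and d: "distr (environment b a) borel L = kappa_measure b a l"
    using site_kappa_limit[OF pos(2,1,3) t' t(3)] by blast
  note r [measurable] = distr_reflect_env(1)[OF pos(1,2)]
  note dr = distr_reflect_env(2)[OF pos(1,2)]
  define L' where "L' w = 1 - L (reflect_env w)" for w
  have L' [measurable]: "L' \<in> borel_measurable (environment a b)"
    unfolding L'_def using measurable_compose[OF r L] by measurable
  have "AE w in distr (environment a b) (environment b a) reflect_env. conv_along (1 - t) w (L w)"
    unfolding dr by (rule c)
  then have "AE w in environment a b. conv_along (1 - t) (reflect_env w) (L (reflect_env w))"
    by (rule AE_distrD[OF r])
  with AE_environment[OF pos(1,2)] have c': "AE w in environment a b. conv_along t w (L' w)"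
    unfolding L'_def by eventually_elim (rule conv_along_reflect)
  have "AE x in distr (environment b a) borel L. 0 < x \<and> x < 1"
    unfolding d by (rule AE_kappa_measure[OF pos(2,1,3)])
  then have "AE w in environment b a. 0 < L w \<and> L w < 1" by (rule AE_distrD[OF L])
  then have "AE w in distr (environment a b) (environment b a) reflect_env. 0 < L w \<and> L w < 1" unfolding dr .
  then have "AE w in environment a b. 0 < L (reflect_env w) \<and> L (reflect_env w) < 1" by (rule AE_distrD[OF r])
  then have "AE w in environment a b. 0 < L' w" by eventually_elim (simp add: L'_def)
  from distr_doob_kappa[OF pos(1,2) t(1,2) L' c' this]
  have "distr (environment a b) borel (doob_kappa (t, 1 - t) 0 e1) = distr (environment a b) borel L'" .
  also have "\<dots> = distr (distr (environment a b) (environment b a) reflect_env) borel (\<lambda>w. 1 - L w)"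
    by (subst distr_distr[OF _ r]) (auto simp: comp_def L'_def[abs_def])
  also have "\<dots> = distr (environment b a) borel (\<lambda>w. 1 - L w)" unfolding dr ..
  also have "\<dots> = distr (distr (environment b a) borel L) borel (\<lambda>x. 1 - x)"
    by (subst distr_distr[OF _ L]) (auto simp: comp_def)
  finally show ?thesis unfolding d .
qed

lemma distr_reflect_density:
  fixes f :: "real \<Rightarrow> real"
  assumes [measurable]: "f \<in> borel_measurable borel"
  shows "distr (density lborel (\<lambda>x. ennreal (f x))) borel (\<lambda>x. 1 - x) = density lborel (\<lambda>x. ennreal (f (1 - x)))"
    (is "?L = ?R")
proof (rule measure_eqI)
  fix A assume "A \<in> sets ?L"
  then have A [measurable]: "A \<in> sets borel" by simp
  have "emeasure ?L A = (\<integral>\<^sup>+x. indicator A x \<partial>?L)" by simp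
  also have "\<dots> = (\<integral>\<^sup>+x. indicator A (1 - x) \<partial>density lborel (\<lambda>x. ennreal (f x)))"
    by (subst nn_integral_distr) auto
  also have "\<dots> = (\<integral>\<^sup>+x. ennreal (f x) * indicator A (1 - x) \<partial>lborel)"
    by (subst nn_integral_density) auto
  also have "\<dots> = (\<integral>\<^sup>+x. ennreal (f (1 + (-1) * x)) * indicator A (1 - (1 + (-1) * x)) \<partial>lborel)"
    by (subst nn_integral_real_affine[where c = "-1" and t = 1]) auto
  also have "\<dots> = emeasure ?R A" by (simp add: emeasure_density)
  finally show "emeasure ?L A = emeasure ?R A" .
qed simp

lemma g_tilde_density_reflect: "g_tilde_density a b l x = g_density b a l (1 - x)"
  by (simp add: g_tilde_density_def g_density_def add_ac mult_ac)

lemma distributed_lborel_iff: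
  "distributed M lborel X f \<longleftrightarrow>
    distr M borel X = density lborel f \<and> f \<in> borel_measurable borel \<and> X \<in> borel_measurable M"
proof -
  have "distr M lborel X = distr M borel X" by (rule distr_cong) auto
  then show ?thesis by (simp add: distributed_def)
qed

theorem theorem3p7:
  fixes \<alpha> \<beta> :: real and \<xi> :: "real \<times> real"
  assumes "0 < \<alpha>" and "0 < \<beta>" and "\<xi> \<in> ri_U - {xi_star \<alpha> \<beta>}"
  shows "(\<forall>a>0. \<forall>b>0. distr (environment \<alpha> \<beta>) borel (doob_kappa \<xi> 0 e1) \<noteq> beta_distribution a b) \<and>
    distributed (environment \<alpha> \<beta>) lborel (doob_kappa \<xi> 0 e1)
      (\<lambda>x. ennreal
         (if 0 < x \<and> x < 1
          then if fst (xi_star \<alpha> \<beta>) < fst \<xi>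
               then g_density \<alpha> \<beta> (lambda_of \<alpha> \<beta> \<xi>) x
               else g_tilde_density \<alpha> \<beta> (lambda_of \<alpha> \<beta> \<xi>) x
          else 0))"
proof -
  obtain t where xi: "\<xi> = (t, 1 - t)" and t: "0 < t" "t < 1"
    using assms(3) by (auto simp: ri_U_def)
  define l where "l = lambda_of \<alpha> \<beta> \<xi>"
  have star: "fst (xi_star \<alpha> \<beta>) = \<alpha> / (\<alpha> + \<beta>)" by (simp add: xi_star_def)
  have m: "doob_kappa \<xi> 0 e1 \<in> borel_measurable (environment \<alpha> \<beta>)"
    unfolding xi by (rule doob_kappa_measurable[OF t])
  show ?thesis
  proof (cases "\<alpha> / (\<alpha> + \<beta>) < t")
    case True
    have "l = (THE l. 0 < l \<and> t = psi_ratio \<alpha> \<beta> l)"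
      using True by (simp add: l_def lambda_of_def xi xi_star_def psi_ratio_def)
    then have l: "0 < l" "t = psi_ratio \<alpha> \<beta> l"
      using theI'[OF psi_ratio_unique_solution[OF assms(1,2) True t(2)]] by auto
    have d: "distr (environment \<alpha> \<beta>) borel (doob_kappa \<xi> 0 e1) = kappa_measure \<alpha> \<beta> l"
      unfolding xi by (rule distr_doob_kappa_right[OF assms(1,2) l(1) t l(2)])
    have f: "(\<lambda>x. ennreal (if 0 < x \<and> x < 1 then if fst (xi_star \<alpha> \<beta>) < fst \<xi> then g_density \<alpha> \<beta> l x
          else g_tilde_density \<alpha> \<beta> l x else 0)) = (\<lambda>x. ennreal (kappa_density \<alpha> \<beta> l x))"
      using True by (auto simp: star xi kappa_density_def)
    have "(\<lambda>x. ennreal (kappa_density \<alpha> \<beta> l x)) \<in> borel_measurable borel"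
      using kappa_density_measurable[OF assms(1,2) l(1)] by measurable
    then show ?thesis
      unfolding l_def[symmetric] f distributed_lborel_iff d
      using m kappa_measure_not_beta[OF assms(1,2) l(1)] by (auto simp: kappa_measure_def)
  next
    case False
    have "t \<noteq> \<alpha> / (\<alpha> + \<beta>)"
    proof
      assume "t = \<alpha> / (\<alpha> + \<beta>)"
      then have "\<xi> = xi_star \<alpha> \<beta>" using assms by (simp add: xi xi_star_def field_simps)
      with assms(3) show False by simp
    qed
    with False have "t < \<alpha> / (\<alpha> + \<beta>)" by simp
    moreover have "\<beta> / (\<beta> + \<alpha>) = 1 - \<alpha> / (\<alpha> + \<beta>)" using assms by (simp add: field_simps)
    ultimately have t': "\<beta> / (\<beta> + \<alpha>) < 1 - t" "1 - t < 1" using t by auto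
    \<comment> \<open>The equation for small t is the one for 1 - t with the two beta parameters
      exchanged.\<close>
    have "l = (THE l. 0 < l \<and> t = 1 - psi_ratio \<beta> \<alpha> l)"
      using False by (simp add: l_def lambda_of_def xi xi_star_def psi_ratio_def add.commute[of \<alpha> \<beta>])
    also have "\<dots> = (THE l. 0 < l \<and> 1 - t = psi_ratio \<beta> \<alpha> l)"
      by (rule arg_cong[where f = The]) (auto simp: fun_eq_iff)
    finally have l: "0 < l" "1 - t = psi_ratio \<beta> \<alpha> l"
      using theI'[OF psi_ratio_unique_solution[OF assms(2,1) t']] by auto
    have d: "distr (environment \<alpha> \<beta>) borel (doob_kappa \<xi> 0 e1) = distr (kappa_measure \<beta> \<alpha> l) borel (\<lambda>x. 1 - x)"
      unfolding xi by (rule distr_doob_kappa_left[OF assms(1,2) l(1) t l(2)])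
    note [measurable] = kappa_density_measurable[OF assms(2,1) l(1)]
    have d': "distr (kappa_measure \<beta> \<alpha> l) borel (\<lambda>x. 1 - x) = density lborel (\<lambda>x. ennreal (kappa_density \<beta> \<alpha> l (1 - x)))"
      unfolding kappa_measure_def by (rule distr_reflect_density) measurable
    have f: "(\<lambda>x. ennreal (if 0 < x \<and> x < 1 then if fst (xi_star \<alpha> \<beta>) < fst \<xi> then g_density \<alpha> \<beta> l x
          else g_tilde_density \<alpha> \<beta> l x else 0)) = (\<lambda>x. ennreal (kappa_density \<beta> \<alpha> l (1 - x)))"
      using False by (auto simp: star xi kappa_density_def g_tilde_density_reflect)
    \<comment> \<open>Reflection is an involution that maps beta laws to beta laws, so a beta law
      here would make the unreflected law a beta law too.\<close>
    have "distr (kappa_measure \<beta> \<alpha> l) borel (\<lambda>x. 1 - x) \<noteq> beta_distribution p q" if pq: "0 < p" "0 < q" for p q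
    proof
      assume eq: "distr (kappa_measure \<beta> \<alpha> l) borel (\<lambda>x. 1 - x) = beta_distribution p q"
      have "kappa_measure \<beta> \<alpha> l = distr (distr (kappa_measure \<beta> \<alpha> l) borel (\<lambda>x. 1 - x)) borel (\<lambda>x. 1 - x)"
      proof -
        have "(\<lambda>x::real. 1 - x) \<in> borel_measurable (kappa_measure \<beta> \<alpha> l)"
          by (subst measurable_cong_sets[OF sets_kappa_measure refl]) measurable
        then show ?thesis by (subst distr_distr) (auto simp: comp_def distr_id2)
      qed
      also have "\<dots> = beta_distribution q p" unfolding eq by (rule distr_beta_reflect[OF pq])
      finally show False using kappa_measure_not_beta[OF assms(2,1) l(1) pq(2,1)] by simp
    qed
    moreover have "(\<lambda>x. ennreal (kappa_density \<beta> \<alpha> l (1 - x))) \<in> borel_measurable borel" by measurable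
    ultimately show ?thesis
      unfolding l_def[symmetric] f distributed_lborel_iff d using m d' by auto
  qed
qed

end
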